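(* For every $n$ there exist an $n$-vertex plane graph $G$, a planar drawing $\mathcal{H}$ of the empty spanning subgraph $H=(V(G),\emptyset)$ of $G$, and an ordering $\sigma$ of the edges of $G$ such that every drawing of $G$ that greedily extends $\mathcal{H}$ with respect to $\sigma$ has an edge with $2^{\Omega(n)}$ bends.
   Context: Let $G$ be a plane graph (a planar graph with a fixed planar embedding), $H$ a spanning subgraph with a fixed straight-line planar drawing $\mathcal{H}$, and $\sigma=[e_1,\dots,e_m]$ an ordering of the edges of $G$ not in $H$. A drawing $\Gamma$ of $G$ greedily extends $\mathcal{H}$ with respect to $\sigma$ if it is obtained from $\mathcal{H}$ by drawing $e_1,\dots,e_m$ in this order, each $e_i$ as a polygonal curve that respects the embedding of $G$ (and is planar with respect to what is already drawn) and has the minimum possible number of bends given the previously drawn edges. *)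

theory Defs
  imports "HOL-Complex_Analysis.Winding_Numbers"
begin

definition simple_graph :: "nat set \<Rightarrow> nat set set \<Rightarrow> bool" where
  "simple_graph V E \<longleftrightarrow> finite V \<and> (\<forall>e\<in>E. e \<subseteq> V \<and> card e = 2)"

fun polyline :: "complex list \<Rightarrow> real \<Rightarrow> complex" where
  "polyline [] = (\<lambda>t. 0)"
| "polyline [a] = linepath a a"
| "polyline [a, b] = linepath a b"
| "polyline (a # b # c # rest) = linepath a b +++ polyline (b # c # rest)"

text \<open>A polyline drawing is given by vertex positions p and, for each edge e, the list of
  bend points bd e, listed from the endpoint Min e to the endpoint Max e.
  The number of bends of e is length (bd e).\<close>
definition edge_curve :: "(nat \<Rightarrow> complex) \<Rightarrow> (nat set \<Rightarrow> complex list) \<Rightarrow> nat set \<Rightarrow> real \<Rightarrow> complex" where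
  "edge_curve p bd e = polyline (p (Min e) # bd e @ [p (Max e)])"

definition planar_drawing :: "nat set \<Rightarrow> nat set set \<Rightarrow> (nat \<Rightarrow> complex) \<Rightarrow> (nat set \<Rightarrow> complex list) \<Rightarrow> bool" where
  "planar_drawing V F p bd \<longleftrightarrow>
     inj_on p V \<and>
     (\<forall>e\<in>F. arc (edge_curve p bd e) \<and> path_image (edge_curve p bd e) \<inter> p ` V = p ` e) \<and>
     (\<forall>e\<in>F. \<forall>e'\<in>F. e \<noteq> e' \<longrightarrow>
        path_image (edge_curve p bd e) \<inter> path_image (edge_curve p bd e') = p ` (e \<inter> e'))"

text \<open>Orientation-preserving homeomorphism of the plane: a homeomorphism preserving all
  winding numbers (i.e. of degree +1).\<close>
definition orient_pres_homeo :: "(complex \<Rightarrow> complex) \<Rightarrow> bool" where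
  "orient_pres_homeo h \<longleftrightarrow> (\<exists>h'. homeomorphism UNIV UNIV h h') \<and>
     (\<forall>g z. path g \<and> pathfinish g = pathstart g \<and> z \<notin> path_image g \<longrightarrow>
        winding_number (h \<circ> g) (h z) = winding_number g z)"

text \<open>The drawing (p, bd) of the subgraph (V, F) respects the embedding of the plane graph
  given by the reference planar drawing (p0, bd0): it is the image of the restriction of the
  reference drawing to (V, F) under an orientation-preserving homeomorphism of the plane.\<close>
definition respects_embedding ::
  "nat set \<Rightarrow> (nat \<Rightarrow> complex) \<Rightarrow> (nat set \<Rightarrow> complex list) \<Rightarrow> nat set set
     \<Rightarrow> (nat \<Rightarrow> complex) \<Rightarrow> (nat set \<Rightarrow> complex list) \<Rightarrow> bool" where
  "respects_embedding V p0 bd0 F p bd \<longleftrightarrow>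
     (\<exists>h. orient_pres_homeo h \<and> (\<forall>v\<in>V. h (p0 v) = p v) \<and>
        (\<forall>e\<in>F. h ` path_image (edge_curve p0 bd0 e) = path_image (edge_curve p bd e)))"

definition admissible ::
  "nat set \<Rightarrow> (nat \<Rightarrow> complex) \<Rightarrow> (nat set \<Rightarrow> complex list) \<Rightarrow> nat set set
     \<Rightarrow> (nat \<Rightarrow> complex) \<Rightarrow> (nat set \<Rightarrow> complex list) \<Rightarrow> bool" where
  "admissible V p0 bd0 F p bd \<longleftrightarrow> planar_drawing V F p bd \<and> respects_embedding V p0 bd0 F p bd"

text \<open>The drawing with vertex positions p and bends bd greedily extends the straight-line
  drawing p of H = (V, EH) with respect to sigma, for the plane graph G = (V, E) with
  embedding given by (p0, bd0): H-edges are straight, sigma lists E - EH, and each sigma!i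
  is drawn admissibly given H and the earlier edges, with the minimum possible number of
  bends among all admissible choices.\<close>
definition greedily_extends ::
  "nat set \<Rightarrow> nat set set \<Rightarrow> (nat \<Rightarrow> complex) \<Rightarrow> (nat set \<Rightarrow> complex list)
     \<Rightarrow> nat set set \<Rightarrow> (nat \<Rightarrow> complex) \<Rightarrow> nat set list \<Rightarrow> (nat set \<Rightarrow> complex list) \<Rightarrow> bool" where
  "greedily_extends V E p0 bd0 EH p \<sigma> bd \<longleftrightarrow>
     (\<forall>e\<in>EH. bd e = []) \<and>
     (\<forall>i < length \<sigma>.
        admissible V p0 bd0 (EH \<union> set (take (Suc i) \<sigma>)) p bd \<and>
        (\<forall>b'. admissible V p0 bd0 (EH \<union> set (take (Suc i) \<sigma>)) p (bd(\<sigma> ! i := b'))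
               \<longrightarrow> length (bd (\<sigma> ! i)) \<le> length b'))"

end

theory Submission
  imports Defs "HOL-Analysis.Analysis"
begin

text \<open>
  The edges e_0, e_1, ... of a matching live in a long maze whose walls are drawn first. Edge e_k joins a root
  r_k on the floor to a tip t_k, an isolated vertex just above the floor inside a nook. Along the floor the order
  of the feet of the tips and of the roots is t_k, t_(k+1), r_k, r_(k+1). Greedy drawings never pass between
  t_j and the floor before e_j is drawn, since such an excursion through a baffled passage could be shortcut along
  the gate of the passage with fewer bends. Hence e_k followed by the drop from t_k to the floor
  separates r_(k+1) from t_(k+1), so e_(k+1) has to run along e_k, around t_k, and back. Both halves of
  e_(k+1) can be turned into drawings of e_k by adding two bends, and the part of e_(k+1) before the
  first half has at least three bends; minimality of e_k then gives b_(k+1) \<ge> 2 b_k - 1 for the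
  numbers of bends.

  The exchanges are legal because every planar drawing of the matching inside the maze respects the embedding:
  a polygonal arc can be retracted to its root by a homeomorphism supported near it, so all drawings
  are equivalent to the one with short vertical edges.
\<close>

section \<open>Homeomorphisms of the plane with prescribed support\<close>

text \<open>Two losses shape the maze. Turning one half of e_(k+1) into a drawing of e_k costs two
  bends, so the bare recurrence would be b_(k+1) \<ge> 2 b_k - 4, which need not grow from a value
  of at most 4. The baffles in columns 5 to 11 form three overlapping triples
  hanging-standing-hanging, none of which a straight segment can pass. They cost three bends on the
  way from one root to the previous one, which improves the recurrence to 2 b_k - 1 and gives b_0
  \<ge> 3, above its fixed point 1. The second loss is in the shortcuts: joining the root to the
  gate point creates a bend, so an excursion is excluded only if it needs a bend on the way out and
  another on the way back. Inside a nook the baffle in column 3 forces these two bends, inside a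
  trunk the first triple does. A shortcut along a gate is legal only if no earlier edge is near the
  root. This is itself a statement about excursions, of earlier edges into trunks, so the trunks are
  treated first and by induction; the nooks follow.\<close>

lemma in_closed_segmentI:
  "x = (1 - u) *\<^sub>R a + u *\<^sub>R b \<Longrightarrow> 0 \<le> u \<Longrightarrow> u \<le> 1 \<Longrightarrow> x \<in> closed_segment a b"
  unfolding closed_segment_def by blast

definition supp_homeo :: "complex set \<Rightarrow> (complex \<Rightarrow> complex) \<Rightarrow> bool" where
  "supp_homeo U f \<longleftrightarrow> (\<exists>g. homeomorphism UNIV UNIV f g) \<and> (\<forall>x. x \<notin> U \<longrightarrow> f x = x)"

lemma supp_homeo_id: "supp_homeo U (\<lambda>x. x)"
  unfolding supp_homeo_def by (auto intro!: exI[of _ "\<lambda>x. x"] homeomorphism_ident)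

lemma supp_homeo_mono: "supp_homeo U f \<Longrightarrow> U \<subseteq> V \<Longrightarrow> supp_homeo V f"
  unfolding supp_homeo_def by blast

lemma supp_homeo_fix: "supp_homeo U f \<Longrightarrow> x \<notin> U \<Longrightarrow> f x = x"
  unfolding supp_homeo_def by blast

lemma supp_homeo_inj: "supp_homeo U f \<Longrightarrow> inj f"
  unfolding supp_homeo_def homeomorphism_def inj_def by (metis UNIV_I)

lemma supp_homeo_fix_image: "supp_homeo U f \<Longrightarrow> S \<inter> U = {} \<Longrightarrow> f ` S = S"
  using supp_homeo_fix by (force simp: image_def)

lemma supp_homeo_mem: "supp_homeo U f \<Longrightarrow> f x \<in> U \<longleftrightarrow> x \<in> U"
  using supp_homeo_inj supp_homeo_fix by (metis injD)

lemma supp_homeo_comp: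
  assumes "supp_homeo U f" "supp_homeo U g"
  shows "supp_homeo U (\<lambda>x. g (f x))"
proof -
  obtain f' g' where "homeomorphism UNIV UNIV f f'" "homeomorphism UNIV UNIV g g'"
    using assms unfolding supp_homeo_def by blast
  then have "homeomorphism UNIV UNIV (g \<circ> f) (f' \<circ> g')"
    by (rule homeomorphism_compose)
  then show ?thesis
    using assms unfolding supp_homeo_def comp_def by (metis (no_types, lifting))
qed

lemma supp_homeo_inverse:
  assumes "supp_homeo U f"
  obtains g where "supp_homeo U g" "\<And>x. g (f x) = x" "\<And>x. f (g x) = x"
proof -
  obtain g where g: "homeomorphism UNIV UNIV f g"
    using assms unfolding supp_homeo_def by blast
  have gf: "g (f x) = x" "f (g x) = x" for x
    using g unfolding homeomorphism_def by auto
  have "supp_homeo U g"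
    unfolding supp_homeo_def using homeomorphism_symD[OF g] gf assms supp_homeo_fix by metis
  then show thesis using that gf by blast
qed

text \<open>A loop can be blown up radially about \<open>z\<close> until it leaves the support. The
  homotopy avoids \<open>z\<close>, so its image under the injective \<open>f\<close> avoids
  \<open>f z\<close>. At the far end \<open>f\<close> is the identity, and \<open>z\<close> and
  \<open>f z\<close> lie in one disc that the large loop misses.\<close>

lemma supp_homeo_imp_orient_pres:
  assumes f: "supp_homeo U f" and U: "bounded U"
  shows "orient_pres_homeo f"
  unfolding orient_pres_homeo_def
proof (intro conjI allI impI)
  show "\<exists>h'. homeomorphism UNIV UNIV f h'" using f unfolding supp_homeo_def by blast
  then have contf: "continuous_on UNIV f" by (auto simp: homeomorphism_def)
  fix g and z :: complex assume g: "path g \<and> pathfinish g = pathstart g \<and> z \<notin> path_image g"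
  obtain d where d: "d > 0" "\<And>x. x \<in> path_image g \<Longrightarrow> d \<le> dist z x"
    using separate_point_closed[OF closed_path_image] g by blast
  obtain R where R: "R > 0" "\<And>x. x \<in> U \<Longrightarrow> norm x \<le> R"
    using U bounded_pos by blast
  \<comment> \<open>Points farther than \<open>M\<close> from \<open>z\<close> lie outside
    \<open>U\<close>, and the disc of radius \<open>M\<close> about \<open>z\<close> contains
    \<open>f z\<close>.\<close>
  define M where "M = R + norm z + norm (f z) + 1"
  have M: "M > 0" using R by (simp add: M_def add_pos_nonneg)
  define T where "T = 1 + M / d"
  have T: "T \<ge> 1" "T * d > M" using d M by (auto simp: T_def field_simps)
  define H where "H = (\<lambda>(t, s). z + of_real (1 + t * (T - 1)) * (g s - z))"
  have H0: "H (t, s) \<noteq> z" if "t \<in> {0..1}" "s \<in> {0..1}" for t s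
  proof -
    have "g s \<noteq> z" using g that unfolding path_image_def by auto
    define c where "c = 1 + t * (T - 1)"
    have "c > 0" unfolding c_def using that T
      by (metis add_pos_nonneg atLeastAtMost_iff diff_ge_0_iff_ge mult_nonneg_nonneg zero_less_one)
    then have "of_real c * (g s - z) \<noteq> 0" using \<open>g s \<noteq> z\<close> by simp
    then show ?thesis by (simp add: H_def c_def[symmetric] del: of_real_add of_real_mult of_real_diff mult_eq_0_iff)
  qed
  have contg: "continuous_on {0..1} g" using g by (simp add: path_def)
  have contH: "continuous_on ({0..1} \<times> {0..1}) H"
    unfolding H_def split_def by (intro continuous_intros continuous_on_compose2[OF contg]) auto
  define gT where "gT = (\<lambda>s. H (1, s))"
  have gl: "g 1 = g 0" using g by (simp add: pathfinish_def pathstart_def)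
  have h1: "homotopic_loops (-{z}) g gT"
    unfolding homotopic_loops
    by (rule exI[of _ H]) (use contH H0 gl in \<open>auto simp: gT_def pathfinish_def pathstart_def H_def\<close>)
  have h2: "homotopic_loops (-{f z}) (f \<circ> g) (f \<circ> gT)"
    unfolding homotopic_loops
  proof (rule exI[of _ "f \<circ> H"], intro conjI)
    show "continuous_on ({0..1} \<times> {0..1}) (f \<circ> H)"
      by (rule continuous_on_compose[OF contH continuous_on_subset[OF contf subset_UNIV]])
    show "f \<circ> H \<in> {0..1} \<times> {0..1} \<rightarrow> - {f z}"
      using H0 inj_eq[OF supp_homeo_inj[OF f]] by auto
  qed (use gl in \<open>auto simp: gT_def pathfinish_def pathstart_def H_def\<close>)
  have far: "norm (gT s - z) > M" if "s \<in> {0..1}" for s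
  proof -
    have "norm (gT s - z) = T * norm (g s - z)" using T by (simp add: gT_def H_def norm_mult)
    moreover have "norm (g s - z) \<ge> d" using d(2)[of "g s"] that
      by (auto simp: path_image_def dist_norm norm_minus_commute)
    ultimately show ?thesis using T mult_left_mono[of d "norm (g s - z)" T] by linarith
  qed
  have fgT: "f (gT s) = gT s" if "s \<in> {0..1}" for s
  proof -
    have "norm (gT s) > R" using far[OF that] norm_triangle_ineq4[of "gT s" z]
      unfolding M_def by (smt (verit) norm_ge_zero)
    then show ?thesis using supp_homeo_fix[OF f] R(2) by force
  qed
  have pT: "path gT" "pathfinish gT = pathstart gT"
    using homotopic_loops_imp_path[OF h1] homotopic_loops_imp_loop[OF h1] by auto
  have "winding_number (f \<circ> g) (f z) = winding_number (f \<circ> gT) (f z)"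
    by (rule winding_number_homotopic_loops[OF h2])
  also have "\<dots> = winding_number gT (f z)"
  proof (rule winding_number_homotopic_loops, rule homotopic_loops_eq)
    have p2: "path (f \<circ> gT)" using homotopic_loops_imp_path[OF h2] by auto
    then show "path (f \<circ> gT)" .
    show "path_image (f \<circ> gT) \<subseteq> - {f z}" using homotopic_loops_imp_subset[OF h2] by auto
    show "pathfinish (f \<circ> gT) = pathstart (f \<circ> gT)" using homotopic_loops_imp_loop[OF h2] by auto
    show "\<And>t. t \<in> {0..1} \<Longrightarrow> (f \<circ> gT) t = gT t" using fgT by simp
  qed
  also have "\<dots> = winding_number gT z"
  proof (rule winding_number_eq[OF pT, where S = "cball z M"])
    have "norm (f z - z) \<le> norm (f z) + norm z" by (rule norm_triangle_ineq4)
    then show "f z \<in> cball z M" "z \<in> cball z M"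
      using R M by (auto simp: M_def dist_norm norm_minus_commute)
    show "cball z M \<inter> path_image gT = {}"
      using far unfolding path_image_def by (force simp: dist_norm norm_minus_commute)
  qed simp
  also have "\<dots> = winding_number g z"
    using winding_number_homotopic_loops[OF h1] by simp
  finally show "winding_number (f \<circ> g) (f z) = winding_number g z" .
qed

text \<open>A solution of \<open>x + g x = y\<close> is a fixed point of the contraction
  \<open>\<lambda>x. y - g x\<close>, which gives surjectivity by Banach. The lower bound
  \<open>(1 - c) * norm (x - y)\<close> for distances of images gives both injectivity and a
  Lipschitz inverse.\<close>

lemma homeomorphism_id_plus_contraction:
  fixes g :: "'a::banach \<Rightarrow> 'a"
  assumes c: "0 \<le> c" "c < 1" and lip: "\<And>x y. norm (g x - g y) \<le> c * norm (x - y)"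
  shows "\<exists>f'. homeomorphism UNIV UNIV (\<lambda>x. x + g x) f'"
proof -
  let ?f = "\<lambda>x. x + g x"
  have expand: "(1 - c) * norm (x - y) \<le> norm (?f x - ?f y)" for x y
  proof -
    have "norm (x - y) \<le> norm (?f x - ?f y) + norm (g x - g y)"
      using norm_triangle_ineq4[of "?f x - ?f y" "g x - g y"] by (simp add: algebra_simps)
    then show ?thesis using lip[of x y] by (simp add: algebra_simps)
  qed
  have inj: "inj ?f"
    by (rule injI) (use expand c in \<open>smt (verit) eq_iff_diff_eq_0 mult_pos_pos norm_eq_zero norm_ge_zero zero_less_norm_iff\<close>)
  have surj: "\<exists>x. ?f x = y" for y
  proof -
    have "\<forall>a b. dist (y - g a) (y - g b) \<le> c * dist a b"
      using lip by (simp add: dist_norm norm_minus_commute)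
    then have "\<exists>!x. y - g x = x" using c by (rule banach_fix_type[rotated 2])
    then show ?thesis by (metis diff_add_cancel)
  qed
  have contf: "continuous_on UNIV ?f"
  proof -
    have "c-lipschitz_on UNIV g" using c lip by (auto simp: lipschitz_on_def dist_norm)
    then show ?thesis by (intro continuous_intros lipschitz_on_continuous_on)
  qed
  have invf: "?f (inv ?f y) = y" for y
    using surj by (metis (mono_tags, lifting) f_inv_into_f rangeI)
  have "(1 / (1 - c))-lipschitz_on UNIV (inv ?f)"
  proof (rule lipschitz_onI)
    fix x y
    have "(1 - c) * norm (inv ?f x - inv ?f y) \<le> norm (x - y)"
      using expand[of "inv ?f x" "inv ?f y"] invf by simp
    then show "dist (inv ?f x) (inv ?f y) \<le> 1 / (1 - c) * dist x y"
      using c by (simp add: dist_norm field_simps)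
  qed (use c in auto)
  then have "continuous_on UNIV (inv ?f)" by (rule lipschitz_on_continuous_on)
  then have "homeomorphism UNIV UNIV ?f (inv ?f)"
    using contf inj invf surj unfolding homeomorphism_def
    by (metis (no_types, lifting) UNIV_I inv_f_f surjI surj_def)
  then show ?thesis by blast
qed

text \<open>The push is the cone map of a disc: it fixes the circle, moves the centre to u and is linear on radii.\<close>
definition disc_push :: "complex \<Rightarrow> real \<Rightarrow> complex \<Rightarrow> complex \<Rightarrow> complex" where
  "disc_push a r u x = x + max 0 (1 - norm (x - a) / r) *\<^sub>R (u - a)"

text \<open>The displacement has Lipschitz constant \<open>norm (u - a) / r\<close>, which is below
  1 because the target \<open>u\<close> lies in the open disc.\<close>

lemma supp_homeo_disc_push:
  assumes "norm (u - a) < r"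
  shows "supp_homeo (ball a r) (disc_push a r u)"
proof -
  have r: "r > 0" using assms norm_ge_zero le_less_trans by blast
  let ?g = "\<lambda>x. max 0 (1 - norm (x - a) / r) *\<^sub>R (u - a)"
  have "norm (?g x - ?g y) \<le> (norm (u - a) / r) * norm (x - y)" for x y
  proof -
    have 1: "\<bar>max 0 (1 - s) - max 0 (1 - t)\<bar> \<le> \<bar>s - t\<bar>" for s t :: real by auto
    have "\<bar>norm (x - a) / r - norm (y - a) / r\<bar> = \<bar>norm (x - a) - norm (y - a)\<bar> / r"
      using r by (simp add: diff_divide_distrib[symmetric])
    also have "\<dots> \<le> norm (x - y) / r"
      using norm_triangle_ineq3[of "x - a" "y - a"] r by (intro divide_right_mono) auto
    finally have "\<bar>max 0 (1 - norm (x - a) / r) - max 0 (1 - norm (y - a) / r)\<bar> \<le> norm (x - y) / r"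
      using 1 order_trans by blast
    then have "\<bar>max 0 (1 - norm (x - a) / r) - max 0 (1 - norm (y - a) / r)\<bar> * norm (u - a) \<le> norm (x - y) / r * norm (u - a)"
      by (rule mult_right_mono) simp
    then show ?thesis by (simp add: scaleR_left_diff_distrib[symmetric] mult.commute)
  qed
  then have "\<exists>f'. homeomorphism UNIV UNIV (\<lambda>x. x + ?g x) f'"
    using assms r by (intro homeomorphism_id_plus_contraction[of "norm (u - a) / r"]) auto
  moreover have "disc_push a r u x = x" if "x \<notin> ball a r" for x
    using that r by (simp add: disc_push_def dist_norm norm_minus_commute max_def)
  ultimately show ?thesis
    unfolding supp_homeo_def disc_push_def[abs_def] by auto
qed

lemma disc_push_centre [simp]: "r > 0 \<Longrightarrow> disc_push a r u a = u"
  by (simp add: disc_push_def)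

lemma disc_push_radius:
  assumes "norm (b - a) = r" "r > 0"
  shows "disc_push a r u ` closed_segment b a = closed_segment b u"
proof -
  have "disc_push a r u ((1 - t) *\<^sub>R b + t *\<^sub>R a) = (1 - t) *\<^sub>R b + t *\<^sub>R u" if "0 \<le> t" "t \<le> 1" for t
  proof -
    have "(1 - t) *\<^sub>R b + t *\<^sub>R a - a = (1 - t) *\<^sub>R (b - a)" by (simp add: algebra_simps)
    then have "norm ((1 - t) *\<^sub>R b + t *\<^sub>R a - a) = (1 - t) * r" using that assms by simp
    then show ?thesis using assms that by (simp add: disc_push_def) (simp add: algebra_simps)
  qed
  then show ?thesis unfolding closed_segment_def image_def by (auto; metis)
qed

lemma supp_homeo_conjugate:
  assumes f: "supp_homeo U f" and A: "homeomorphism UNIV UNIV A A'"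
  shows "supp_homeo (A ` U) (\<lambda>x. A (f (A' x)))"
proof -
  obtain g where g: "homeomorphism UNIV UNIV f g"
    using f unfolding supp_homeo_def by blast
  have "homeomorphism UNIV UNIV (A \<circ> (f \<circ> A')) ((A \<circ> g) \<circ> A')"
    using homeomorphism_compose[OF homeomorphism_compose[OF homeomorphism_symD[OF A] g] A]
    by (simp add: comp_assoc)
  moreover have "A (f (A' x)) = x" if "x \<notin> A ` U" for x
  proof -
    have AA: "A (A' x) = x" using A by (simp add: homeomorphism_def)
    then have "A' x \<notin> U" using that by (metis imageI)
    then show ?thesis using f AA by (simp add: supp_homeo_fix)
  qed
  ultimately show ?thesis unfolding supp_homeo_def comp_def by blast
qed

text \<open>Each member maps its own support onto itself, so on disjoint supports the composition
  acts as if every member were alone.\<close>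

lemma supp_homeo_finite_family:
  assumes "finite I" "\<And>k. k \<in> I \<Longrightarrow> supp_homeo (U k) (f k)"
    "\<And>j k. j \<in> I \<Longrightarrow> k \<in> I \<Longrightarrow> j \<noteq> k \<Longrightarrow> U j \<inter> U k = {}"
  shows "\<exists>g. supp_homeo (\<Union>k\<in>I. U k) g \<and> (\<forall>k\<in>I. \<forall>x\<in>U k. g x = f k x)"
  using assms
proof (induction I rule: finite_induct)
  case empty
  then show ?case using supp_homeo_id by auto
next
  case (insert k I)
  then obtain g where g: "supp_homeo (\<Union>k\<in>I. U k) g" "\<forall>k\<in>I. \<forall>x\<in>U k. g x = f k x"
    by (metis insert_iff)
  have fk: "supp_homeo (U k) (f k)" using insert by auto
  have dis: "U j \<inter> U k = {}" if "j \<in> I" for j using insert that by (metis insert_iff)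
  have "supp_homeo (\<Union>k\<in>insert k I. U k) (\<lambda>x. f k (g x))"
    by (rule supp_homeo_comp[OF supp_homeo_mono[OF g(1)] supp_homeo_mono[OF fk]]) auto
  moreover have "f k (g x) = f j x" if "j \<in> insert k I" "x \<in> U j" for j x
  proof (cases "j = k")
    case True
    then have "x \<notin> (\<Union>k\<in>I. U k)" using dis that by blast
    then show ?thesis using True supp_homeo_fix[OF g(1)] by simp
  next
    case False
    then have j: "j \<in> I" using that by auto
    then have "f j x \<in> U j" using supp_homeo_mem insert.prems(1)[of j] that by blast
    then have "f j x \<notin> U k" using dis j by blast
    then show ?thesis using g(2) j that supp_homeo_fix[OF fk] by auto
  qed
  ultimately show ?case by blast
qed

text \<open>The end of the segment is pulled back by disc pushes. A push of radius \<open>r\<close>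
  at the current end changes only the last piece of length \<open>r\<close>, and
  \<open>r \<le> \<sigma>\<close> prevents this piece from reaching beyond \<open>a\<close>.\<close>

lemma push_along_ray:
  fixes d a :: complex
  assumes d: "norm d = 1" and r: "0 < r" "r \<le> \<sigma>" and le: "\<sigma> \<le> \<omega>"
    and U: "\<And>s. \<sigma> \<le> s \<Longrightarrow> s \<le> \<omega> \<Longrightarrow> ball (a + s *\<^sub>R d) r \<subseteq> U"
  shows "\<exists>f. supp_homeo U f \<and> f ` closed_segment a (a + \<omega> *\<^sub>R d) = closed_segment a (a + \<sigma> *\<^sub>R d)
    \<and> f (a + \<omega> *\<^sub>R d) = a + \<sigma> *\<^sub>R d"
proof -
  define pt where "pt = (\<lambda>s. a + s *\<^sub>R d)"
  have dist_pt: "norm (pt s - pt t) = \<bar>s - t\<bar>" for s t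
    using d by (simp add: pt_def scaleR_left_diff_distrib[symmetric])
  have pt0: "pt 0 = a" by (simp add: pt_def)
  have mem: "pt s \<in> closed_segment (pt x) (pt y)" if "x \<le> s" "s \<le> y" for s x y
  proof (cases "x = y")
    case False
    then have "pt s = (1 - (s - x) / (y - x)) *\<^sub>R pt x + ((s - x) / (y - x)) *\<^sub>R pt y"
      using that by (simp add: pt_def algebra_simps) (simp add: scaleR_left_distrib[symmetric] field_simps)
    moreover have "0 \<le> (s - x) / (y - x)" "(s - x) / (y - x) \<le> 1" using that False by auto
    ultimately show ?thesis unfolding closed_segment_def by blast
  qed (use that in auto)
  have "\<exists>f. supp_homeo U f \<and> f ` closed_segment (pt 0) (pt w) = closed_segment (pt 0) (pt \<sigma>) \<and> f (pt w) = pt \<sigma>"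
    if "\<sigma> \<le> w" "w \<le> \<omega>" "w - \<sigma> \<le> real N * (r / 2)" for N w
    using that
  proof (induction N arbitrary: w)
    case 0
    then have "w = \<sigma>" by simp
    then show ?case using supp_homeo_id[of U] by (intro exI[of _ "\<lambda>x. x"]) auto
  next
    case (Suc N)
    \<comment> \<open>Steps of \<open>r / 2\<close> keep the new end inside the disc of radius
      \<open>r\<close>; the maximum stops the last step exactly at \<open>\<sigma>\<close>.\<close>
    define u where "u = max \<sigma> (w - r / 2)"
    have u: "\<sigma> \<le> u" "u \<le> w" "w - u \<le> r / 2" "u - \<sigma> \<le> real N * (r / 2)"
      using Suc.prems r by (auto simp: u_def algebra_simps max_def)
    obtain f where f: "supp_homeo U f" "f ` closed_segment (pt 0) (pt u) = closed_segment (pt 0) (pt \<sigma>)" "f (pt u) = pt \<sigma>"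
      using Suc.IH[of u] u Suc.prems by auto
    define b where "b = w - r"
    let ?g = "disc_push (pt w) r (pt u)"
    have b: "0 \<le> b" "b \<le> u" "b \<le> w" using u r Suc.prems by (auto simp: b_def)
    have g: "supp_homeo (ball (pt w) r) ?g"
      by (rule supp_homeo_disc_push) (use dist_pt u r in auto)
    then have gU: "supp_homeo U ?g" using U[of w] Suc.prems by (auto simp: pt_def intro: supp_homeo_mono)
    have 1: "?g ` closed_segment (pt b) (pt w) = closed_segment (pt b) (pt u)"
      by (rule disc_push_radius) (use dist_pt r in \<open>auto simp: b_def\<close>)
    have 2: "?g ` closed_segment (pt 0) (pt b) = closed_segment (pt 0) (pt b)"
    proof (rule supp_homeo_fix_image[OF g])
      have "r \<le> dist (pt w) x" if "x \<in> closed_segment (pt 0) (pt b)" for x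
      proof -
        obtain t where t: "0 \<le> t" "t \<le> 1" "x = (1 - t) *\<^sub>R pt 0 + t *\<^sub>R pt b" using \<open>x \<in> _\<close> unfolding closed_segment_def by blast
        then have "x = pt (t * b)" by (simp add: pt_def algebra_simps)
        moreover have "t * b \<le> b" using t b by (simp add: mult_left_le_one_le)
        ultimately show ?thesis using dist_pt[of w "t * b"] by (simp add: dist_norm b_def)
      qed
      then show "closed_segment (pt 0) (pt b) \<inter> ball (pt w) r = {}" by force
    qed
    have "?g ` closed_segment (pt 0) (pt w) = closed_segment (pt 0) (pt u)"
      using Un_closed_segment[OF mem[OF b(1) b(3)]] Un_closed_segment[OF mem[OF b(1) b(2)]] 1 2
      by (metis image_Un)
    then have "(\<lambda>x. f (?g x)) ` closed_segment (pt 0) (pt w) = closed_segment (pt 0) (pt \<sigma>)"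
      using f(2) by (metis image_image)
    moreover have "f (?g (pt w)) = pt \<sigma>" using f(3) r by simp
    ultimately show ?case using supp_homeo_comp[OF gU f(1)] by (intro exI[of _ "\<lambda>x. f (?g x)"]) auto
  qed
  moreover obtain N where "\<omega> - \<sigma> \<le> real N * (r / 2)"
    using reals_Archimedean3[of "r / 2"] r by (metis half_gt_zero less_imp_le)
  ultimately show ?thesis using le by (metis order_refl pt0 pt_def)
qed

text \<open>Compactness of the part to be swept gives one radius for all discs. Only this part has
  to lie in \<open>U\<close>, so the segment may start on the boundary of \<open>U\<close>.\<close>

lemma push_along:
  fixes a w :: complex
  assumes U: "open U" and aw: "a \<noteq> w" and t: "0 < t" "t \<le> 1"
    and sub: "closed_segment (a + t *\<^sub>R (w - a)) w \<subseteq> U"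
  shows "\<exists>f. supp_homeo U f \<and> f ` closed_segment a w = closed_segment a (a + t *\<^sub>R (w - a))
    \<and> f w = a + t *\<^sub>R (w - a)"
proof -
  define l where "l = norm (w - a)"
  have l: "l > 0" using aw by (simp add: l_def)
  define d where "d = (1 / l) *\<^sub>R (w - a)"
  have d: "norm d = 1" using l by (simp add: d_def l_def)
  have w: "a + l *\<^sub>R d = w" "a + (t * l) *\<^sub>R d = a + t *\<^sub>R (w - a)" using l by (auto simp: d_def)
  obtain e where e: "e > 0" "(\<Union>x\<in>closed_segment (a + t *\<^sub>R (w - a)) w. ball x e) \<subseteq> U"
    using compact_subset_open_imp_ball_epsilon_subset[OF compact_segment U sub] by blast
  define r where "r = min e (t * l)"
  have "ball (a + s *\<^sub>R d) r \<subseteq> U" if "t * l \<le> s" "s \<le> l" for s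
  proof -
    have "a + s *\<^sub>R d \<in> closed_segment (a + t *\<^sub>R (w - a)) w"
    proof (cases "t = 1")
      case True
      then show ?thesis using that w by (metis ends_in_segment(2) mult_1 order_antisym)
    next
      case False
      define q where "q = (s / l - t) / (1 - t)"
      have q: "0 \<le> q" "q \<le> 1" using that l t False by (auto simp: q_def field_simps)
      have "q * (1 - t) = s / l - t" using t False by (simp add: q_def)
      then have "s / l = (1 - q) * t + q" by (simp add: algebra_simps)
      then have "a + s *\<^sub>R d = (1 - q) *\<^sub>R (a + t *\<^sub>R (w - a)) + q *\<^sub>R w"
        by (simp add: d_def) (simp add: algebra_simps)
      then show ?thesis using q unfolding closed_segment_def by blast
    qed
    then have "ball (a + s *\<^sub>R d) e \<subseteq> U" using e by blast
    then show ?thesis by (auto simp: r_def)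
  qed
  then have "\<exists>f. supp_homeo U f \<and> f ` closed_segment a (a + l *\<^sub>R d) = closed_segment a (a + (t * l) *\<^sub>R d)
    \<and> f (a + l *\<^sub>R d) = a + (t * l) *\<^sub>R d"
    using d e t l by (intro push_along_ray[where r = r]) (auto simp: r_def mult_left_le_one_le)
  then show ?thesis unfolding w .
qed

lemma linear_image_closed_segment_origin:
  assumes "linear A"
  shows "(\<lambda>x. b + A x) ` closed_segment 0 w = closed_segment b (b + A w)"
proof -
  have "A ` closed_segment 0 w = closed_segment (A 0) (A w)"
    by (rule closed_segment_linear_image[OF assms, symmetric])
  then have "(\<lambda>x. b + A x) ` closed_segment 0 w = (+) b ` closed_segment 0 (A w)"
    using linear_0[OF assms] by (metis image_image)
  then show ?thesis using closed_segment_translation[of b 0 "A w"] by simp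
qed

text \<open>In affine coordinates where the line perpendicular to n is horizontal and d is vertical, this is a push of a
  disc tangent to that line at b.\<close>
lemma corner_move:
  fixes b d d' n :: complex
  assumes d: "n \<bullet> d > 0" and d': "n \<bullet> d' > 0" and e: "e > 0"
  shows "\<exists>\<delta>>0. \<forall>s. 0 < s \<and> s < \<delta> \<longrightarrow> (\<forall>T>0. \<exists>t f. 0 < t \<and> t \<le> T \<and>
     supp_homeo (ball b e \<inter> {z. n \<bullet> (z - b) > 0}) f \<and>
     f ` closed_segment b (b + s *\<^sub>R d) = closed_segment b (b + t *\<^sub>R d') \<and> f (b + s *\<^sub>R d) = b + t *\<^sub>R d')"
proof -
  define A where "A = (\<lambda>z. Re z *\<^sub>R (\<i> * n) + Im z *\<^sub>R d)"
  have linA: "linear A" by (rule linearI) (auto simp: A_def algebra_simps)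
  have n: "n \<bullet> (\<i> * n) = 0" by (simp add: inner_complex_def)
  have nA: "n \<bullet> A z = Im z * (n \<bullet> d)" for z by (simp add: A_def inner_add_right n)
  have n0: "n \<noteq> 0" using d by auto
  have "inj A"
  proof -
    have "z = 0" if "A z = 0" for z
    proof -
      have "Im z = 0" using nA[of z] that d by auto
      then have "Re z = 0" using that n0 by (auto simp: A_def)
      with \<open>Im z = 0\<close> show ?thesis by (simp add: complex_eq_iff)
    qed
    then show ?thesis using linear_injective_0[OF linA] by blast
  qed
  then obtain B where B: "linear B" "\<And>x. B (A x) = x" "\<And>x. A (B x) = x"
    using linear_injective_isomorphism[OF linA] by blast
  have contA: "continuous_on UNIV A" and contB: "continuous_on UNIV B"
    using linA B(1) by (auto simp: linear_continuous_on linear_conv_bounded_linear)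
  have homA: "homeomorphism UNIV UNIV (\<lambda>x. b + A x) (\<lambda>y. B (y - b))"
    unfolding homeomorphism_def
    using B contA contB by (auto intro!: continuous_intros continuous_on_compose2[OF contB] simp: image_def) (metis add_diff_cancel_left' diff_add_cancel add.commute)+
  define w where "w = B d'"
  have Aw: "A w = d'" using B by (simp add: w_def)
  have Imw: "Im w > 0" using nA[of w] d d' Aw by (simp add: zero_less_mult_iff)
  define C where "C = norm n + norm d + 1"
  have C: "C > 0" by (simp add: C_def add_nonneg_pos)
  have normA: "norm (A z) \<le> C * norm z" for z
  proof -
    have "norm (A z) \<le> \<bar>Re z\<bar> * norm n + \<bar>Im z\<bar> * norm d"
      unfolding A_def by (rule order_trans[OF norm_triangle_ineq]) (simp add: norm_mult)
    also have "\<dots> \<le> norm z * norm n + norm z * norm d"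
      by (intro add_mono mult_right_mono abs_Re_le_cmod abs_Im_le_cmod) auto
    also have "\<dots> \<le> C * norm z" by (simp add: C_def algebra_simps)
    finally show ?thesis .
  qed
  \<comment> \<open>The disc of radius \<open>s\<close> about \<open>\<i> * of_real s\<close> lies
    within distance \<open>2 * s\<close> of 0, and \<open>A\<close> stretches lengths by at most
    \<open>C\<close>.\<close>
  define \<delta> where "\<delta> = e / (2 * C)"
  show ?thesis
  proof (rule exI[of _ \<delta>], intro conjI allI impI)
    show "\<delta> > 0" using e C by (simp add: \<delta>_def)
    fix s T :: real assume s: "0 < s \<and> s < \<delta>" and T: "T > 0"
    \<comment> \<open>The second entry of the minimum puts \<open>t *\<^sub>R w\<close> into the
      disc: the squared distance to the centre exceeds \<open>s\<^sup>2\<close> by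
      \<open>t * (t * (norm w)\<^sup>2 - 2 * s * Im w)\<close>, which is then negative.\<close>
    define t where "t = min T (s * Im w / (norm w)\<^sup>2)"
    have w0: "norm w > 0" using Imw by auto
    have t: "0 < t" "t \<le> T" "t * (norm w)\<^sup>2 \<le> s * Im w" using T s Imw w0
      by (auto simp: t_def min_def field_simps)
    define u where "u = t *\<^sub>R w"
    let ?c = "\<i> * of_real s"
    have "(norm (u - ?c))\<^sup>2 = t * (t * (norm w)\<^sup>2) - 2 * t * s * Im w + s\<^sup>2"
    proof -
      have "(norm (u - ?c))\<^sup>2 = (t * Re w)\<^sup>2 + (t * Im w - s)\<^sup>2" by (simp add: u_def cmod_power2)
      then show ?thesis unfolding cmod_power2[of w] by (simp add: power2_eq_square algebra_simps)
    qed
    also have "\<dots> < s\<^sup>2"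
    proof -
      have "t * (t * (norm w)\<^sup>2) \<le> t * (s * Im w)" using t by (intro mult_left_mono) auto
      moreover have "t * (s * Im w) > 0" using t s Imw by simp
      ultimately show ?thesis by (simp add: algebra_simps)
    qed
    finally have uc: "norm (u - ?c) < s" using s by (auto intro: power2_less_imp_less)
    define f0 where "f0 = disc_push ?c s u"
    have f0: "supp_homeo (ball ?c s) f0" unfolding f0_def by (rule supp_homeo_disc_push[OF uc])
    define f where "f = (\<lambda>x. b + A (f0 (B (x - b))))"
    have f: "supp_homeo ((\<lambda>x. b + A x) ` ball ?c s) f"
      unfolding f_def by (rule supp_homeo_conjugate[OF f0 homA])
    have sub: "(\<lambda>x. b + A x) ` ball ?c s \<subseteq> ball b e \<inter> {z. n \<bullet> (z - b) > 0}"
    proof safe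
      fix z assume z: "z \<in> ball ?c s"
      have "\<bar>Im (z - ?c)\<bar> < s" using z abs_Im_le_cmod[of "z - ?c"] by (simp add: dist_norm norm_minus_commute)
      then have "Im z > 0" by simp
      then show "n \<bullet> (b + A z - b) > 0" using nA d by simp
      have "norm z \<le> norm (z - ?c) + norm ?c" using norm_triangle_ineq[of "z - ?c" ?c] by simp
      also have "\<dots> < 2 * s" using z s by (simp add: dist_norm norm_minus_commute norm_mult)
      finally have "C * norm z < C * (2 * \<delta>)" using C s by (intro mult_strict_left_mono) auto
      also have "\<dots> = e" using C by (simp add: \<delta>_def)
      finally show "b + A z \<in> ball b e" using normA[of z] by (simp add: dist_norm)
    qed
    have As: "A ?c = s *\<^sub>R d" by (simp add: A_def)
    have Au: "A u = t *\<^sub>R d'" by (simp add: u_def linear_scale[OF linA] Aw)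
    have "f ` closed_segment b (b + s *\<^sub>R d) = f ` (\<lambda>x. b + A x) ` closed_segment 0 ?c"
      using linear_image_closed_segment_origin[OF linA, of b ?c] As by simp
    also have "\<dots> = (\<lambda>x. b + A x) ` f0 ` closed_segment 0 ?c"
      by (simp add: f_def image_image B)
    also have "f0 ` closed_segment 0 ?c = closed_segment 0 u"
      unfolding f0_def by (rule disc_push_radius) (use s in \<open>auto simp: norm_mult\<close>)
    also have "(\<lambda>x. b + A x) ` closed_segment 0 u = closed_segment b (b + t *\<^sub>R d')"
      using linear_image_closed_segment_origin[OF linA, of b u] Au by simp
    finally have img: "f ` closed_segment b (b + s *\<^sub>R d) = closed_segment b (b + t *\<^sub>R d')" .
    have "f (b + s *\<^sub>R d) = b + t *\<^sub>R d'"
      unfolding As[symmetric] f_def using s by (simp add: B f0_def Au)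
    then show "\<exists>t f. 0 < t \<and> t \<le> T \<and>
      supp_homeo (ball b e \<inter> {z. n \<bullet> (z - b) > 0}) f \<and>
      f ` closed_segment b (b + s *\<^sub>R d) = closed_segment b (b + t *\<^sub>R d') \<and> f (b + s *\<^sub>R d) = b + t *\<^sub>R d'"
      using t img supp_homeo_mono[OF f sub] by blast
  qed
qed

section \<open>Polylines\<close>

abbreviation pimg :: "complex list \<Rightarrow> complex set" where
  "pimg xs \<equiv> path_image (polyline xs)"

lemma pathstart_polyline [simp]: "pathstart (polyline (a # xs)) = a"
  by (cases "a # xs" rule: polyline.cases) auto

lemma pathfinish_polyline [simp]: "xs \<noteq> [] \<Longrightarrow> pathfinish (polyline xs) = last xs"
  by (induction xs rule: polyline.induct) auto

lemma path_polyline [simp]: "path (polyline xs)"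
proof (induction xs rule: polyline.induct)
  case 1
  then show ?case by (simp add: path_def)
next
  case (2 a)
  then show ?case by (metis path_linepath polyline.simps(2))
qed auto

lemma pimg_single [simp]: "pimg [a] = {a}" by simp

lemma pimg_Cons [simp]: "pimg (a # b # xs) = closed_segment a b \<union> pimg (b # xs)"
  by (cases xs) (auto simp: path_image_join)

declare polyline.simps(2-4) [simp del]

lemma arc_polyline_two [simp]: "arc (polyline [a, b]) \<longleftrightarrow> a \<noteq> b"
  by (metis arc_linepath arc_distinct_ends pathstart_linepath pathfinish_linepath polyline.simps(3))

lemma arc_polyline_Cons:
  "arc (polyline (a # b # c # xs)) \<longleftrightarrow>
    a \<noteq> b \<and> arc (polyline (b # c # xs)) \<and> closed_segment a b \<inter> pimg (b # c # xs) \<subseteq> {b}"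
  by (metis polyline.simps(4) arc_join_eq pathfinish_linepath pathstart_polyline path_image_linepath arc_polyline_two polyline.simps(3))

lemma pimg_append: "pimg (xs @ z # ys) = pimg (xs @ [z]) \<union> pimg (z # ys)"
proof (induction xs)
  case Nil
  have "z \<in> pimg (z # ys)" by (cases ys) auto
  then show ?case by (simp add: insert_absorb del: pimg_Cons)
next
  case (Cons a xs)
  show ?case
  proof (cases xs)
    case Nil
    have "z \<in> pimg (z # ys)" by (cases ys) auto
    then show ?thesis using Nil by auto
  next
    case (Cons b bs)
    then show ?thesis using Cons.IH by (simp add: Un_assoc)
  qed
qed

lemma arc_polyline_append:
  assumes "xs \<noteq> []" "ys \<noteq> []"
  shows "arc (polyline (xs @ z # ys)) \<longleftrightarrow>
    arc (polyline (xs @ [z])) \<and> arc (polyline (z # ys)) \<and> pimg (xs @ [z]) \<inter> pimg (z # ys) \<subseteq> {z}"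
  using assms(1)
proof (induction xs rule: list_nonempty_induct)
  case (single a)
  obtain c cs where "ys = c # cs" using assms(2) by (cases ys) auto
  then show ?case by (simp add: arc_polyline_Cons del: pimg_Cons) (auto simp: pimg_Cons)
next
  case (cons a xs)
  obtain b bs where xs: "xs = b # bs" using cons by (cases xs) auto
  obtain c cs where cs: "bs @ z # ys = c # cs" by (cases bs) auto
  obtain c' cs' where cs': "bs @ [z] = c' # cs'" by (cases bs) auto
  have z: "z \<in> pimg (z # ys)" by (cases ys) auto
  have last: "z \<in> pimg (b # c' # cs')" using pathfinish_in_path_image[of "polyline (b # c' # cs')"] cs'
    by (metis last.simps last_snoc list.distinct(1) pathfinish_polyline)
  have P: "pimg (b # c # cs) = pimg (b # c' # cs') \<union> pimg (z # ys)"
    using pimg_append[of "b # bs" z ys] cs cs' by (simp del: pimg_Cons)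
  have IH: "arc (polyline (b # c # cs)) \<longleftrightarrow> arc (polyline (b # c' # cs')) \<and> arc (polyline (z # ys)) \<and> pimg (b # c' # cs') \<inter> pimg (z # ys) \<subseteq> {z}"
    using cons.IH cs cs' xs by (simp del: pimg_Cons)
  have start: "b \<in> pimg (b # c' # cs')" by auto
  have P2: "pimg (a # b # c' # cs') = closed_segment a b \<union> pimg (b # c' # cs')" by (rule pimg_Cons)
  have "arc (polyline (a # b # c # cs)) \<longleftrightarrow> arc (polyline (a # b # c' # cs')) \<and> arc (polyline (z # ys)) \<and> pimg (a # b # c' # cs') \<inter> pimg (z # ys) \<subseteq> {z}"
    unfolding arc_polyline_Cons IH P P2 using start last z by blast
  then show ?case using xs cs cs' by (simp del: pimg_Cons)
qed

lemma pimg_rev [simp]: "pimg (rev xs) = pimg xs"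
proof (induction xs)
  case (Cons a xs)
  show ?case
  proof (cases xs)
    case (Cons b ys)
    have "pimg (rev (a # xs)) = pimg (rev ys @ b # [a])" using Cons by simp
    also have "\<dots> = pimg (rev ys @ [b]) \<union> pimg [b, a]" by (rule pimg_append)
    also have "\<dots> = pimg xs \<union> closed_segment a b" using Cons Cons.IH by (auto simp: closed_segment_commute)
    finally show ?thesis using Cons by auto
  qed simp
qed simp

lemma arc_polyline_rev [simp]: "arc (polyline (rev xs)) \<longleftrightarrow> arc (polyline xs)"
proof -
  have "arc (polyline (rev xs))" if "arc (polyline xs)" for xs
    using that
  proof (induction xs rule: polyline.induct)
    case (4 a b c rest)
    have A: "arc (polyline (rev (b # c # rest)))" "a \<noteq> b" "closed_segment a b \<inter> pimg (b # c # rest) \<subseteq> {b}"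
      using 4 by (auto simp: arc_polyline_Cons simp del: pimg_Cons)
    have "pimg [b, a] = closed_segment a b" by (auto simp: closed_segment_commute)
    then have "arc (polyline ((rev (c # rest)) @ b # [a]))"
      using A pimg_rev[of "b # c # rest"] by (subst arc_polyline_append) (auto simp: closed_segment_commute simp del: pimg_rev pimg_Cons)
    then show ?case by simp
  qed auto
  then show ?thesis by (metis rev_rev_ident)
qed

lemma polyline_swap_ends:
  "pimg (x # rev xs @ [y]) = pimg (y # xs @ [x])"
  "arc (polyline (x # rev xs @ [y])) \<longleftrightarrow> arc (polyline (y # xs @ [x]))"
  using pimg_rev[of "y # xs @ [x]"] arc_polyline_rev[of "y # xs @ [x]"]
  by (simp_all del: pimg_rev arc_polyline_rev pimg_Cons)

lemma pimg_endpoints [simp]: "a \<in> pimg (a # xs)" "b \<in> pimg (xs @ [b])" "b \<in> pimg (a # xs @ [b])"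
proof -
  show "a \<in> pimg (a # xs)" by (metis pathstart_in_path_image pathstart_polyline)
  show "b \<in> pimg (xs @ [b])" using pathfinish_in_path_image[of "polyline (xs @ [b])"] by simp
  show "b \<in> pimg (a # xs @ [b])" using pathfinish_in_path_image[of "polyline (a # xs @ [b])"] by simp
qed

lemma closed_pimg [simp]: "closed (pimg xs)" and compact_pimg [simp]: "compact (pimg xs)"
  and connected_pimg [simp]: "connected (pimg xs)"
  by (simp_all add: closed_path_image compact_path_image connected_path_image)

section \<open>Cutting polygonal arcs at their contacts with a closed set\<close>

lemma first_hit_segment:
  fixes a c :: complex
  assumes "closed C" "closed_segment a c \<inter> C \<noteq> {}"
  obtains z where "z \<in> closed_segment a c" "closed_segment a z \<inter> C = {z}"
proof -
  have "closed (closed_segment a c \<inter> C)" using assms by (intro closed_Int) auto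
  then obtain z where z: "z \<in> closed_segment a c \<inter> C" "\<And>y. y \<in> closed_segment a c \<inter> C \<Longrightarrow> dist a z \<le> dist a y"
    using distance_attains_inf[of "closed_segment a c \<inter> C" a] assms by blast
  have "x = z" if "x \<in> closed_segment a z" "x \<in> C" for x
  proof -
    have "x \<in> closed_segment a c" using that z by (metis IntD1 ends_in_segment(1) in_mono subset_closed_segment)
    then have "dist a z \<le> dist a x" using z that by blast
    moreover have "dist a z = dist a x + dist x z" using that by (simp add: between between_mem_segment[symmetric])
    ultimately show ?thesis by (metis add_le_same_cancel1 dist_le_zero_iff)
  qed
  then show thesis using z that[of z] by auto
qed

text \<open>The bend counts of the two parts add up to at most the old count: a cut inside a segment
  creates no bend, and a cut at a bend uses that bend up. The first alternative covers the case
  where only the final point lies on \<open>C\<close>, which leaves no second part.\<close>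

lemma polyline_first_hit_aux:
  assumes "arc (polyline (a # bs @ [b]))" "closed C" "a \<notin> C" "pimg (a # bs @ [b]) \<inter> C \<noteq> {}"
  shows "pimg (a # bs @ [b]) \<inter> C = {b} \<or>
   (\<exists>z bs1 bs2. z \<in> C \<and> length bs1 + length bs2 \<le> length bs \<and>
     arc (polyline (a # bs1 @ [z])) \<and> arc (polyline (z # bs2 @ [b])) \<and>
     pimg (a # bs1 @ [z]) \<union> pimg (z # bs2 @ [b]) = pimg (a # bs @ [b]) \<and>
     pimg (a # bs1 @ [z]) \<inter> pimg (z # bs2 @ [b]) = {z} \<and> pimg (a # bs1 @ [z]) \<inter> C = {z})"
  using assms
proof (induction bs arbitrary: a)
  case Nil
  then have ab: "a \<noteq> b" "closed_segment a b \<inter> C \<noteq> {}" by auto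
  obtain z where z: "z \<in> closed_segment a b" "closed_segment a z \<inter> C = {z}"
    using first_hit_segment[OF Nil(2) ab(2)] by blast
  have zC: "z \<in> C" using z by blast
  have za: "z \<noteq> a" using zC Nil by blast
  show ?case
  proof (cases "z = b")
    case True
    then show ?thesis using z by auto
  next
    case False
    have "closed_segment a z \<union> closed_segment z b = closed_segment a b" "closed_segment a z \<inter> closed_segment z b = {z}"
      using Un_closed_segment[OF z(1)] Int_closed_segment[of z a b] z(1) by auto
    then show ?thesis using zC za False z by (intro disjI2 exI[of _ z] exI[of _ "[]"]) auto
  qed
next
  case (Cons c bs)
  obtain c' cs where cs: "bs @ [b] = c' # cs" by (cases bs) auto
  have A: "a \<noteq> c" "arc (polyline (c # bs @ [b]))" "closed_segment a c \<inter> pimg (c # bs @ [b]) \<subseteq> {c}"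
    using Cons.prems(1) arc_polyline_Cons[of a c c' cs] cs by (auto simp del: pimg_Cons)
  have P: "pimg (a # (c # bs) @ [b]) = closed_segment a c \<union> pimg (c # bs @ [b])" by simp
  show ?case
  proof (cases "closed_segment a c \<inter> C = {}")
    case False
    obtain z where z: "z \<in> closed_segment a c" "closed_segment a z \<inter> C = {z}"
      using first_hit_segment[OF Cons.prems(2) False] by blast
    have zC: "z \<in> C" using z by blast
    have za: "z \<noteq> a" using zC Cons by blast
    show ?thesis
    proof (cases "z = c")
      case True
      have "closed_segment a c \<inter> pimg (c # bs @ [b]) = {c}" using A(3) pimg_endpoints(1)[of c "bs @ [b]"] by auto
      moreover have "pimg (a # [] @ [c]) = closed_segment a c" by auto
      ultimately show ?thesis using zC za A(2) z P unfolding True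
        by (intro disjI2 exI[of _ c] exI[of _ "[]"] exI[of _ bs] conjI) (simp_all del: pimg_Cons)
    next
      case False
      have S: "closed_segment a z \<union> closed_segment z c = closed_segment a c" "closed_segment a z \<inter> closed_segment z c = {z}"
        using Un_closed_segment[OF z(1)] Int_closed_segment[of z a c] z(1) by auto
      have cz: "c \<notin> closed_segment a z" using S(2) False by (metis IntI ends_in_segment(2) singletonD)
      have I: "closed_segment z c \<inter> pimg (c # bs @ [b]) \<subseteq> {c}" using A(3) S by blast
      have "arc (polyline (z # c # bs @ [b]))" using A(2) False I cs by (simp add: arc_polyline_Cons del: pimg_Cons)
      moreover have "closed_segment a z \<inter> (closed_segment z c \<union> pimg (c # bs @ [b])) = {z}"
        using S cz A(3) by blast
      moreover have "closed_segment a z \<union> (closed_segment z c \<union> pimg (c # bs @ [b])) = closed_segment a c \<union> pimg (c # bs @ [b])"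
        using S by blast
      moreover have "pimg (a # [] @ [z]) = closed_segment a z" "pimg (z # (c # bs) @ [b]) = closed_segment z c \<union> pimg (c # bs @ [b])" by auto
      ultimately show ?thesis using zC za z P
        by (intro disjI2 exI[of _ z] exI[of _ "[]"] exI[of _ "c # bs"] conjI) (simp_all del: pimg_Cons)
    qed
  next
    case True
    then have cC: "c \<notin> C" by auto
    have "pimg (c # bs @ [b]) \<inter> C \<noteq> {}" using Cons.prems(4) True P by auto
    from Cons.IH[OF A(2) Cons.prems(2) cC this] show ?thesis
    proof (elim disjE exE conjE)
      assume "pimg (c # bs @ [b]) \<inter> C = {b}"
      then show ?thesis using True P by auto
    next
      fix z bs1 bs2
      assume h: "z \<in> C" "length bs1 + length bs2 \<le> length bs" "arc (polyline (c # bs1 @ [z]))" "arc (polyline (z # bs2 @ [b]))"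
        "pimg (c # bs1 @ [z]) \<union> pimg (z # bs2 @ [b]) = pimg (c # bs @ [b])"
        "pimg (c # bs1 @ [z]) \<inter> pimg (z # bs2 @ [b]) = {z}" "pimg (c # bs1 @ [z]) \<inter> C = {z}"
      obtain c1 cs1 where cs1: "bs1 @ [z] = c1 # cs1" by (cases bs1) auto
      have "c \<noteq> z" using h(1) cC by blast
      then have "c \<notin> pimg (z # bs2 @ [b])" using h(6) pimg_endpoints(1)[of c "bs1 @ [z]"] by blast
      then have "closed_segment a c \<inter> pimg (z # bs2 @ [b]) = {}" using A(3) h(5) by blast
      moreover have "arc (polyline (a # (c # bs1) @ [z]))"
        using A h(3,5) cs1 by (auto simp: arc_polyline_Cons simp del: pimg_Cons)
      moreover have "pimg (a # (c # bs1) @ [z]) = closed_segment a c \<union> pimg (c # bs1 @ [z])" by simp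
      moreover have "(closed_segment a c \<union> pimg (c # bs1 @ [z])) \<union> pimg (z # bs2 @ [b]) = closed_segment a c \<union> pimg (c # bs @ [b])"
        using h(5) by blast
      ultimately show ?thesis using h True P
        by (intro disjI2 exI[of _ z] exI[of _ "c # bs1"] exI[of _ bs2] conjI) (simp_all del: pimg_Cons add: Int_Un_distrib2)
    qed
  qed
qed

lemma polyline_first_hit:
  assumes "arc (polyline (a # bs @ [b]))" "closed C" "a \<notin> C" "b \<notin> C" "pimg (a # bs @ [b]) \<inter> C \<noteq> {}"
  obtains z bs1 bs2 where "z \<in> C" "length bs1 + length bs2 \<le> length bs"
     "arc (polyline (a # bs1 @ [z]))" "arc (polyline (z # bs2 @ [b]))"
     "pimg (a # bs1 @ [z]) \<union> pimg (z # bs2 @ [b]) = pimg (a # bs @ [b])"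
     "pimg (a # bs1 @ [z]) \<inter> pimg (z # bs2 @ [b]) = {z}" "pimg (a # bs1 @ [z]) \<inter> C = {z}"
  using polyline_first_hit_aux[OF assms(1-3,5)] assms(4) that by blast

lemma polyline_last_hit:
  assumes "arc (polyline (a # bs @ [b]))" "closed C" "a \<notin> C" "b \<notin> C" "pimg (a # bs @ [b]) \<inter> C \<noteq> {}"
  obtains z bs1 bs2 where "z \<in> C" "length bs1 + length bs2 \<le> length bs"
     "arc (polyline (a # bs1 @ [z]))" "arc (polyline (z # bs2 @ [b]))"
     "pimg (a # bs1 @ [z]) \<union> pimg (z # bs2 @ [b]) = pimg (a # bs @ [b])"
     "pimg (a # bs1 @ [z]) \<inter> pimg (z # bs2 @ [b]) = {z}" "pimg (z # bs2 @ [b]) \<inter> C = {z}"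
proof -
  note r = polyline_swap_ends
  obtain z bs1 bs2 where h: "z \<in> C" "length bs1 + length bs2 \<le> length (rev bs)"
     "arc (polyline (b # bs1 @ [z]))" "arc (polyline (z # bs2 @ [a]))"
     "pimg (b # bs1 @ [z]) \<union> pimg (z # bs2 @ [a]) = pimg (b # rev bs @ [a])"
     "pimg (b # bs1 @ [z]) \<inter> pimg (z # bs2 @ [a]) = {z}" "pimg (b # bs1 @ [z]) \<inter> C = {z}"
    by (rule polyline_first_hit[of b "rev bs" a C]) (use assms in \<open>simp_all add: r del: pimg_Cons\<close>)
  show thesis
  proof (rule that[of z "rev bs2" "rev bs1"])
    show "z \<in> C" by (rule h(1))
    show "length (rev bs2) + length (rev bs1) \<le> length bs" using h(2) by simp
    show "arc (polyline (a # rev bs2 @ [z]))" unfolding r by (rule h(4))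
    show "arc (polyline (z # rev bs1 @ [b]))" unfolding r by (rule h(3))
    show "pimg (a # rev bs2 @ [z]) \<union> pimg (z # rev bs1 @ [b]) = pimg (a # bs @ [b])"
      using h(5) unfolding r by (simp only: Un_commute)
    show "pimg (a # rev bs2 @ [z]) \<inter> pimg (z # rev bs1 @ [b]) = {z}"
      using h(6) unfolding r by (simp only: Int_commute)
    show "pimg (z # rev bs1 @ [b]) \<inter> C = {z}" unfolding r by (rule h(7))
  qed
qed

text \<open>In contrast to \<open>polyline_last_hit\<close> the starting point may lie on
  \<open>C\<close>, and the suffix may then be the whole arc. This serves a piece that begins at a
  contact with \<open>C\<close> and may return to it.\<close>

lemma polyline_last_hit_suffix:
  assumes "arc (polyline (a # bs @ [b]))" "closed C" "b \<notin> C" "pimg (a # bs @ [b]) \<inter> C \<noteq> {}"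
  obtains z bs2 where "z \<in> C" "length bs2 \<le> length bs" "arc (polyline (z # bs2 @ [b]))"
     "pimg (z # bs2 @ [b]) \<subseteq> pimg (a # bs @ [b])" "pimg (z # bs2 @ [b]) \<inter> C = {z}"
proof -
  note r = polyline_swap_ends
  have "pimg (b # rev bs @ [a]) \<inter> C = {a} \<or>
   (\<exists>z bs1 bs2. z \<in> C \<and> length bs1 + length bs2 \<le> length (rev bs) \<and>
     arc (polyline (b # bs1 @ [z])) \<and> arc (polyline (z # bs2 @ [a])) \<and>
     pimg (b # bs1 @ [z]) \<union> pimg (z # bs2 @ [a]) = pimg (b # rev bs @ [a]) \<and>
     pimg (b # bs1 @ [z]) \<inter> pimg (z # bs2 @ [a]) = {z} \<and> pimg (b # bs1 @ [z]) \<inter> C = {z})"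
    by (rule polyline_first_hit_aux) (use assms in \<open>simp_all add: r del: pimg_Cons\<close>)
  then show thesis
  proof (elim disjE exE conjE)
    assume "pimg (b # rev bs @ [a]) \<inter> C = {a}"
    then have "pimg (a # bs @ [b]) \<inter> C = {a}" unfolding r .
    then show thesis using that[of a bs] assms(1) by blast
  next
    fix z bs1 bs2 assume h: "z \<in> C" "length bs1 + length bs2 \<le> length (rev bs)" "arc (polyline (b # bs1 @ [z]))"
      "pimg (b # bs1 @ [z]) \<union> pimg (z # bs2 @ [a]) = pimg (b # rev bs @ [a])" "pimg (b # bs1 @ [z]) \<inter> C = {z}"
    then have "pimg (b # bs1 @ [z]) \<subseteq> pimg (a # bs @ [b])" by (simp add: r del: pimg_Cons) blast
    moreover have "length bs1 \<le> length bs" using h(2) by simp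
    ultimately show thesis using h(1,3,5) that[of z "rev bs1", unfolded r length_rev] by blast
  qed
qed

lemma polyline_cut:
  assumes "arc (polyline (a # bs @ [b]))" "z \<in> pimg (a # bs @ [b])" "z \<noteq> a" "z \<noteq> b"
  shows "\<exists>bs1 bs2. length bs1 + length bs2 \<le> length bs \<and>
     arc (polyline (a # bs1 @ [z])) \<and> arc (polyline (z # bs2 @ [b])) \<and>
     pimg (a # bs1 @ [z]) \<union> pimg (z # bs2 @ [b]) = pimg (a # bs @ [b]) \<and>
     pimg (a # bs1 @ [z]) \<inter> pimg (z # bs2 @ [b]) = {z}"
proof -
  have "a \<notin> {z}" "pimg (a # bs @ [b]) \<inter> {z} \<noteq> {}" "pimg (a # bs @ [b]) \<inter> {z} \<noteq> {b}" using assms by auto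
  from polyline_first_hit_aux[OF assms(1) closed_singleton this(1,2)] this(3) show ?thesis by blast
qed

section \<open>Straightening disjoint polylines\<close>

text \<open>The vector \<open>n\<close> is the sum of the two unit directions. It vanishes only if
  the path turns straight back at \<open>b\<close>, and then the two segments overlap.\<close>

lemma bisector_inner_pos:
  fixes a b c :: complex
  assumes "a \<noteq> b" "b \<noteq> c" "closed_segment a b \<inter> closed_segment b c \<subseteq> {b}"
  shows "\<exists>n. n \<bullet> (c - b) > 0 \<and> n \<bullet> (b - a) > 0"
proof -
  define u where "u = sgn (c - b)"
  define w where "w = sgn (b - a)"
  have nu: "norm u = 1" "norm w = 1" using assms by (auto simp: u_def w_def norm_sgn)
  have ne: "u + w \<noteq> 0"
  proof
    assume "u + w = 0"
    then have uw: "u = - w" by (simp add: eq_neg_iff_add_eq_0)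
    define l where "l = norm (b - a)"
    define m where "m = norm (c - b)"
    have lm: "l > 0" "m > 0" using assms by (auto simp: l_def m_def)
    have ba: "a = b - l *\<^sub>R w" using lm by (simp add: w_def l_def sgn_div_norm)
    have cb: "c = b + m *\<^sub>R u" using lm by (simp add: u_def m_def sgn_div_norm)
    define t where "t = min l m"
    define x where "x = b - t *\<^sub>R w"
    have "x = (1 - t / l) *\<^sub>R b + (t / l) *\<^sub>R a" unfolding ba x_def using lm by (simp add: algebra_simps)
    moreover have "x = (1 - t / m) *\<^sub>R b + (t / m) *\<^sub>R c" unfolding cb x_def uw using lm by (simp add: algebra_simps)
    moreover have "0 \<le> t / l" "t / l \<le> 1" "0 \<le> t / m" "t / m \<le> 1" using lm by (auto simp: t_def)
    ultimately have "x \<in> closed_segment b a" "x \<in> closed_segment b c" unfolding closed_segment_def by blast+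
    then have "x = b" using assms(3) by (auto simp: closed_segment_commute)
    then show False using lm nu by (auto simp: x_def t_def min_def split: if_splits)
  qed
  have "(norm (u + w))\<^sup>2 = 2 + 2 * (u \<bullet> w)"
    using nu by (simp add: power2_norm_eq_inner inner_add inner_commute norm_eq_1)
  then have pos: "1 + u \<bullet> w > 0" using ne by (smt (verit) norm_eq_zero zero_less_power2)
  have "(u + w) \<bullet> u > 0" "(u + w) \<bullet> w > 0"
    using pos nu by (auto simp: inner_add inner_commute norm_eq_1)
  moreover have "c - b = norm (c - b) *\<^sub>R u" "b - a = norm (b - a) *\<^sub>R w"
    using assms by (auto simp: u_def w_def sgn_div_norm)
  ultimately have "(u + w) \<bullet> (c - b) > 0" "(u + w) \<bullet> (b - a) > 0"
    using assms by (metis inner_scaleR_right mult_pos_pos right_minus_eq zero_less_norm_iff)+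
  then show ?thesis by blast
qed

text \<open>Induction from the far end: the tail is pulled back to a short stub at \<open>b\<close>,
  the stub is turned into a prolongation of the first segment, and the now straight arc is pulled
  back towards \<open>a\<close>. The bound \<open>T\<close> has to vary in the induction because the
  turn at \<open>b\<close> works only for short stubs.\<close>

lemma shrink_polyline:
  assumes "arc (polyline (a # b # xs))" "open U" "pimg (a # b # xs) - {a} \<subseteq> U" "T > 0"
  shows "\<exists>t f. 0 < t \<and> t \<le> T \<and> supp_homeo U f \<and>
    f ` pimg (a # b # xs) = closed_segment a (a + t *\<^sub>R (b - a)) \<and> f (last (b # xs)) = a + t *\<^sub>R (b - a)"
  using assms
proof (induction xs arbitrary: a b U T)
  case Nil
  then have ab: "a \<noteq> b" by simp
  define t where "t = min T 1"
  have t: "0 < t" "t \<le> 1" "t \<le> T" using Nil by (auto simp: t_def)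
  have "closed_segment (a + t *\<^sub>R (b - a)) b \<subseteq> closed_segment a b - {a}"
  proof -
    have t_eq: "a + t *\<^sub>R (b - a) = (1 - t) *\<^sub>R a + t *\<^sub>R b" by (simp add: algebra_simps)
    then have m: "a + t *\<^sub>R (b - a) \<in> closed_segment a b" using t by (intro in_closed_segmentI) auto
    then have "closed_segment a (a + t *\<^sub>R (b - a)) \<inter> closed_segment (a + t *\<^sub>R (b - a)) b = {a + t *\<^sub>R (b - a)}"
      by (rule Int_closed_segment[OF disjI1])
    moreover have "a + t *\<^sub>R (b - a) \<noteq> a" using t ab by simp
    ultimately have "a \<notin> closed_segment (a + t *\<^sub>R (b - a)) b"
      by (metis IntI ends_in_segment(1) singletonD)
    moreover have "closed_segment (a + t *\<^sub>R (b - a)) b \<subseteq> closed_segment a b"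
      using m by (simp add: subset_closed_segment)
    ultimately show ?thesis by blast
  qed
  moreover have P: "pimg [a, b] = closed_segment a b" by auto
  ultimately have "closed_segment (a + t *\<^sub>R (b - a)) b \<subseteq> U" using Nil.prems(3) by blast
  from push_along[OF Nil.prems(2) ab t(1,2) this] show ?case using t unfolding P by auto
next
  case (Cons c ys)
  have A: "a \<noteq> b" "arc (polyline (b # c # ys))" "closed_segment a b \<inter> pimg (b # c # ys) \<subseteq> {b}"
    using Cons.prems(1) by (auto simp: arc_polyline_Cons simp del: pimg_Cons)
  have P: "pimg (a # b # c # ys) = closed_segment a b \<union> pimg (b # c # ys)" by (rule pimg_Cons)
  have bU: "b \<in> U" using Cons.prems(3) A(1) P by auto
  have bc: "b \<noteq> c" using A(2) by (cases ys) (auto simp: arc_polyline_Cons)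
  have "closed_segment b c \<subseteq> pimg (b # c # ys)" by auto
  then obtain n where n: "n \<bullet> (c - b) > 0" "n \<bullet> (b - a) > 0"
    using bisector_inner_pos[OF A(1) bc] A(3) by blast
  obtain e where e: "e > 0" "ball b e \<subseteq> U" using bU Cons.prems(2) open_contains_ball by blast
  obtain \<delta> where \<delta>: "\<delta> > 0" and mv: "\<And>s T. 0 < s \<Longrightarrow> s < \<delta> \<Longrightarrow> T > 0 \<Longrightarrow> \<exists>t f. 0 < t \<and> t \<le> T \<and>
     supp_homeo (ball b e \<inter> {z. n \<bullet> (z - b) > 0}) f \<and>
     f ` closed_segment b (b + s *\<^sub>R (c - b)) = closed_segment b (b + t *\<^sub>R (b - a)) \<and> f (b + s *\<^sub>R (c - b)) = b + t *\<^sub>R (b - a)"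
    using corner_move[OF n e(1)] by metis
  \<comment> \<open>Taking the first segment out of the allowed support keeps it pointwise fixed
    while the tail is pulled in.\<close>
  define U' where "U' = U - closed_segment a b"
  have "\<exists>s f. 0 < s \<and> s \<le> \<delta> / 2 \<and> supp_homeo U' f \<and>
    f ` pimg (b # c # ys) = closed_segment b (b + s *\<^sub>R (c - b)) \<and> f (last (c # ys)) = b + s *\<^sub>R (c - b)"
  proof (rule Cons.IH[OF A(2)])
    show "open U'" using Cons.prems(2) by (auto simp: U'_def)
    show "pimg (b # c # ys) - {b} \<subseteq> U'" using Cons.prems(3) A(3) P by (auto simp: U'_def simp del: pimg_Cons)
  qed (use \<delta> in auto)
  then obtain s f1 where s: "0 < s" "s \<le> \<delta> / 2" and f1: "supp_homeo U' f1"
    "f1 ` pimg (b # c # ys) = closed_segment b (b + s *\<^sub>R (c - b))" "f1 (last (c # ys)) = b + s *\<^sub>R (c - b)" by blast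
  have nba: "norm (b - a) > 0" using A(1) by simp
  obtain t f2 where t: "0 < t" "t \<le> e / (2 * norm (b - a))" and f2: "supp_homeo (ball b e \<inter> {z. n \<bullet> (z - b) > 0}) f2"
     "f2 ` closed_segment b (b + s *\<^sub>R (c - b)) = closed_segment b (b + t *\<^sub>R (b - a))" "f2 (b + s *\<^sub>R (c - b)) = b + t *\<^sub>R (b - a)"
    using mv[of s "e / (2 * norm (b - a))"] s \<delta> e nba by auto
  define w where "w = b + t *\<^sub>R (b - a)"
  have w_eq: "w - a = (1 + t) *\<^sub>R (b - a)" by (simp add: w_def algebra_simps)
  have b_eq: "b = a + (1 / (1 + t)) *\<^sub>R (w - a)" unfolding w_eq using t by simp
  have bw: "b \<in> closed_segment a w"
  proof -
    define q where "q = 1 / (1 + t)"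
    have "b = a + q *\<^sub>R (w - a)" using b_eq unfolding q_def .
    also have "\<dots> = (1 - q) *\<^sub>R a + q *\<^sub>R w" by (simp add: algebra_simps)
    finally have "b = (1 - q) *\<^sub>R a + q *\<^sub>R w" .
    then show ?thesis by (rule in_closed_segmentI) (use t in \<open>auto simp: q_def\<close>)
  qed
  have f1s: "f1 ` closed_segment a b = closed_segment a b"
    by (rule supp_homeo_fix_image[OF f1(1)]) (auto simp: U'_def)
  \<comment> \<open>The turn is supported in the open half plane into which \<open>n\<close> points,
    and the first segment lies in the complementary one.\<close>
  have f2s: "f2 ` closed_segment a b = closed_segment a b"
  proof (rule supp_homeo_fix_image[OF f2(1)])
    have "n \<bullet> (x - b) \<le> 0" if x: "x \<in> closed_segment a b" for x
    proof -
      obtain q where q: "0 \<le> q" "q \<le> 1" "x = (1 - q) *\<^sub>R a + q *\<^sub>R b" using x unfolding closed_segment_def by blast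
      have "x - b = (- (1 - q)) *\<^sub>R (b - a)" unfolding q(3) by (simp add: algebra_simps)
      then have "n \<bullet> (x - b) = - ((1 - q) * (n \<bullet> (b - a)))" by (simp add: left_diff_distrib)
      then show ?thesis using n(2) q(2) by (simp add: mult_nonneg_nonneg)
    qed
    then show "closed_segment a b \<inter> (ball b e \<inter> {z. 0 < n \<bullet> (z - b)}) = {}"
      unfolding disjoint_iff by (metis IntD2 mem_Collect_eq not_le)
  qed
  have F: "(\<lambda>x. f2 (f1 x)) ` pimg (a # b # c # ys) = closed_segment a w"
    using f1s f2s f1(2) f2(2) Un_closed_segment[OF bw] unfolding P image_image[symmetric, of f2 f1] image_Un w_def by auto
  \<comment> \<open>The straight arc ends at \<open>w\<close>, and \<open>w - a\<close> is
    \<open>1 + t\<close> times \<open>b - a\<close>; the division converts a fraction of the latter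
    into one of the former.\<close>
  define t' where "t' = min T 1 / (1 + t)"
  have t'_eq: "t' * (1 + t) = min T 1" using t by (simp add: t'_def)
  have t': "0 < t'" "t' \<le> 1" "t' * (1 + t) \<le> T"
    using t Cons.prems(4) unfolding t'_eq by (auto simp: t'_def divide_le_eq_1)
  have "\<exists>f. supp_homeo U f \<and> f ` closed_segment a w = closed_segment a (a + t' *\<^sub>R (w - a)) \<and> f w = a + t' *\<^sub>R (w - a)"
  proof (rule push_along[OF Cons.prems(2) _ t'(1,2)])
    show aw: "a \<noteq> w" using w_eq A(1) t by auto
    show "closed_segment (a + t' *\<^sub>R (w - a)) w \<subseteq> U"
    proof
      fix x assume "x \<in> closed_segment (a + t' *\<^sub>R (w - a)) w"
      then obtain q where q: "0 \<le> q" "q \<le> 1" "x = (1 - q) *\<^sub>R (a + t' *\<^sub>R (w - a)) + q *\<^sub>R w" unfolding closed_segment_def by blast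
      define y where "y = ((1 - q) * t' + q) * (1 + t)"
      have "x = a + ((1 - q) * t' + q) *\<^sub>R (w - a)" unfolding q(3) by (simp add: algebra_simps)
      then have xy: "x = a + y *\<^sub>R (b - a)" unfolding w_eq y_def by simp
      have "(1 - q) * t' + q \<le> (1 - q) * 1 + q" using q t' by (intro add_mono mult_left_mono) auto
      then have y1: "y \<le> 1 + t" using t by (simp add: y_def mult_le_cancel_right1)
      have "(1 - q) * t' + q > 0" using q t' by (cases "q = 0") (auto simp: add_nonneg_pos)
      then have y0: "y > 0" using t by (simp add: y_def)
      show "x \<in> U"
      proof (cases "y \<le> 1")
        case True
        have "x = (1 - y) *\<^sub>R a + y *\<^sub>R b" unfolding xy by (simp add: algebra_simps)
        then have "x \<in> closed_segment a b" by (rule in_closed_segmentI) (use True y0 in auto)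
        moreover have "x \<noteq> a" using xy y0 A(1) by simp
        ultimately show ?thesis using Cons.prems(3) P by blast
      next
        case False
        have "x - b = (y - 1) *\<^sub>R (b - a)" unfolding xy by (simp add: algebra_simps)
        then have "norm (x - b) = (y - 1) * norm (b - a)" using False by simp
        also have "\<dots> \<le> t * norm (b - a)" using y1 by (intro mult_right_mono) auto
        also have "\<dots> \<le> e / 2" using t nba by (simp add: field_simps)
        finally have "x \<in> ball b e" using e by (simp add: dist_norm norm_minus_commute)
        then show ?thesis using e by blast
      qed
    qed
  qed
  then obtain f3 where f3: "supp_homeo U f3" "f3 ` closed_segment a w = closed_segment a (a + t' *\<^sub>R (w - a))" "f3 w = a + t' *\<^sub>R (w - a)" by blast
  have "supp_homeo U (\<lambda>x. f3 (f2 (f1 x)))"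
  proof -
    have "supp_homeo U f1" using f1(1) by (rule supp_homeo_mono) (auto simp: U'_def)
    moreover have "supp_homeo U f2" using f2(1) by (rule supp_homeo_mono) (use e in auto)
    ultimately show ?thesis using f3(1) by (metis supp_homeo_comp)
  qed
  moreover have "(\<lambda>x. f3 (f2 (f1 x))) ` pimg (a # b # c # ys) = closed_segment a (a + (t' * (1 + t)) *\<^sub>R (b - a))"
  proof -
    have "(\<lambda>x. f3 (f2 (f1 x))) ` pimg (a # b # c # ys) = f3 ` (\<lambda>x. f2 (f1 x)) ` pimg (a # b # c # ys)"
      by (simp only: image_image)
    then show ?thesis unfolding F f3(2) w_eq scaleR_scaleR .
  qed
  moreover have "f3 (f2 (f1 (last (b # c # ys)))) = a + (t' * (1 + t)) *\<^sub>R (b - a)"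
    using f1(3) f2(3) f3(3) unfolding w_eq by (simp add: w_def)
  ultimately show ?case using t' t
    by (intro exI[of _ "t' * (1 + t)"] exI[of _ "\<lambda>x. f3 (f2 (f1 x))"]) auto
qed

text \<open>Everything but the root lies above the root, so the stub left by
  \<open>shrink_polyline\<close> can be turned upright by \<open>corner_move\<close> with normal
  \<open>\<i>\<close>. The result no longer remembers in which direction the arc left its
  root.\<close>

lemma retract_polyline_to_vertical:
  assumes arc: "arc (polyline (r # bs @ [v]))" and U: "open U" "pimg (r # bs @ [v]) - {r} \<subseteq> U"
    and e: "e > 0" "ball r e \<inter> {z. Im z > Im r} \<subseteq> U" and up: "U \<subseteq> {z. Im z > Im r}" and T: "T > 0"
  shows "\<exists>t f. 0 < t \<and> t \<le> T \<and> supp_homeo U f \<and>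
    f ` pimg (r # bs @ [v]) = closed_segment r (r + t *\<^sub>R \<i>) \<and> f v = r + t *\<^sub>R \<i>"
proof -
  obtain b xs where bx: "bs @ [v] = b # xs" by (cases bs) auto
  have rb: "r \<noteq> b" using arc bx by (cases xs) (auto simp: arc_polyline_Cons)
  have "b \<in> pimg (r # b # xs)" by auto
  then have "Im b > Im r" using U(2) up rb unfolding bx by blast
  then have d: "\<i> \<bullet> (b - r) > 0" "\<i> \<bullet> \<i> > 0" by (auto simp: inner_complex_def)
  obtain \<delta> where \<delta>: "\<delta> > 0" and mv: "\<And>s T. 0 < s \<Longrightarrow> s < \<delta> \<Longrightarrow> T > 0 \<Longrightarrow> \<exists>t f. 0 < t \<and> t \<le> T \<and>
     supp_homeo (ball r e \<inter> {z. \<i> \<bullet> (z - r) > 0}) f \<and>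
     f ` closed_segment r (r + s *\<^sub>R (b - r)) = closed_segment r (r + t *\<^sub>R \<i>) \<and> f (r + s *\<^sub>R (b - r)) = r + t *\<^sub>R \<i>"
    using corner_move[OF d e(1)] by metis
  obtain s f1 where s: "0 < s" "s \<le> \<delta> / 2" and f1: "supp_homeo U f1"
    "f1 ` pimg (r # b # xs) = closed_segment r (r + s *\<^sub>R (b - r))" "f1 (last (b # xs)) = r + s *\<^sub>R (b - r)"
    using shrink_polyline[of r b xs U "\<delta> / 2"] arc U \<delta> unfolding bx by auto
  obtain t f2 where t: "0 < t" "t \<le> T" and f2: "supp_homeo (ball r e \<inter> {z. \<i> \<bullet> (z - r) > 0}) f2"
     "f2 ` closed_segment r (r + s *\<^sub>R (b - r)) = closed_segment r (r + t *\<^sub>R \<i>)" "f2 (r + s *\<^sub>R (b - r)) = r + t *\<^sub>R \<i>"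
    using mv[of s T] s \<delta> T by auto
  have "supp_homeo U f2" using f2(1) by (rule supp_homeo_mono) (use e in \<open>auto simp: inner_complex_def\<close>)
  then have "supp_homeo U (\<lambda>x. f2 (f1 x))" using f1(1) by (rule supp_homeo_comp[rotated])
  moreover have "(\<lambda>x. f2 (f1 x)) ` pimg (r # b # xs) = closed_segment r (r + t *\<^sub>R \<i>)"
    using f1(2) f2(2) by (metis image_image)
  moreover have "last (b # xs) = v" using bx by (metis last_snoc)
  ultimately show ?thesis using t f1(3) f2(3) unfolding bx
    by (intro exI[of _ t] exI[of _ "\<lambda>x. f2 (f1 x)"]) auto
qed

section \<open>Connected complements and forced crossings\<close>

lemma connected_compl_family:
  fixes T :: "complex set"
  assumes "finite I" "closed T" "connected (- T)" "\<And>k. k \<in> I \<Longrightarrow> compact (A k) \<and> convex (A k) \<and> connected (A k \<inter> T)"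
    "\<And>j k. j \<in> I \<Longrightarrow> k \<in> I \<Longrightarrow> j \<noteq> k \<Longrightarrow> A j \<inter> A k = {}"
  shows "connected (- (T \<union> (\<Union>k\<in>I. A k))) \<and> closed (T \<union> (\<Union>k\<in>I. A k))"
  using assms
proof (induction I rule: finite_induct)
  case (insert k I)
  have IH: "connected (- (T \<union> (\<Union>k\<in>I. A k)))" "closed (T \<union> (\<Union>k\<in>I. A k))" using insert by auto
  have A: "compact (A k)" "convex (A k)" "connected (A k \<inter> T)" using insert by auto
  have "A k \<inter> A j = {}" if "j \<in> I" for j using insert that by (metis insert_iff)
  then have "A k \<inter> (T \<union> (\<Union>k\<in>I. A k)) = A k \<inter> T" by blast
  \<comment> \<open>Janiszewski: if two sets have connected complements and a connected
    intersection, their union has a connected complement. Disjointness within the family reduces the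
    intersection to \<open>A k \<inter> T\<close>.\<close>
  then have "connected (- (A k \<union> (T \<union> (\<Union>k\<in>I. A k))))"
    using A(3) Janiszewski_connected[OF A(1) IH(2) _ _ IH(1)]
      connected_complement_bounded_convex[OF compact_imp_bounded[OF A(1)] A(2)] by simp
  moreover have "A k \<union> (T \<union> (\<Union>k\<in>I. A k)) = T \<union> (\<Union>k\<in>insert k I. A k)" by auto
  moreover have "closed (A k \<union> (T \<union> (\<Union>k\<in>I. A k)))" using IH A compact_imp_closed by blast
  ultimately show ?case by simp
qed auto

text \<open>\<open>fashoda_interlace\<close> carried over from \<open>real^2\<close>; it supplies
  the crossing in \<open>curve_hits_tipseg\<close>.\<close>

lemma fashoda_interlace_complex:
  fixes f g :: "real \<Rightarrow> complex"
  assumes "path f" "path g"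
    and f: "\<And>z. z \<in> path_image f \<Longrightarrow> x0 \<le> Re z \<and> Re z \<le> x1 \<and> 0 \<le> Im z \<and> Im z \<le> y1"
    and g: "\<And>z. z \<in> path_image g \<Longrightarrow> x0 \<le> Re z \<and> Re z \<le> x1 \<and> 0 \<le> Im z \<and> Im z \<le> y1"
    and im: "Im (pathstart f) = 0" "Im (pathfinish f) = 0" "Im (pathstart g) = 0" "Im (pathfinish g) = 0"
    and re: "Re (pathstart f) < Re (pathstart g)" "Re (pathstart g) < Re (pathfinish f)" "Re (pathfinish f) < Re (pathfinish g)"
  shows "path_image f \<inter> path_image g \<noteq> {}"
proof -
  define V where "V = (\<lambda>z. vector [Re z, Im z] :: real^2)"
  have V [simp]: "V z $ 1 = Re z" "V z $ 2 = Im z" for z by (simp_all add: V_def)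
  have inj: "x = y" if "V x = V y" for x y using that by (metis V complex_eqI)
  have "continuous_on S V" for S
  proof -
    have "V = (\<lambda>z. Re z *\<^sub>R axis 1 1 + Im z *\<^sub>R axis 2 1)"
      by (auto simp: vec_eq_iff forall_2 axis_def)
    then show ?thesis by (auto intro!: continuous_intros)
  qed
  then have p: "path (V \<circ> f)" "path (V \<circ> g)" using assms(1,2) path_continuous_image by blast+
  have mem: "V z \<in> cbox (vector [x0, 0]) (vector [x1, y1])" if "x0 \<le> Re z \<and> Re z \<le> x1 \<and> 0 \<le> Im z \<and> Im z \<le> y1" for z
    using that by (auto simp: mem_box_cart forall_2)
  obtain z where "z \<in> path_image (V \<circ> f)" "z \<in> path_image (V \<circ> g)"
  proof (rule fashoda_interlace[OF p, of "vector [x0, 0]" "vector [x1, y1]"])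
    show "path_image (V \<circ> f) \<subseteq> cbox (vector [x0, 0]) (vector [x1, y1])"
      unfolding path_image_compose using f mem by blast
    show "path_image (V \<circ> g) \<subseteq> cbox (vector [x0, 0]) (vector [x1, y1])"
      unfolding path_image_compose using g mem by blast
  qed (use im re in \<open>auto simp: pathstart_compose pathfinish_compose\<close>)
  then show ?thesis unfolding path_image_compose using inj by blast
qed

text \<open>\<open>N\<close> indexes all tips and \<open>I\<close> the edges drawn so far. Tips of
  undrawn edges need prescribed targets too, since respecting the embedding concerns every vertex.
  The map is composed of a retraction of the drawn arcs, a stretching of the resulting stubs to a
  common length, and a motion of the remaining tips.\<close>

lemma homeo_to_vertical_spikes:
  fixes r v :: "'i \<Rightarrow> complex" and bs :: "'i \<Rightarrow> complex list"
  assumes fin: "finite N" and IN: "I \<subseteq> N"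
    and \<Omega>: "open \<Omega>" "\<And>z. z \<in> \<Omega> \<Longrightarrow> Im z > 0"
    and r: "\<And>k. k \<in> N \<Longrightarrow> Im (r k) = 0"
    and R: "\<And>k. k \<in> N \<Longrightarrow> {z. \<bar>Re z - Re (r k)\<bar> < 1 \<and> 0 < Im z \<and> Im z < 1} \<subseteq> \<Omega>"
    and sep: "\<And>j k. j \<in> N \<Longrightarrow> k \<in> N \<Longrightarrow> j \<noteq> k \<Longrightarrow> \<bar>Re (r j) - Re (r k)\<bar> \<ge> 2"
    and v: "\<And>k. k \<in> N \<Longrightarrow> v k \<in> \<Omega>" "inj_on v N" "\<And>j k. j \<in> N \<Longrightarrow> k \<in> N \<Longrightarrow> \<bar>Re (v j) - Re (r k)\<bar> \<ge> 1"
    and arcs: "\<And>k. k \<in> I \<Longrightarrow> arc (polyline (r k # bs k @ [v k]))"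
    and sub: "\<And>k. k \<in> I \<Longrightarrow> pimg (r k # bs k @ [v k]) - {r k} \<subseteq> \<Omega>"
    and disj: "\<And>j k. j \<in> I \<Longrightarrow> k \<in> I \<Longrightarrow> j \<noteq> k \<Longrightarrow> pimg (r j # bs j @ [v j]) \<inter> pimg (r k # bs k @ [v k]) = {}"
    and vnot: "\<And>j k. j \<in> N \<Longrightarrow> k \<in> I \<Longrightarrow> j \<noteq> k \<Longrightarrow> v j \<notin> pimg (r k # bs k @ [v k])"
    and conn: "connected (\<Omega> - (\<Union>k\<in>I. closed_segment (r k) (r k + (1/2) *\<^sub>R \<i>)))"
  shows "\<exists>f. supp_homeo \<Omega> f \<and>
    (\<forall>k\<in>I. f ` pimg (r k # bs k @ [v k]) = closed_segment (r k) (r k + (1/2) *\<^sub>R \<i>)) \<and>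
    (\<forall>k\<in>N. f (v k) = r k + (1/2) *\<^sub>R \<i>)"
proof -
  define \<gamma> where "\<gamma> = (\<lambda>k. pimg (r k # bs k @ [v k]))"
  have finI: "finite I" using fin IN finite_subset by blast
  have r\<gamma>: "r k \<in> \<gamma> k" for k by (simp add: \<gamma>_def del: pimg_Cons)
  have v\<gamma>: "v k \<in> \<gamma> k" for k by (simp add: \<gamma>_def del: pimg_Cons)
  have cl: "closed (\<gamma> k)" for k by (simp add: \<gamma>_def del: pimg_Cons)
  have ne: "\<gamma> k \<noteq> {}" for k using r\<gamma> by blast
  have r\<Omega>: "r k \<notin> \<Omega>" if "k \<in> N" for k using \<Omega>(2)[of "r k"] r[OF that] by auto
  \<comment> \<open>Voronoi cells: the points closer to \<open>\<gamma> k\<close> than to any other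
    drawn arc, without the other tips. They provide disjoint open neighbourhoods, so the arcs can be
    retracted independently while all other tips stay in place.\<close>
  define O' where "O' = (\<lambda>k. {z. \<forall>j\<in>I-{k}. infdist z (\<gamma> k) < infdist z (\<gamma> j)} - v ` (N - {k}))"
  define U where "U = (\<lambda>k. \<Omega> \<inter> O' k)"
  have openO: "open (O' k)" for k
  proof -
    have "{z. \<forall>j\<in>I-{k}. infdist z (\<gamma> k) < infdist z (\<gamma> j)} = (\<Inter>j\<in>I-{k}. {z. infdist z (\<gamma> k) < infdist z (\<gamma> j)})" by auto
    moreover have "open (\<Inter>j\<in>I-{k}. {z. infdist z (\<gamma> k) < infdist z (\<gamma> j)})"
      using finI by (intro open_INT ballI open_Collect_less continuous_intros) auto
    ultimately show ?thesis unfolding O'_def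
      using fin by (intro open_Diff finite_imp_closed) auto
  qed
  have \<gamma>O: "\<gamma> k \<subseteq> O' k" if "k \<in> I" for k
  proof
    fix z assume z: "z \<in> \<gamma> k"
    have "infdist z (\<gamma> k) < infdist z (\<gamma> j)" if "j \<in> I - {k}" for j
    proof -
      have "z \<notin> \<gamma> j" using disj[of j k] that \<open>k \<in> I\<close> z unfolding \<gamma>_def by blast
      then have "infdist z (\<gamma> j) \<noteq> 0" using in_closed_iff_infdist_zero[OF cl ne] by blast
      moreover have "infdist z (\<gamma> k) = 0" using z by (rule infdist_zero)
      ultimately show ?thesis using infdist_nonneg[of z "\<gamma> j"] by linarith
    qed
    moreover have "z \<notin> v ` (N - {k})" using vnot[of _ k] z that unfolding \<gamma>_def by blast
    ultimately show "z \<in> O' k" unfolding O'_def by blast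
  qed
  have Udisj: "U j \<inter> U k = {}" if "j \<in> I" "k \<in> I" "j \<noteq> k" for j k
  proof -
    have False if "z \<in> U j" "z \<in> U k" for z
    proof -
      have "infdist z (\<gamma> j) < infdist z (\<gamma> k)" using that \<open>k \<in> I\<close> \<open>j \<noteq> k\<close> unfolding U_def O'_def by blast
      moreover have "infdist z (\<gamma> k) < infdist z (\<gamma> j)" using that \<open>j \<in> I\<close> \<open>j \<noteq> k\<close> unfolding U_def O'_def by blast
      ultimately show False by simp
    qed
    then show ?thesis by blast
  qed
  have "\<exists>t f. 0 < t \<and> t \<le> 1/4 \<and> supp_homeo (U k) f \<and>
    f ` \<gamma> k = closed_segment (r k) (r k + t *\<^sub>R \<i>) \<and> f (v k) = r k + t *\<^sub>R \<i>" if k: "k \<in> I" for k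
  proof -
    have kN: "k \<in> N" using k IN by blast
    obtain e where e: "e > 0" "ball (r k) e \<subseteq> O' k"
      using openO \<gamma>O[OF k] r\<gamma> open_contains_ball by blast
    have "ball (r k) (min e 1) \<inter> {z. Im z > Im (r k)} \<subseteq> U k"
    proof
      fix z assume z: "z \<in> ball (r k) (min e 1) \<inter> {z. Im z > Im (r k)}"
      have "norm (z - r k) < 1" using z by (simp add: dist_norm norm_minus_commute)
      then have "\<bar>Re (z - r k)\<bar> < 1" "\<bar>Im (z - r k)\<bar> < 1" using abs_Re_le_cmod abs_Im_le_cmod order_le_less_trans by blast+
      then have "z \<in> \<Omega>" using z R[OF kN] r[OF kN] by auto
      moreover have "z \<in> O' k" using z e by auto
      ultimately show "z \<in> U k" by (simp add: U_def)
    qed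
    moreover have "pimg (r k # bs k @ [v k]) - {r k} \<subseteq> U k"
      using sub[OF k] \<gamma>O[OF k] unfolding U_def \<gamma>_def by blast
    moreover have "U k \<subseteq> {z. Im z > Im (r k)}" using \<Omega>(2) r[OF kN] by (auto simp: U_def)
    ultimately show ?thesis unfolding \<gamma>_def
      by (intro retract_polyline_to_vertical[OF arcs[OF k], where e = "min e 1"])
        (use e \<Omega>(1) openO in \<open>auto simp: U_def\<close>)
  qed
  then obtain t f where tf: "\<And>k. k \<in> I \<Longrightarrow> 0 < t k \<and> t k \<le> 1/4 \<and> supp_homeo (U k) (f k) \<and>
    f k ` \<gamma> k = closed_segment (r k) (r k + t k *\<^sub>R \<i>) \<and> f k (v k) = r k + t k *\<^sub>R \<i>" by metis
  obtain F1 where F1: "supp_homeo (\<Union>k\<in>I. U k) F1" "\<And>k x. k \<in> I \<Longrightarrow> x \<in> U k \<Longrightarrow> F1 x = f k x"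
    using supp_homeo_finite_family[OF finI, of U f] tf Udisj by blast
  have F1\<gamma>: "F1 x = f k x" if "k \<in> I" "x \<in> \<gamma> k" for k x
  proof (cases "x = r k")
    case True
    have "r k \<notin> \<Omega>" using r\<Omega> that IN by blast
    then have "x \<notin> (\<Union>k\<in>I. U k)" "x \<notin> U k" using True by (auto simp: U_def)
    then show ?thesis using supp_homeo_fix[OF F1(1)] supp_homeo_fix tf[OF that(1)] by metis
  next
    case False
    then have "x \<in> U k" using sub[OF that(1)] \<gamma>O[OF that(1)] that unfolding U_def \<gamma>_def by blast
    then show ?thesis using F1(2) that by blast
  qed
  have F1img: "F1 ` \<gamma> k = closed_segment (r k) (r k + t k *\<^sub>R \<i>)" "F1 (v k) = r k + t k *\<^sub>R \<i>" if "k \<in> I" for k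
    using F1\<gamma>[OF that] tf[OF that] v\<gamma> by (auto cong: image_cong_simp)
  have F1v: "F1 (v j) = v j" if "j \<in> N - I" for j
  proof (rule supp_homeo_fix[OF F1(1)])
    show "v j \<notin> (\<Union>k\<in>I. U k)" using that unfolding U_def O'_def by blast
  qed
  \<comment> \<open>The retractions give no control over the stub lengths \<open>t k\<close> except
    from above. Inside the disjoint boxes \<open>Q k\<close> the stubs are stretched to length 1/2,
    by the inverse of a push that shortens.\<close>
  define Q where "Q = (\<lambda>k. {z. \<bar>Re z - Re (r k)\<bar> < 1 \<and> 0 < Im z \<and> Im z < 1})"
  have Qopen: "open (Q k)" for k
    unfolding Q_def by (intro open_Collect_conj open_Collect_less continuous_intros)
  have spike: "closed_segment (r k + s *\<^sub>R \<i>) (r k + u *\<^sub>R \<i>) = {z. Re z = Re (r k) \<and> s \<le> Im z \<and> Im z \<le> u}" if "k \<in> N" "s \<le> u" for k s u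
    using that r[OF that(1)] by (subst closed_segment_same_Re) (auto simp: closed_segment_eq_real_ivl)
  have spike0: "closed_segment (r k) (r k + u *\<^sub>R \<i>) = {z. Re z = Re (r k) \<and> 0 \<le> Im z \<and> Im z \<le> u}" if "k \<in> N" "0 \<le> u" for k u
    using spike[OF that] by simp
  have "\<exists>g. supp_homeo (Q k) g \<and> g ` closed_segment (r k) (r k + t k *\<^sub>R \<i>) = closed_segment (r k) (r k + (1/2) *\<^sub>R \<i>) \<and>
     g (r k + t k *\<^sub>R \<i>) = r k + (1/2) *\<^sub>R \<i>" if k: "k \<in> I" for k
  proof -
    have kN: "k \<in> N" using k IN by blast
    let ?w = "r k + (1/2) *\<^sub>R \<i>"
    have e: "r k + (2 * t k) *\<^sub>R (?w - r k) = r k + t k *\<^sub>R \<i>" by simp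
    have t: "0 < 2 * t k" "2 * t k \<le> 1" "t k \<le> 1/2" using tf[OF k] by auto
    have rw: "r k \<noteq> ?w" by simp
    have sub': "closed_segment (r k + (2 * t k) *\<^sub>R (?w - r k)) ?w \<subseteq> Q k"
      unfolding e using spike[OF kN t(3)] t by (auto simp: Q_def)
    obtain g where g: "supp_homeo (Q k) g" "g ` closed_segment (r k) ?w = closed_segment (r k) (r k + t k *\<^sub>R \<i>)" "g ?w = r k + t k *\<^sub>R \<i>"
      using push_along[OF Qopen rw t(1,2) sub'] unfolding e by blast
    obtain g' where g': "supp_homeo (Q k) g'" "\<And>x. g' (g x) = x" "\<And>x. g (g' x) = x"
      by (rule supp_homeo_inverse[OF g(1)]) (rule that)
    have "g' ` closed_segment (r k) (r k + t k *\<^sub>R \<i>) = closed_segment (r k) ?w"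
      unfolding g(2)[symmetric] using g'(2) by (simp add: image_image)
    moreover have "g' (r k + t k *\<^sub>R \<i>) = ?w" unfolding g(3)[symmetric] by (rule g'(2))
    ultimately show ?thesis using g'(1) by blast
  qed
  then obtain g where g: "\<And>k. k \<in> I \<Longrightarrow> supp_homeo (Q k) (g k) \<and> g k ` closed_segment (r k) (r k + t k *\<^sub>R \<i>) = closed_segment (r k) (r k + (1/2) *\<^sub>R \<i>) \<and>
     g k (r k + t k *\<^sub>R \<i>) = r k + (1/2) *\<^sub>R \<i>" by metis
  have Qdisj: "Q j \<inter> Q k = {}" if "j \<in> N" "k \<in> N" "j \<noteq> k" for j k
    using sep[OF that] by (auto simp: Q_def)
  obtain F2 where F2: "supp_homeo (\<Union>k\<in>I. Q k) F2" "\<And>k x. k \<in> I \<Longrightarrow> x \<in> Q k \<Longrightarrow> F2 x = g k x"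
    using supp_homeo_finite_family[OF finI, of Q g] g Qdisj IN by blast
  have F2s: "F2 x = g k x" if "k \<in> I" "x \<in> closed_segment (r k) (r k + t k *\<^sub>R \<i>)" for k x
  proof (cases "x = r k")
    case True
    have "x \<notin> (\<Union>k\<in>I. Q k)" "x \<notin> Q k" using True r[of k] that(1) IN by (auto simp: Q_def)
    then show ?thesis using supp_homeo_fix[OF F2(1)] supp_homeo_fix g[OF that(1)] by metis
  next
    case False
    have kN: "k \<in> N" using that IN by blast
    have tk: "0 \<le> t k" "t k \<le> 1/4" using tf[OF that(1)] by auto
    have x: "Re x = Re (r k)" "0 \<le> Im x" "Im x \<le> t k" using that(2) spike0[OF kN tk(1)] by auto
    have "Im x \<noteq> 0" using False x r[OF kN] by (auto simp: complex_eq_iff)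
    then have "x \<in> Q k" using x tk by (auto simp: Q_def)
    then show ?thesis using F2(2) that by blast
  qed
  have F2img: "F2 ` closed_segment (r k) (r k + t k *\<^sub>R \<i>) = closed_segment (r k) (r k + (1/2) *\<^sub>R \<i>)" "F2 (r k + t k *\<^sub>R \<i>) = r k + (1/2) *\<^sub>R \<i>" if "k \<in> I" for k
    using F2s[OF that] g[OF that] by (auto cong: image_cong_simp)
  have F2v: "F2 (v j) = v j" if "j \<in> N - I" for j
  proof (rule supp_homeo_fix[OF F2(1)])
    have "v j \<notin> Q k" if "k \<in> I" for k
      using v(3)[of j k] \<open>j \<in> N - I\<close> that IN by (auto simp: Q_def)
    then show "v j \<notin> (\<Union>k\<in>I. Q k)" by blast
  qed
  define S where "S = \<Omega> - (\<Union>k\<in>I. closed_segment (r k) (r k + (1/2) *\<^sub>R \<i>))"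
  have Sopen: "open S" unfolding S_def using \<Omega>(1) finI by (intro open_Diff closed_UN) auto
  \<comment> \<open>The undrawn tips are moved last, in the complement of the finished spikes; this
    is the only place where connectedness of that complement enters.\<close>
  have "\<exists>F3. supp_homeo S F3 \<and> (\<forall>j\<in>N - I. F3 (v j) = r j + (1/2) *\<^sub>R \<i>)"
  proof (cases "N - I = {}")
    case True
    then show ?thesis using supp_homeo_id by blast
  next
    case False
    have notspike: "z \<notin> (\<Union>k\<in>I. closed_segment (r k) (r k + (1/2) *\<^sub>R \<i>))" if "\<And>k. k \<in> I \<Longrightarrow> Re z \<noteq> Re (r k)" for z
      using that spike0[of _ "1/2"] IN by auto
    have vS: "v j \<in> S" if "j \<in> N - I" for j
      unfolding S_def using v(1)[of j] v(3)[of j] that IN by (intro DiffI notspike) force+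
    have rS: "r j + (1/2) *\<^sub>R \<i> \<in> S" if "j \<in> N - I" for j
    proof -
      have "r j + (1/2) *\<^sub>R \<i> \<in> \<Omega>" using R[of j] r[of j] that by auto
      moreover have "Re (r j + (1/2) *\<^sub>R \<i>) \<noteq> Re (r k)" if "k \<in> I" for k
      proof -
        have "j \<in> N" "k \<in> N" "j \<noteq> k" using \<open>j \<in> N - I\<close> that IN by auto
        from sep[OF this] show ?thesis by auto
      qed
      ultimately show ?thesis unfolding S_def using notspike by blast
    qed
    have "S \<noteq> {}" using False vS by blast
    then have hull: "UNIV \<subseteq> affine hull S" using affine_hull_open[OF Sopen] by simp
    have pw: "pairwise (\<lambda>i j. v i \<noteq> v j \<and> r i + (1/2) *\<^sub>R \<i> \<noteq> r j + (1/2) *\<^sub>R \<i>) (N - I)"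
    proof -
      have "r i \<noteq> r j" if "i \<in> N" "j \<in> N" "i \<noteq> j" for i j using sep[OF that] by auto
      then show ?thesis using v(2) unfolding pairwise_def inj_on_def by auto
    qed
    obtain F3 G3 where F3: "homeomorphism UNIV UNIV F3 G3" "\<And>j. j \<in> N - I \<Longrightarrow> F3 (v j) = r j + (1/2) *\<^sub>R \<i>"
      "{x. \<not> (F3 x = x \<and> G3 x = x)} \<subseteq> S" "bounded {x. \<not> (F3 x = x \<and> G3 x = x)}"
    proof (rule homeomorphism_moving_points_exists[of S UNIV "N - I" v "\<lambda>j. r j + (1/2) *\<^sub>R \<i>"])
      show "connected S" using conn unfolding S_def .
      then show "connected S" .
      show "v i \<in> S \<and> r i + (1/2) *\<^sub>R \<i> \<in> S" if "i \<in> N - I" for i using vS rS that by blast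
    qed (use Sopen hull pw fin in \<open>auto\<close>)
    then show ?thesis unfolding supp_homeo_def by blast
  qed
  then obtain F3 where F3: "supp_homeo S F3" "\<And>j. j \<in> N - I \<Longrightarrow> F3 (v j) = r j + (1/2) *\<^sub>R \<i>" by blast
  have F3s: "F3 x = x" if "x \<in> closed_segment (r k) (r k + (1/2) *\<^sub>R \<i>)" "k \<in> I" for x k
    using supp_homeo_fix[OF F3(1)] that unfolding S_def by blast
  have QO: "Q k \<subseteq> \<Omega>" if "k \<in> N" for k using R[OF that] by (simp add: Q_def)
  have "supp_homeo \<Omega> F1" using F1(1) by (rule supp_homeo_mono) (auto simp: U_def)
  moreover have "supp_homeo \<Omega> F2" using F2(1) by (rule supp_homeo_mono) (use QO IN in blast)
  moreover have "supp_homeo \<Omega> F3" using F3(1) by (rule supp_homeo_mono) (auto simp: S_def)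
  ultimately have "supp_homeo \<Omega> (\<lambda>x. F3 (F2 (F1 x)))" by (metis supp_homeo_comp)
  moreover have "(\<lambda>x. F3 (F2 (F1 x))) ` \<gamma> k = closed_segment (r k) (r k + (1/2) *\<^sub>R \<i>)" if "k \<in> I" for k
  proof -
    have "(\<lambda>x. F3 (F2 (F1 x))) ` \<gamma> k = F3 ` F2 ` F1 ` \<gamma> k" by (simp add: image_image)
    also have "\<dots> = closed_segment (r k) (r k + (1/2) *\<^sub>R \<i>)"
      unfolding F1img[OF that] F2img[OF that] using F3s that by (auto simp: image_def)
    finally show ?thesis .
  qed
  moreover have "F3 (F2 (F1 (v k))) = r k + (1/2) *\<^sub>R \<i>" if "k \<in> N" for k
  proof (cases "k \<in> I")
    case True
    then show ?thesis using F1img F2img F3s[of "r k + (1/2) *\<^sub>R \<i>" k] by simp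
  next
    case False
    then show ?thesis using that F1v F2v F3 by simp
  qed
  ultimately show ?thesis unfolding \<gamma>_def by blast
qed

lemma connected_arc_minus_start:
  fixes g :: "real \<Rightarrow> 'a::topological_space"
  assumes "arc g"
  shows "connected (path_image g - {pathstart g})"
proof -
  have "path_image g - {pathstart g} = g ` {0<..1}"
  proof -
    have "g t \<noteq> g 0" if "t \<in> {0<..1}" for t
      using assms that unfolding arc_def inj_on_def by force
    moreover have "{0..1::real} = insert 0 {0<..1}" by auto
    ultimately show ?thesis unfolding path_image_def pathstart_def by auto
  qed
  moreover have "continuous_on {0<..1} g"
    using assms unfolding arc_def path_def by (auto elim: continuous_on_subset)
  moreover have "connected {0<..1::real}" by (intro convex_connected convex_real_interval)
  ultimately show ?thesis using connected_continuous_image[of "{0<..1}" g] by simp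
qed

section \<open>The maze\<close>

lemma segment_point_at_Re:
  fixes w u :: complex
  assumes "Re w \<le> s" "s \<le> Re u" "Re w < Re u"
  shows "Complex s (Im w + (s - Re w) * ((Im u - Im w) / (Re u - Re w))) \<in> closed_segment w u"
proof -
  define t where "t = (s - Re w) / (Re u - Re w)"
  have t: "0 \<le> t" "t \<le> 1" using assms by (auto simp: t_def)
  have "s = (1 - t) * Re w + t * Re u"
  proof -
    have "t * (Re u - Re w) = s - Re w" using assms by (simp add: t_def)
    then show ?thesis by (simp add: algebra_simps)
  qed
  then have "Complex s (Im w + (s - Re w) * ((Im u - Im w) / (Re u - Re w))) = (1 - t) *\<^sub>R w + t *\<^sub>R u"
  proof -
    have "(s - Re w) * ((Im u - Im w) / (Re u - Re w)) = t * (Im u - Im w)" by (simp add: t_def)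
    then have "Complex s (Im w + (s - Re w) * ((Im u - Im w) / (Re u - Re w))) = Complex s (Im w + t * (Im u - Im w))" by simp
    also have "\<dots> = (1 - t) *\<^sub>R w + t *\<^sub>R u" using \<open>s = _\<close> by (simp add: complex_eq_iff algebra_simps)
    finally show ?thesis .
  qed
  then show ?thesis using t by (rule in_closed_segmentI)
qed

lemma midpoint_in_closed_segment:
  fixes a b :: complex
  shows "Complex ((Re a + Re b) / 2) ((Im a + Im b) / 2) \<in> closed_segment a b"
  by (rule in_closed_segmentI[of _ "1/2"]) (auto simp: complex_eq_iff)

lemma mem_vertical_segment:
  "a \<le> b \<Longrightarrow> z \<in> closed_segment (Complex x a) (Complex x b) \<longleftrightarrow> Re z = x \<and> a \<le> Im z \<and> Im z \<le> b"
  by (subst closed_segment_same_Re) (auto simp: closed_segment_eq_real_ivl)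

lemma mem_horizontal_segment:
  "a \<le> b \<Longrightarrow> z \<in> closed_segment (Complex a y) (Complex b y) \<longleftrightarrow> Im z = y \<and> a \<le> Re z \<and> Re z \<le> b"
  by (subst closed_segment_same_Im) (auto simp: closed_segment_eq_real_ivl)

lemma nat_unit_interval:
  fixes a b :: nat
  assumes "real a \<le> t" "t \<le> real b" "a < b"
  shows "\<exists>x. a \<le> x \<and> x < b \<and> real x \<le> t \<and> t \<le> real x + 1"
proof (cases "t = real b")
  case True
  then show ?thesis using assms by (intro exI[of _ "b - 1"]) (auto simp: of_nat_diff)
next
  case False
  have "0 \<le> t" using assms by (meson of_nat_0_le_iff order_trans)
  then have "real (nat \<lfloor>t\<rfloor>) \<le> t" "t < real (nat \<lfloor>t\<rfloor>) + 1" by linarith+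
  moreover have "a \<le> nat \<lfloor>t\<rfloor>" using assms by (simp add: le_nat_floor)
  moreover have "nat \<lfloor>t\<rfloor> < b" using False assms calculation(1) by linarith
  ultimately show ?thesis by (intro exI[of _ "nat \<lfloor>t\<rfloor>"]) auto
qed

lemma nat_div_mod_cases:
  fixes x :: nat
  obtains j c where "x = 12 * j + c" "c < 12"
  using that[of "x div 12" "x mod 12"] by simp

text \<open>
  Vertex 6 x + y sits at the grid point (x, y) for 0 \<le> x \<le> X and 0 \<le> y \<le> 5, unless that point is neither on
  a wall nor a tip; the remaining vertices are parked below the maze at height -5. All wall edges are unit
  grid edges: the frame, roofs at height 4, and in column x the vertical wall from lo x to hi x.
  Columns are periodic with period 12: 1, 3, 4 (with the roof) form the nook of a tip
  at column 2, with the root of the previous edge at column 4 below the nook's opening, and columns 5 to 11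
  are alternating baffles hanging from the ceiling and standing on the floor. Edge k joins the root rp k to the
  tip tp k one level to the left. The reference drawing p0 differs from p only in having the tips right above their roots.
\<close>

locale maze =
  fixes m n :: nat
  assumes n_large: "72 * m + 78 \<le> n"
begin

definition X :: nat where "X = 12 * (m + 1)"

text \<open>Value 1 leaves a gap above the floor: below columns 5, 7, 9, 11, which hang from the
  ceiling, and below column 4, which hangs from the roof and whose gap is the mouth of the
  nook.\<close>

definition lo :: "nat \<Rightarrow> nat" where
  "lo x = (if x mod 12 \<in> {4, 5, 7, 9, 11} then 1 else 0)"

text \<open>The sides \<open>0\<close> and \<open>X\<close> of the frame come first since their
  residue 0 otherwise carries no wall. Height 0 stands for a degenerate wall, a single point of the
  floor.\<close>

definition hi :: "nat \<Rightarrow> nat" where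
  "hi x = (if x = 0 \<or> x = X then 5 else if x mod 12 \<in> {1, 4} then 4 else if x mod 12 \<in> {5, 7, 9, 11} then 5
     else if x mod 12 \<in> {3, 6, 8, 10} then 3 else 0)"

definition vert :: "nat \<Rightarrow> nat \<Rightarrow> bool" where
  "vert x y \<longleftrightarrow> x \<le> X \<and> lo x \<le> y \<and> y < hi x"

definition horiz :: "nat \<Rightarrow> nat \<Rightarrow> bool" where
  "horiz x y \<longleftrightarrow> x < X \<and> (y = 0 \<or> y = 5 \<or> y = 4 \<and> x mod 12 \<in> {1, 2, 3})"

definition EW :: "nat set set" where
  "EW = {{6 * x + y, 6 * x + (y + 1)} |x y. vert x y} \<union> {{6 * x + y, 6 * (x + 1) + y} |x y. horiz x y}"

text \<open>\<open>72 * k + 96 = 6 * (12 * k + 16)\<close> and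
  \<open>72 * k + 13 = 6 * (12 * k + 2) + 1\<close> are the codes of the grid points
  \<open>rp k\<close> and \<open>tp k\<close>.\<close>

definition rv :: "nat \<Rightarrow> nat" where "rv k = 72 * k + 96"
definition tv :: "nat \<Rightarrow> nat" where "tv k = 72 * k + 13"
definition es :: "nat \<Rightarrow> nat set" where "es k = {tv k, rv k}"

definition pos :: "nat \<Rightarrow> complex" where "pos v = Complex (real (v div 6)) (real (v mod 6))"

definition used :: "nat \<Rightarrow> bool" where "used v \<longleftrightarrow> v \<in> \<Union>EW \<or> (\<exists>k<m. v = tv k)"

definition p :: "nat \<Rightarrow> complex" where "p v = (if used v then pos v else Complex (real v) (-5))"

definition rp :: "nat \<Rightarrow> complex" where "rp k = Complex (12 * real k + 16) 0"
definition tp :: "nat \<Rightarrow> complex" where "tp k = Complex (12 * real k + 2) 1"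

text \<open>As \<open>13 < 72\<close>, the quotient \<open>v div 72\<close> recovers
  \<open>k\<close> from \<open>v = tv k\<close>.\<close>

definition p0 :: "nat \<Rightarrow> complex" where
  "p0 v = (if \<exists>k<m. v = tv k then rp (v div 72) + (1/2) *\<^sub>R \<i> else p v)"

text \<open>Whole walls in coordinates, convenient for membership tests; \<open>W_eq\<close>
  identifies them with the union of the unit edges.\<close>

definition W :: "complex set" where
  "W = {z. 0 \<le> Re z \<and> Re z \<le> real X \<and> (Im z = 0 \<or> Im z = 5)} \<union>
       {z. \<exists>x\<le>X. Re z = real x \<and> real (lo x) \<le> Im z \<and> Im z \<le> real (hi x)} \<union>
       {z. \<exists>k\<le>m. 12 * real k + 1 \<le> Re z \<and> Re z \<le> 12 * real k + 4 \<and> Im z = 4}"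

definition useg :: "nat set \<Rightarrow> complex set" where
  "useg e = closed_segment (pos (Min e)) (pos (Max e))"

section \<open>Walls as unions of unit grid edges\<close>

lemma hi_le: "hi x \<le> 5" by (simp add: hi_def)

lemma lo_hi: "lo x < hi x \<or> lo x = 0 \<and> hi x = 0"
  by (auto simp: lo_def hi_def X_def)

lemma lo_hi_offset:
  assumes "c < 12" "0 < c"
  shows "lo (12 * j + c) = (if c \<in> {4, 5, 7, 9, 11} then 1 else 0)"
    and "hi (12 * j + c) = (if c \<in> {1, 4} then 4 else if c \<in> {5, 7, 9, 11} then 5 else if c \<in> {3, 6, 8, 10} then 3 else 0)"
proof -
  have c: "(12 * j + c) mod 12 = c" using assms by simp
  show "lo (12 * j + c) = (if c \<in> {4, 5, 7, 9, 11} then 1 else 0)" unfolding lo_def c ..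
  have "12 * j + c \<noteq> X" using c assms unfolding X_def by (metis less_numeral_extra(3) mod_mult_self1_is_0)
  then show "hi (12 * j + c) = (if c \<in> {1, 4} then 4 else if c \<in> {5, 7, 9, 11} then 5 else if c \<in> {3, 6, 8, 10} then 3 else 0)"
    unfolding hi_def c using assms by auto
qed

lemma pos_grid: "y < 6 \<Longrightarrow> pos (6 * x + y) = Complex (real x) (real y)"
  by (simp add: pos_def)

lemma EW_cases:
  assumes "e \<in> EW"
  obtains (vert) x y where "e = {6 * x + y, 6 * x + (y + 1)}" "vert x y" "y < 5" "x \<le> X"
      "Min e = 6 * x + y" "Max e = 6 * x + (y + 1)"
      "useg e = {z. Re z = real x \<and> real y \<le> Im z \<and> Im z \<le> real y + 1}"
    | (horiz) x y where "e = {6 * x + y, 6 * (x + 1) + y}" "horiz x y" "y < 6" "x < X"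
      "Min e = 6 * x + y" "Max e = 6 * (x + 1) + y"
      "useg e = {z. Im z = real y \<and> real x \<le> Re z \<and> Re z \<le> real x + 1}"
proof -
  consider x y where "e = {6 * x + y, 6 * x + (y + 1)}" "vert x y" | x y where "e = {6 * x + y, 6 * (x + 1) + y}" "horiz x y"
    using assms unfolding EW_def by blast
  then show thesis
  proof cases
    case 1
    have y: "y < 5" "x \<le> X" using 1(2) hi_le[of x] by (auto simp: vert_def)
    have mm: "Min e = 6 * x + y" "Max e = 6 * x + (y + 1)" unfolding 1(1) by auto
    have "pos (6 * x + y) = Complex (real x) (real y)" "pos (6 * x + (y + 1)) = Complex (real x) (real y + 1)"
      using y pos_grid[of y x] pos_grid[of "y + 1" x] by auto
    then have "useg e = {z. Re z = real x \<and> real y \<le> Im z \<and> Im z \<le> real y + 1}"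
      unfolding useg_def mm using mem_vertical_segment[of "real y" "real y + 1" _ "real x"] by auto
    then show thesis using vert 1 y mm by blast
  next
    case 2
    have y: "y < 6" "x < X" using 2(2) by (auto simp: horiz_def)
    have mm: "Min e = 6 * x + y" "Max e = 6 * (x + 1) + y" unfolding 2(1) by auto
    have "pos (6 * x + y) = Complex (real x) (real y)" "pos (6 * (x + 1) + y) = Complex (real x + 1) (real y)"
      using y pos_grid[of y x] pos_grid[of y "x + 1"] by (auto simp: add.commute)
    then have "useg e = {z. Im z = real y \<and> real x \<le> Re z \<and> Re z \<le> real x + 1}"
      unfolding useg_def mm using mem_horizontal_segment[of "real x" "real x + 1" _ "real y"] by auto
    then show thesis using horiz 2 y mm by blast
  qed
qed

text \<open>The largest code of a grid point is \<open>6 * X + 5 = 72 * m + 77\<close>, which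
  explains the bound \<open>n_large\<close>.\<close>

lemma EW_subset: "e \<in> EW \<Longrightarrow> e \<subseteq> {..<n}"
  by (erule EW_cases) (use n_large in \<open>auto simp: X_def\<close>)

lemma EW_card: "e \<in> EW \<Longrightarrow> card e = 2"
  by (erule EW_cases) auto

lemma finite_EW: "finite EW"
  by (rule finite_subset[of _ "Pow {..<n}"]) (use EW_subset in auto)

lemma tv_lt: "k < m \<Longrightarrow> tv k < n" and rv_lt: "k < m \<Longrightarrow> rv k < n"
  using n_large by (auto simp: tv_def rv_def)

lemma inj_pos: "pos v = pos w \<longleftrightarrow> v = w"
proof
  assume "pos v = pos w"
  then have "v div 6 = w div 6" "v mod 6 = w mod 6" by (auto simp: pos_def)
  then show "v = w" by (metis div_mult_mod_eq)
qed simp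

lemma used_mem: "e \<in> EW \<Longrightarrow> v \<in> e \<Longrightarrow> used v" by (auto simp: used_def)

lemma p_used: "used v \<Longrightarrow> p v = pos v" by (simp add: p_def)

lemma inj_p: "inj p"
proof (rule injI)
  fix v w assume "p v = p w"
  then show "v = w"
    by (cases "used v"; cases "used w") (auto simp: p_def inj_pos, auto simp: pos_def)
qed

lemma rv_used: "k < m \<Longrightarrow> used (rv k)"
proof -
  assume "k < m"
  then have "horiz (12 * k + 16) 0" by (auto simp: horiz_def X_def)
  then have "{6 * (12 * k + 16) + 0, 6 * (12 * k + 16 + 1) + 0} \<in> EW" unfolding EW_def by blast
  then show ?thesis by (rule used_mem) (auto simp: rv_def)
qed

lemma tv_used: "k < m \<Longrightarrow> used (tv k)" by (auto simp: used_def)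

lemma p_rv: "k < m \<Longrightarrow> p (rv k) = rp k"
  using rv_used by (auto simp: p_def pos_def rp_def rv_def)

lemma pos_tv: "pos (tv k) = tp k"
proof -
  have "(72 * k + 13) div 6 = 12 * k + 2" "(72 * k + 13) mod 6 = 1" by presburger+
  then show ?thesis by (auto simp: pos_def tp_def tv_def)
qed

lemma p_tv: "k < m \<Longrightarrow> p (tv k) = tp k"
  using tv_used by (simp add: p_def pos_tv)

lemma tv_ne_rv [simp]: "tv j \<noteq> rv k" unfolding tv_def rv_def by presburger

lemma p0_tv: "k < m \<Longrightarrow> p0 (tv k) = rp k + (1/2) *\<^sub>R \<i>"
  by (auto simp: p0_def tv_def)

lemma p0_other: "(\<And>k. k < m \<Longrightarrow> v \<noteq> tv k) \<Longrightarrow> p0 v = p v"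
  by (auto simp: p0_def)

lemma es_Min_Max [simp]: "Min (es k) = tv k" "Max (es k) = rv k"
  by (auto simp: es_def tv_def rv_def)

lemma es_inj [simp]: "es j = es k \<longleftrightarrow> j = k"
  by (metis es_Min_Max(1) add_right_cancel mult_cancel1 tv_def zero_neq_numeral)

lemma es_card: "card (es k) = 2" by (simp add: es_def)

lemma es_subset: "k < m \<Longrightarrow> es k \<subseteq> {..<n}" using tv_lt rv_lt by (auto simp: es_def)

text \<open>Two distinct unit grid edges meet in grid points only, because a non-grid point determines its edge.\<close>

definition edge_through :: "complex \<Rightarrow> nat set" where
  "edge_through z = (let x = nat \<lfloor>Re z\<rfloor>; y = nat \<lfloor>Im z\<rfloor> in
     if real x = Re z then {6 * x + y, 6 * x + (y + 1)} else {6 * x + y, 6 * (x + 1) + y})"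

lemma useg_cases:
  assumes e: "e \<in> EW" and z: "z \<in> useg e"
  shows "(\<exists>v\<in>e. z = pos v) \<or> (\<forall>v. z \<noteq> pos v) \<and> e = edge_through z"
  using e
proof (cases rule: EW_cases)
  case (vert x y)
  show ?thesis
  proof (cases "Im z = real y \<or> Im z = real y + 1")
    case True
    have "pos (6 * x + y) = Complex (real x) (real y)" "pos (6 * x + (y + 1)) = Complex (real x) (real y + 1)"
      using vert pos_grid[of y x] pos_grid[of "y + 1" x] by auto
    then have "z = pos (6 * x + y) \<or> z = pos (6 * x + (y + 1))" using True z vert by (auto simp: complex_eq_iff)
    then show ?thesis unfolding vert(1) by blast
  next
    case False
    then have b: "real y < Im z" "Im z < real y + 1" "Re z = real x" using z vert by auto
    then have "nat \<lfloor>Im z\<rfloor> = y" "nat \<lfloor>Re z\<rfloor> = x" by (auto simp: floor_eq_iff nat_eq_iff)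
    then have "e = edge_through z" using b vert by (simp add: edge_through_def Let_def)
    moreover have "z \<noteq> pos v" for v using b by (auto simp: pos_def) 
    ultimately show ?thesis by blast
  qed
next
  case (horiz x y)
  show ?thesis
  proof (cases "Re z = real x \<or> Re z = real x + 1")
    case True
    have "pos (6 * x + y) = Complex (real x) (real y)" "pos (6 * (x + 1) + y) = Complex (real x + 1) (real y)"
      using horiz pos_grid[of y x] pos_grid[of y "x + 1"] by (auto simp: add.commute)
    then have "z = pos (6 * x + y) \<or> z = pos (6 * (x + 1) + y)" using True z horiz by (auto simp: complex_eq_iff)
    then show ?thesis unfolding horiz(1) by blast
  next
    case False
    then have b: "real x < Re z" "Re z < real x + 1" "Im z = real y" using z horiz by auto
    then have "nat \<lfloor>Im z\<rfloor> = y" "nat \<lfloor>Re z\<rfloor> = x" by (auto simp: floor_eq_iff nat_eq_iff)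
    then have "e = edge_through z" using b horiz by (simp add: edge_through_def Let_def)
    moreover have "z \<noteq> pos v" for v using b by (auto simp: pos_def)
    ultimately show ?thesis by blast
  qed
qed

lemma pos_in_useg: "e \<in> EW \<Longrightarrow> v \<in> e \<Longrightarrow> pos v \<in> useg e"
  by (erule EW_cases) (auto simp: useg_def)

lemma useg_pos: "e \<in> EW \<Longrightarrow> pos v \<in> useg e \<Longrightarrow> v \<in> e"
  using useg_cases[of e "pos v"] inj_pos by auto

lemma useg_Int:
  assumes "e \<in> EW" "e' \<in> EW" "e \<noteq> e'"
  shows "useg e \<inter> useg e' = pos ` (e \<inter> e')"
proof
  show "useg e \<inter> useg e' \<subseteq> pos ` (e \<inter> e')"
  proof
    fix z assume z: "z \<in> useg e \<inter> useg e'"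
    then obtain v where "z = pos v" using useg_cases[of e z] useg_cases[of e' z] assms by blast
    then show "z \<in> pos ` (e \<inter> e')" using z useg_pos assms by blast
  qed
qed (use assms pos_in_useg in auto)

lemma W_eq: "W = (\<Union>e\<in>EW. useg e)"
proof
  have vin: "z \<in> (\<Union>e\<in>EW. useg e)" if "vert x y" "Re z = real x" "real y \<le> Im z" "Im z \<le> real y + 1" for x y z
  proof -
    have e: "{6 * x + y, 6 * x + (y + 1)} \<in> EW" using that unfolding EW_def by blast
    have "y < 5" using that(1) hi_le[of x] by (auto simp: vert_def)
    then have "pos (6 * x + y) = Complex (real x) (real y)" "pos (6 * x + (y + 1)) = Complex (real x) (real y + 1)"
      using pos_grid[of y x] pos_grid[of "y + 1" x] by auto
    then have "z \<in> useg {6 * x + y, 6 * x + (y + 1)}" using that by (simp add: useg_def mem_vertical_segment)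
    with e show ?thesis by blast
  qed
  have hin: "z \<in> (\<Union>e\<in>EW. useg e)" if "horiz x y" "Im z = real y" "real x \<le> Re z" "Re z \<le> real x + 1" for x y z
  proof -
    have e: "{6 * x + y, 6 * (x + 1) + y} \<in> EW" using that unfolding EW_def by blast
    have "y < 6" using that(1) by (auto simp: horiz_def)
    then have "pos (6 * x + y) = Complex (real x) (real y)" "pos (6 * (x + 1) + y) = Complex (real x + 1) (real y)"
      using pos_grid[of y x] pos_grid[of y "x + 1"] by (auto simp: add.commute)
    then have "z \<in> useg {6 * x + y, 6 * (x + 1) + y}" using that by (simp add: useg_def mem_horizontal_segment)
    with e show ?thesis by blast
  qed
  have X0: "0 < X" by (simp add: X_def)
  have flat: "z \<in> (\<Union>e\<in>EW. useg e)" if fl: "0 \<le> Re z" "Re z \<le> real X" "Im z = 0 \<or> Im z = 5" for z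
  proof -
    obtain x where x: "x < X" "real x \<le> Re z" "Re z \<le> real x + 1" using nat_unit_interval[of 0 "Re z" X] fl X0 by auto
    have "horiz x 0" "horiz x 5" using x by (auto simp: horiz_def)
    then show ?thesis using hin[of x 0 z] hin[of x 5 z] x that by auto
  qed
  show "W \<subseteq> (\<Union>e\<in>EW. useg e)"
  proof
    fix z assume "z \<in> W"
    then consider "0 \<le> Re z" "Re z \<le> real X" "Im z = 0 \<or> Im z = 5"
      | x where "x \<le> X" "Re z = real x" "real (lo x) \<le> Im z" "Im z \<le> real (hi x)"
      | k where "k \<le> m" "12 * real k + 1 \<le> Re z" "Re z \<le> 12 * real k + 4" "Im z = 4"
      unfolding W_def by blast
    then show "z \<in> (\<Union>e\<in>EW. useg e)"
    proof cases
      case 1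
      then show ?thesis by (rule flat)
    next
      case 2
      show ?thesis
      proof (cases "lo x < hi x")
        case True
        then obtain y where "lo x \<le> y" "y < hi x" "real y \<le> Im z" "Im z \<le> real y + 1" using nat_unit_interval 2 by blast
        then show ?thesis using vin[of x y z] 2 by (auto simp: vert_def)
      next
        case False
        then have "Im z = 0" using lo_hi[of x] 2 by auto
        then show ?thesis using 2 flat[of z] by auto
      qed
    next
      case 3
      obtain x where x: "12 * k + 1 \<le> x" "x < 12 * k + 4" "real x \<le> Re z" "Re z \<le> real x + 1"
        using nat_unit_interval[of "12 * k + 1" "Re z" "12 * k + 4"] 3 by auto
      define c where "c = x - 12 * k"
      have c: "x = 12 * k + c" "1 \<le> c" "c \<le> 3" using x by (auto simp: c_def)
      then have "x mod 12 = c" by simp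
      then have "x mod 12 \<in> {1, 2, 3}" using c by auto
      then have "horiz x 4" using x 3 by (auto simp: horiz_def X_def)
      then show ?thesis using hin[of x 4 z] x 3 by auto
    qed
  qed
  show "(\<Union>e\<in>EW. useg e) \<subseteq> W"
  proof
    fix z assume "z \<in> (\<Union>e\<in>EW. useg e)"
    then obtain e where e: "e \<in> EW" "z \<in> useg e" by blast
    from e(1) show "z \<in> W"
    proof (cases rule: EW_cases)
      case (vert x y)
      then have "lo x \<le> y" "y + 1 \<le> hi x" by (auto simp: vert_def)
      then have "real (lo x) \<le> real y" "real y + 1 \<le> real (hi x)" by (simp, metis of_nat_1 of_nat_add of_nat_le_iff)
      moreover have "Re z = real x" "real y \<le> Im z" "Im z \<le> real y + 1" using vert(7) e(2) by auto
      ultimately show ?thesis using vert(4) unfolding W_def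
        by (intro UnI1 UnI2 CollectI exI[of _ x]) auto
    next
      case (horiz x y)
      have xX: "real x + 1 \<le> real X" using horiz(4) by linarith
      have z: "Im z = real y" "real x \<le> Re z" "Re z \<le> real x + 1" using horiz(7) e(2) by auto
      show ?thesis
      proof (cases "y = 4")
        case True
        obtain j c where jc: "x = 12 * j + c" "c < 12" by (rule nat_div_mod_cases)
        then have c: "1 \<le> c" "c \<le> 3" using horiz(2) True by (auto simp: horiz_def)
        have "j \<le> m" using jc horiz(4) by (auto simp: X_def)
        moreover have "12 * real j + 1 \<le> real x" "real x + 1 \<le> 12 * real j + 4" using jc c by auto
        ultimately show ?thesis using z True unfolding W_def
          by (intro UnI2 CollectI exI[of _ j]) auto
      next
        case False
        then have "y = 0 \<or> y = 5" using horiz(2) by (auto simp: horiz_def)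
        then show ?thesis using z xX unfolding W_def by (intro UnI1 CollectI) auto
      qed
    qed
  qed
qed

lemma closed_W: "closed W"
  unfolding W_eq using finite_EW by (intro closed_UN) (auto simp: useg_def)

lemma W_vertical:
  assumes "j \<le> m" "0 < c" "c < 12" "Re z = 12 * real j + real c"
    "real (lo (12 * j + c)) \<le> Im z" "Im z \<le> real (hi (12 * j + c))"
  shows "z \<in> W"
proof -
  have "12 * j + c \<le> X" using assms by (auto simp: X_def)
  then show ?thesis using assms unfolding W_def by (intro UnI1 UnI2 CollectI exI[of _ "12 * j + c"]) auto
qed

lemma W_not_vertical:
  assumes "z \<in> W" "0 < c" "c < 12" "Re z = 12 * real j + real c" "Im z \<noteq> 0" "Im z \<noteq> 4" "Im z \<noteq> 5"
  shows "real (lo (12 * j + c)) \<le> Im z \<and> Im z \<le> real (hi (12 * j + c))"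
proof -
  obtain x where x: "Re z = real x" "real (lo x) \<le> Im z" "Im z \<le> real (hi x)" using assms unfolding W_def by blast
  have "real x = real (12 * j + c)" using x assms by simp
  then have "x = 12 * j + c" using of_nat_eq_iff by blast
  then show ?thesis using x by blast
qed

text \<open>The only column at distance less than 1 is that of the root, which has residue 4 and
  therefore starts at height 1.\<close>

lemma strip_free:
  assumes "k < m" "\<bar>Re z - (12 * real k + 16)\<bar> < 1" "0 < Im z" "Im z < 1"
  shows "z \<notin> W"
proof
  assume z: "z \<in> W"
  then obtain x where x: "Re z = real x" "real (lo x) \<le> Im z" "Im z \<le> real (hi x)" using assms unfolding W_def by auto
  have "\<bar>real x - real (12 * k + 16)\<bar> < 1" using x assms by simp
  then have "x = 12 * k + 16" by linarith
  then have "x = 12 * (k + 1) + 4" by simp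
  then have "lo x = 1" using lo_hi_offset(1)[of 4 "k + 1"] by simp
  then show False using x assms by simp
qed

lemma tip_free:
  assumes "Re z = 12 * real k + 2" "0 < Im z" "Im z < 4"
  shows "z \<notin> W"
  using W_not_vertical[of z 2 k] assms lo_hi_offset[of 2 k] by auto

section \<open>The open free region and its connectedness\<close>

definition box :: "complex set" where "box = {z. 0 < Re z \<and> Re z < real X \<and> 0 < Im z \<and> Im z < 5}"

definition \<Omega> :: "complex set" where "\<Omega> = box - W"

lemma open_box: "open box"
  unfolding box_def by (intro open_Collect_conj open_Collect_less continuous_intros)

lemma convex_box: "convex box"
proof -
  have "box = {z. 0 < Re z} \<inter> {z. Re z < real X} \<inter> {z. 0 < Im z} \<inter> {z. Im z < 5}" by (auto simp: box_def)
  then show ?thesis by (auto intro!: convex_Int convex_halfspace_Re_gt convex_halfspace_Re_lt convex_halfspace_Im_gt convex_halfspace_Im_lt)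
qed

lemma open_\<Omega>: "open \<Omega>" unfolding \<Omega>_def using open_box closed_W by (rule open_Diff)

lemma bounded_\<Omega>: "bounded \<Omega>"
proof -
  have "norm z \<le> real X + 5" if "z \<in> \<Omega>" for z
    using cmod_le[of z] that by (auto simp: \<Omega>_def box_def)
  then show ?thesis unfolding bounded_iff by blast
qed

lemma frontier_box_subset: "frontier box \<subseteq> W"
proof -
  have "closure box \<subseteq> {z. 0 \<le> Re z \<and> Re z \<le> real X \<and> 0 \<le> Im z \<and> Im z \<le> 5}"
    by (rule closure_minimal) (auto simp: box_def intro!: closed_Collect_conj closed_Collect_le continuous_intros)
  moreover have "frontier box = closure box - box" using open_box by (simp add: frontier_def interior_open)
  moreover have "hi 0 = 5" "hi X = 5" "lo 0 = 0" "lo X = 0" by (auto simp: hi_def lo_def X_def)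
  moreover have "z \<in> W" if "0 \<le> Re z" "Re z \<le> real X" "0 \<le> Im z" "Im z \<le> 5" "z \<notin> box" for z
  proof -
    consider "Im z = 0 \<or> Im z = 5" | "Re z = real 0" | "Re z = real X" using \<open>0 \<le> Re z\<close> \<open>Re z \<le> real X\<close> \<open>0 \<le> Im z\<close> \<open>Im z \<le> 5\<close> \<open>z \<notin> box\<close> by (force simp: box_def)
    then show ?thesis
    proof cases
      case 1 then show ?thesis using that unfolding W_def by blast
    next
      case 2 then show ?thesis using that \<open>hi 0 = 5\<close> \<open>lo 0 = 0\<close> unfolding W_def
        by (intro UnI1 UnI2 CollectI exI[of _ 0]) auto
    next
      case 3 then show ?thesis using that \<open>hi X = 5\<close> \<open>lo X = 0\<close> unfolding W_def
        by (intro UnI1 UnI2 CollectI exI[of _ X]) auto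
    qed
  qed
  ultimately show ?thesis by blast
qed

text \<open>The pieces are attached to the outside of the frame in such an order that each of them
  touches what is already there in exactly one point: first the walls based on floor or ceiling,
  then the roofs, the walls hanging from the roofs, and the spikes. So no cycle arises and
  \<open>connected_compl_family\<close> applies at every stage.\<close>

lemma connected_\<Omega>_minus_spikes:
  assumes "I \<subseteq> {..<m}"
  shows "connected (\<Omega> - (\<Union>k\<in>I. closed_segment (rp k) (rp k + (1/2) *\<^sub>R \<i>)))"
proof -
  \<comment> \<open>Residue 4 is postponed: such a wall reaches neither floor nor ceiling and can be
    attached only to a roof.\<close>
  define J1 where "J1 = {x. 0 < x \<and> x < X \<and> x mod 12 \<noteq> 4}"
  define A1 where "A1 = (\<lambda>x. closed_segment (Complex (real x) (real (lo x))) (Complex (real x) (real (hi x))))"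
  define A2 where "A2 = (\<lambda>k. closed_segment (Complex (12 * real k + 1) 4) (Complex (12 * real k + 4) 4))"
  define A3 where "A3 = (\<lambda>k. closed_segment (Complex (12 * real k + 4) 1) (Complex (12 * real k + 4) 4))"
  define A4 where "A4 = (\<lambda>k. closed_segment (rp k) (rp k + (1/2) *\<^sub>R \<i>))"
  have lohi: "real (lo x) \<le> real (hi x)" for x using lo_hi[of x] by auto
  have A1: "z \<in> A1 x \<longleftrightarrow> Re z = real x \<and> real (lo x) \<le> Im z \<and> Im z \<le> real (hi x)" for z x
    unfolding A1_def using mem_vertical_segment[OF lohi] .
  have A2: "z \<in> A2 k \<longleftrightarrow> Im z = 4 \<and> 12 * real k + 1 \<le> Re z \<and> Re z \<le> 12 * real k + 4" for z k
    unfolding A2_def by (rule mem_horizontal_segment) simp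
  have A3: "z \<in> A3 k \<longleftrightarrow> Re z = 12 * real k + 4 \<and> 1 \<le> Im z \<and> Im z \<le> 4" for z k
    unfolding A3_def by (rule mem_vertical_segment) simp
  have "rp k = Complex (12 * real k + 16) 0" "rp k + (1/2) *\<^sub>R \<i> = Complex (12 * real k + 16) (1/2)" for k
    by (auto simp: rp_def complex_eq_iff)
  then have A4: "z \<in> A4 k \<longleftrightarrow> Re z = 12 * real k + 16 \<and> 0 \<le> Im z \<and> Im z \<le> 1/2" for z k
    unfolding A4_def using mem_vertical_segment[of 0 "1/2"] by simp
  define T0 where "T0 = - box"
  define T1 where "T1 = T0 \<union> (\<Union>x\<in>J1. A1 x)"
  define T2 where "T2 = T1 \<union> (\<Union>k\<in>{..m}. A2 k)"
  define T3 where "T3 = T2 \<union> (\<Union>k\<in>{..m}. A3 k)"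
  define T4 where "T4 = T3 \<union> (\<Union>k\<in>I. A4 k)"
  have T0: "closed T0" "connected (- T0)" using open_box convex_box convex_connected by (auto simp: T0_def)
  have J1E: "\<exists>j c. x = 12 * j + c \<and> c < 12 \<and> c \<noteq> 4 \<and> j \<le> m \<and> (c = 0 \<longrightarrow> lo x = 0 \<and> hi x = 0)" if x: "x \<in> J1" for x
  proof -
    obtain j c where jc: "x = 12 * j + c" "c < 12" by (rule nat_div_mod_cases)
    have "c = 0 \<longrightarrow> lo x = 0 \<and> hi x = 0" using x jc by (auto simp: J1_def lo_def hi_def)
    moreover have "c \<noteq> 4" "j \<le> m" using jc x by (auto simp: J1_def X_def)
    ultimately show ?thesis using jc by blast
  qed
  have A1T0: "A1 x \<inter> T0 = {Complex (real x) (if lo x = 0 then 0 else 5)}" if x: "x \<in> J1" for x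
  proof -
    obtain j c where jc: "x = 12 * j + c" "c < 12" "c \<noteq> 4" "c = 0 \<longrightarrow> lo x = 0 \<and> hi x = 0" using J1E[OF x] by blast
    have lh: "lo x = 0 \<and> hi x < 5 \<or> lo x = 1 \<and> hi x = 5"
    proof (cases "c = 0")
      case False
      then show ?thesis using lo_hi_offset[of c j] jc by auto
    qed (use jc in auto)
    have xr: "0 < real x" "real x < real X" using x by (auto simp: J1_def)
    show ?thesis using lh
    proof
      assume "lo x = 0 \<and> hi x < 5"
      then show ?thesis using xr by (auto simp: A1 T0_def box_def complex_eq_iff)
    next
      assume "lo x = 1 \<and> hi x = 5"
      then show ?thesis using xr by (auto simp: A1 T0_def box_def complex_eq_iff)
    qed
  qed
  have T1: "connected (- T1) \<and> closed T1" unfolding T1_def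
  proof (rule connected_compl_family)
    show "finite J1" by (rule finite_subset[of _ "{..X}"]) (auto simp: J1_def)
    show "compact (A1 x) \<and> convex (A1 x) \<and> connected (A1 x \<inter> T0)" if "x \<in> J1" for x
      unfolding A1T0[OF that] by (auto simp: A1_def)
    show "A1 x \<inter> A1 y = {}" if "x \<noteq> y" for x y using that A1 by auto
  qed (use T0 in auto)
  have A2T1: "A2 k \<inter> T1 = {Complex (12 * real k + 1) 4}" if k: "k \<le> m" for k
  proof -
    have "z = Complex (12 * real k + 1) 4" if z: "z \<in> A2 k" "z \<in> T1" for z
    proof -
      have z2: "Im z = 4" "12 * real k + 1 \<le> Re z" "Re z \<le> 12 * real k + 4" using z A2 by auto
      have "real k \<le> real m" using k by simp
      then have "z \<in> box" using z2 by (auto simp: box_def X_def)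
      then obtain x where x: "x \<in> J1" "Re z = real x" "real (lo x) \<le> 4" "4 \<le> real (hi x)" using z z2 A1 by (auto simp: T1_def T0_def)
      have "real (12 * k + 1) \<le> real x" "real x \<le> real (12 * k + 4)" using x z2 by auto
      then have "12 * k + 1 \<le> x" "x \<le> 12 * k + 4" using of_nat_le_iff by blast+
      moreover have "x \<noteq> 12 * k + 4" using x by (auto simp: J1_def)
      moreover have "x \<noteq> 12 * k + 2" "x \<noteq> 12 * k + 3" using x lo_hi_offset(2)[of 2 k] lo_hi_offset(2)[of 3 k] by auto
      ultimately have "x = 12 * k + 1" by linarith
      then show ?thesis using x z2 by (auto simp: complex_eq_iff)
    qed
    moreover have "12 * k + 1 \<in> J1" using k by (auto simp: J1_def X_def)
    moreover have "Complex (12 * real k + 1) 4 \<in> A1 (12 * k + 1)" using lo_hi_offset[of 1 k] by (auto simp: A1)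
    moreover have "Complex (12 * real k + 1) 4 \<in> A2 k" by (simp add: A2)
    ultimately show ?thesis unfolding T1_def by blast
  qed
  have T2: "connected (- T2) \<and> closed T2" unfolding T2_def
  proof (rule connected_compl_family)
    show "compact (A2 x) \<and> convex (A2 x) \<and> connected (A2 x \<inter> T1)" if "x \<in> {..m}" for x
      using that A2T1[of x] by (auto simp: A2_def)
    show "A2 x \<inter> A2 y = {}" if "x \<noteq> y" for x y
    proof -
      have "real x + 1 \<le> real y \<or> real y + 1 \<le> real x" using that by linarith
      then show ?thesis using A2 by auto
    qed
  qed (use T1 in auto)
  have A3T2: "A3 k \<inter> T2 = {Complex (12 * real k + 4) 4}" if k: "k \<le> m" for k
  proof -
    have "z = Complex (12 * real k + 4) 4" if z: "z \<in> A3 k" "z \<in> T2" for z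
    proof -
      have z2: "Re z = 12 * real k + 4" "1 \<le> Im z" "Im z \<le> 4" using z A3 by auto
      have "real k \<le> real m" using k by simp
      then have zb: "z \<in> box" using z2 by (auto simp: box_def X_def)
      have "z \<notin> A1 x" if "x \<in> J1" for x
      proof
        assume "z \<in> A1 x"
        then have "real x = real (12 * k + 4)" using z2 A1 by simp
        then have "x = 12 * k + 4" using of_nat_eq_iff by blast
        then show False using that by (auto simp: J1_def)
      qed
      then obtain j where "z \<in> A2 j" using z zb by (auto simp: T2_def T1_def T0_def)
      then show ?thesis using z2 A2 by (auto simp: complex_eq_iff)
    qed
    moreover have "Complex (12 * real k + 4) 4 \<in> A2 k" by (simp add: A2)
    moreover have "Complex (12 * real k + 4) 4 \<in> A3 k" by (simp add: A3)
    ultimately show ?thesis using k unfolding T2_def by blast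
  qed
  have T3: "connected (- T3) \<and> closed T3" unfolding T3_def
  proof (rule connected_compl_family)
    show "compact (A3 x) \<and> convex (A3 x) \<and> connected (A3 x \<inter> T2)" if "x \<in> {..m}" for x
      using that A3T2[of x] by (auto simp: A3_def)
    show "A3 x \<inter> A3 y = {}" if "x \<noteq> y" for x y using that A3 by auto
  qed (use T2 in auto)
  have A4T3: "A4 k \<inter> T3 = {rp k}" if k: "k < m" for k
  proof -
    have "z = rp k" if z: "z \<in> A4 k" "z \<in> T3" for z
    proof (rule ccontr)
      assume "z \<noteq> rp k"
      have z2: "Re z = 12 * real k + 16" "0 \<le> Im z" "Im z \<le> 1/2" using z A4 by auto
      then have "Im z \<noteq> 0" using \<open>z \<noteq> rp k\<close> by (auto simp: rp_def complex_eq_iff)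
      have "real k + 1 \<le> real m" using k by linarith
      then have zb: "z \<in> box" using z2 \<open>Im z \<noteq> 0\<close> by (auto simp: box_def X_def)
      have "z \<notin> A1 x" if "x \<in> J1" for x
      proof
        assume "z \<in> A1 x"
        then have "real x = real (12 * (k + 1) + 4)" using z2 A1 by simp
        then have "x = 12 * (k + 1) + 4" using of_nat_eq_iff by blast
        then have "x mod 12 = 4" by simp
        then show False using that by (auto simp: J1_def)
      qed
      then show False using z zb z2 A2 A3 by (auto simp: T3_def T2_def T1_def T0_def)
    qed
    moreover have "rp k \<in> A4 k" by (simp add: A4 rp_def)
    moreover have "rp k \<in> T0" by (simp add: T0_def box_def rp_def)
    ultimately show ?thesis unfolding T3_def T2_def T1_def by blast
  qed
  have T4: "connected (- T4) \<and> closed T4" unfolding T4_def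
  proof (rule connected_compl_family)
    show "finite I" using assms finite_subset by blast
    show "compact (A4 x) \<and> convex (A4 x) \<and> connected (A4 x \<inter> T3)" if "x \<in> I" for x
      using that A4T3[of x] assms by (auto simp: A4_def)
    show "A4 x \<inter> A4 y = {}" if "x \<noteq> y" for x y using that A4 by auto
  qed (use T3 in auto)
  have "z \<in> W \<longleftrightarrow> z \<in> (\<Union>x\<in>J1. A1 x) \<union> (\<Union>k\<in>{..m}. A2 k) \<union> (\<Union>k\<in>{..m}. A3 k)" if z: "z \<in> box" for z
  proof
    assume "z \<in> W"
    then consider x where "x \<le> X" "Re z = real x" "real (lo x) \<le> Im z" "Im z \<le> real (hi x)"
      | k where "k \<le> m" "12 * real k + 1 \<le> Re z" "Re z \<le> 12 * real k + 4" "Im z = 4"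
      using z unfolding W_def box_def by force
    then show "z \<in> (\<Union>x\<in>J1. A1 x) \<union> (\<Union>k\<in>{..m}. A2 k) \<union> (\<Union>k\<in>{..m}. A3 k)"
    proof cases
      case 1
      have x: "0 < x" "x < X" using z 1 by (auto simp: box_def)
      show ?thesis
      proof (cases "x mod 12 = 4")
        case True
        obtain j c where jc: "x = 12 * j + c" "c < 12" by (rule nat_div_mod_cases)
        then have "c = 4" using True by simp
        then have "z \<in> A3 j" "j \<le> m" using 1 jc lo_hi_offset[of 4 j] x by (auto simp: A3 X_def)
        then show ?thesis by blast
      next
        case False
        then have "x \<in> J1" using x by (simp add: J1_def)
        then show ?thesis using 1 A1 by blast
      qed
    next
      case 2
      then show ?thesis using A2 by blast
    qed
  next
    assume "z \<in> (\<Union>x\<in>J1. A1 x) \<union> (\<Union>k\<in>{..m}. A2 k) \<union> (\<Union>k\<in>{..m}. A3 k)"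
    then consider x where "x \<in> J1" "z \<in> A1 x" | k where "k \<le> m" "z \<in> A2 k" | k where "k \<le> m" "z \<in> A3 k" by auto
    then show "z \<in> W"
    proof cases
      case 1
      then show ?thesis using A1 unfolding W_def J1_def by (intro UnI1 UnI2 CollectI exI[of _ x]) auto
    next
      case 2
      then show ?thesis using A2 unfolding W_def by blast
    next
      case 3
      then show ?thesis using A3 lo_hi_offset[of 4 k] by (intro W_vertical[of k 4]) auto
    qed
  qed
  then have "\<Omega> - (\<Union>k\<in>I. A4 k) = - T4" unfolding \<Omega>_def T4_def T3_def T2_def T1_def T0_def by blast
  then show ?thesis using T4 unfolding A4_def by simp
qed


subsection \<open>Admissible drawings\<close>

lemma es_disjoint: "j \<noteq> k \<Longrightarrow> es j \<inter> es k = {}"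
proof -
  assume "j \<noteq> k"
  then have "tv j \<noteq> tv k" "rv j \<noteq> rv k" by (auto simp: tv_def rv_def)
  then show ?thesis using tv_ne_rv[of j k] tv_ne_rv[of k j] unfolding es_def by (auto simp del: tv_ne_rv)
qed

lemma useg_subset_W: "e \<in> EW \<Longrightarrow> useg e \<subseteq> W" unfolding W_eq by blast

lemma W_Im_nonneg: "z \<in> W \<Longrightarrow> Im z \<ge> 0"
  unfolding W_def by (auto intro: order_trans[OF of_nat_0_le_iff])

lemma tp_in_\<Omega>: "k < m \<Longrightarrow> tp k \<in> \<Omega>"
proof -
  assume k: "k < m"
  then have "real k + 1 \<le> real m" by linarith
  then show ?thesis using tip_free[of "tp k" k] by (auto simp: \<Omega>_def box_def tp_def X_def)
qed

lemma \<Omega>_W: "z \<in> \<Omega> \<Longrightarrow> z \<notin> W" by (simp add: \<Omega>_def)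

lemma rp_in_W: "k < m \<Longrightarrow> rp k \<in> W"
proof -
  assume k: "k < m"
  then have "real k + 1 \<le> real m" by linarith
  then show ?thesis by (auto simp: W_def rp_def X_def)
qed

lemma tv_notin_EW: "k < m \<Longrightarrow> e \<in> EW \<Longrightarrow> tv k \<notin> e"
  using pos_in_useg[of e "tv k"] useg_subset_W[of e] tp_in_\<Omega>[of k] \<Omega>_W[of "tp k"] pos_tv[of k] by auto

lemma es_notin_EW: "k < m \<Longrightarrow> es k \<notin> EW"
  using tv_notin_EW[of k "es k"] by (auto simp: es_def)

lemma p_notin_\<Omega>: "(\<And>k. k < m \<Longrightarrow> v \<noteq> tv k) \<Longrightarrow> p v \<notin> \<Omega>"
proof (cases "used v")
  case True
  assume "\<And>k. k < m \<Longrightarrow> v \<noteq> tv k"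
  then obtain e where "e \<in> EW" "v \<in> e" using True by (auto simp: used_def)
  then have "pos v \<in> W" using pos_in_useg useg_subset_W by blast
  then show ?thesis using True \<Omega>_W by (auto simp: p_used)
next
  case False
  then show ?thesis by (auto simp: p_def \<Omega>_def box_def)
qed

lemma rp_eq_p: "k < m \<Longrightarrow> p w = rp k \<longleftrightarrow> w = rv k"
  using p_rv[of k] inj_p by (metis injD)

text \<open>The tip positions \<open>q\<close> are left open so that the drawings on
  \<open>p\<close> and on \<open>p0\<close> are both covered. Spikes lie in \<open>\<Omega>\<close>
  except for their roots and walls avoid \<open>\<Omega>\<close>, so roots are the only possible
  contacts between the two.\<close>

lemma planar_drawingI:
  assumes P: "\<And>v. (\<And>k. k < m \<Longrightarrow> v \<noteq> tv k) \<Longrightarrow> P v = p v" "\<And>k. k < m \<Longrightarrow> P (tv k) = q k"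
    and q: "\<And>k. k < m \<Longrightarrow> q k \<in> \<Omega>" "inj_on q {..<m}"
    and I: "I \<subseteq> {..<m}" and E': "E' \<subseteq> EW" "\<And>e. e \<in> E' \<Longrightarrow> bd e = []"
    and arcs: "\<And>k. k \<in> I \<Longrightarrow> arc (edge_curve P bd (es k))"
    and sub: "\<And>k. k \<in> I \<Longrightarrow> path_image (edge_curve P bd (es k)) \<subseteq> insert (rp k) \<Omega>"
    and tips: "\<And>j k. j < m \<Longrightarrow> k \<in> I \<Longrightarrow> j \<noteq> k \<Longrightarrow> q j \<notin> path_image (edge_curve P bd (es k))"
    and disj: "\<And>j k. j \<in> I \<Longrightarrow> k \<in> I \<Longrightarrow> j \<noteq> k \<Longrightarrow> path_image (edge_curve P bd (es j)) \<inter> path_image (edge_curve P bd (es k)) = {}"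
  shows "planar_drawing {..<n} (E' \<union> es ` I) P bd"
proof -
  let ?c = "\<lambda>e. path_image (edge_curve P bd e)"
  have Pwall: "P v = pos v" if "e \<in> EW" "v \<in> e" for e v
    using P(1)[of v] tv_notin_EW that used_mem p_used by metis
  have Prv: "P (rv k) = rp k" if "k < m" for k
    using P(1)[of "rv k"] p_rv[OF that] tv_ne_rv by metis
  have injP: "inj P"
  proof (rule injI)
    fix v w assume eq: "P v = P w"
    consider j k where "j < m" "k < m" "v = tv j" "w = tv k" | j where "j < m" "v = tv j" "\<And>k. k < m \<Longrightarrow> w \<noteq> tv k"
      | k where "k < m" "w = tv k" "\<And>k. k < m \<Longrightarrow> v \<noteq> tv k" | "\<And>k. k < m \<Longrightarrow> v \<noteq> tv k" "\<And>k. k < m \<Longrightarrow> w \<noteq> tv k" by blast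
    then show "v = w"
    proof cases
      case 1
      then show ?thesis using eq P(2) q(2) by (auto simp: inj_on_def)
    next
      case 2
      then show ?thesis using eq P q(1)[of j] p_notin_\<Omega>[of w] by metis
    next
      case 3
      then show ?thesis using eq P q(1)[of k] p_notin_\<Omega>[of v] by metis
    next
      case 4
      then show ?thesis using eq P(1) inj_p by (metis injD)
    qed
  qed
  have Min_Max: "Min e \<in> e" "Max e \<in> e" "Min e \<noteq> Max e" if "e \<in> EW" for e
    using that by (cases rule: EW_cases; auto)+
  have wall_image: "?c e = useg e" if "e \<in> E'" for e
    using that E' Pwall Min_Max by (auto simp: edge_curve_def useg_def)
  have wall_arc: "arc (edge_curve P bd e)" if "e \<in> E'" for e
  proof -
    have "P (Min e) \<noteq> P (Max e)" using injP Min_Max that E'(1) by (metis injD subsetD)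
    then show ?thesis using E'(2)[OF that] by (simp add: edge_curve_def)
  qed
  have wall_vertex: "w \<in> e" if "e \<in> EW" "P w \<in> useg e" for e w
  proof (cases "\<exists>k<m. w = tv k")
    case True
    then have "P w \<in> \<Omega>" using P(2) q(1) by auto
    moreover have "P w \<in> W" using that useg_subset_W by blast
    ultimately show ?thesis using \<Omega>_W by blast
  next
    case False
    then have w: "P w = p w" using P(1) by blast
    have "Im (p w) \<ge> 0" using W_Im_nonneg useg_subset_W that w by force
    then have "used w" by (auto simp: p_def split: if_splits)
    then show ?thesis using useg_pos that w p_used by metis
  qed
  have spike_ends: "P (tv k) \<in> ?c (es k)" "P (rv k) \<in> ?c (es k)" for k
    by (auto simp: edge_curve_def simp del: pimg_Cons)
  have spike_vertex: "w \<in> es k" if k: "k \<in> I" "P w \<in> ?c (es k)" for k w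
  proof (cases "\<exists>j<m. w = tv j")
    case True
    then obtain j where "j < m" "w = tv j" by blast
    then show ?thesis using tips[of j k] P(2)[of j] k by (cases "j = k") (auto simp: es_def)
  next
    case False
    then have w: "P w = p w" using P(1) by blast
    have "p w \<notin> \<Omega>" using p_notin_\<Omega> False by blast
    then have "p w = rp k" using sub[OF k(1)] k(2) w by auto
    then show ?thesis using rp_eq_p[of k w] I k by (auto simp: es_def)
  qed
  have kI: "k < m" if "k \<in> I" for k using that I by blast
  have wall_spike: "useg e \<inter> ?c (es k) = P ` (e \<inter> es k)" if e: "e \<in> EW" and k: "k \<in> I" for e k
  proof
    show "useg e \<inter> ?c (es k) \<subseteq> P ` (e \<inter> es k)"
    proof
      fix z assume z: "z \<in> useg e \<inter> ?c (es k)"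
      then have "z = rp k" using sub[OF k] useg_subset_W[OF e] \<Omega>_W by blast
      then have zP: "z = P (rv k)" using Prv kI[OF k] by simp
      then have "rv k \<in> e" using wall_vertex[OF e] z by blast
      then show "z \<in> P ` (e \<inter> es k)" using zP by (auto simp: es_def)
    qed
    show "P ` (e \<inter> es k) \<subseteq> useg e \<inter> ?c (es k)"
    proof
      fix z assume "z \<in> P ` (e \<inter> es k)"
      then obtain w where w: "w \<in> e" "w \<in> es k" "z = P w" by blast
      then have "z \<in> ?c (es k)" using spike_ends[of k] unfolding es_def[of k] by (metis empty_iff insertE)
      then show "z \<in> useg e \<inter> ?c (es k)" using w pos_in_useg[OF e] Pwall[OF e] by simp
    qed
  qed
  show ?thesis
    unfolding planar_drawing_def
  proof (intro conjI ballI impI)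
    show "inj_on P {..<n}" using injP by (rule inj_on_subset) simp
  next
    fix e assume "e \<in> E' \<union> es ` I"
    then show "arc (edge_curve P bd e)" using wall_arc arcs by blast
  next
    fix e assume "e \<in> E' \<union> es ` I"
    then show "?c e \<inter> P ` {..<n} = P ` e"
    proof
      assume e: "e \<in> E'"
      then have "P v \<in> useg e" if "v \<in> e" for v using pos_in_useg Pwall that E'(1) by (metis subsetD)
      then show ?thesis using e E'(1) wall_image wall_vertex EW_subset by blast
    next
      assume "e \<in> es ` I"
      then obtain k where k: "k \<in> I" "e = es k" by blast
      have "P v \<in> ?c e" if "v \<in> e" for v using that spike_ends k by (auto simp: es_def)
      then show ?thesis using k spike_vertex es_subset[OF kI[OF k(1)]] by blast
    qed
  next
    fix e e' assume ee: "e \<in> E' \<union> es ` I" "e' \<in> E' \<union> es ` I" "e \<noteq> e'"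
    then consider "e \<in> E'" "e' \<in> E'" | k where "e \<in> E'" "k \<in> I" "e' = es k" | k where "e' \<in> E'" "k \<in> I" "e = es k"
      | j k where "j \<in> I" "k \<in> I" "e = es j" "e' = es k" "j \<noteq> k" by blast
    then show "?c e \<inter> ?c e' = P ` (e \<inter> e')"
    proof cases
      case 1
      have "P ` (e \<inter> e') = pos ` (e \<inter> e')" using Pwall 1 E'(1) by (intro image_cong) auto
      then show ?thesis using useg_Int 1 wall_image ee(3) E'(1) by (metis subsetD)
    next
      case 2
      then show ?thesis using wall_spike[of e k] wall_image E'(1) by auto
    next
      case 3
      then show ?thesis using wall_spike[of e' k] wall_image E'(1) by (auto simp: Int_commute)
    next
      case 4
      then have "es j \<inter> es k = {}" using es_disjoint by blast
      then show ?thesis using disj[of j k] 4 by simp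
    qed
  qed
qed

text \<open>Since \<open>tv k < rv k\<close>, bend lists are stored from tip to root. The reversal
  makes every spike start at its root.\<close>

definition curve :: "(nat set \<Rightarrow> complex list) \<Rightarrow> nat \<Rightarrow> complex set" where
  "curve bd k = pimg (rp k # rev (bd (es k)) @ [tp k])"

lemma edge_curve_es:
  assumes "k < m"
  shows "path_image (edge_curve p bd (es k)) = curve bd k"
    and "arc (edge_curve p bd (es k)) \<longleftrightarrow> arc (polyline (rp k # rev (bd (es k)) @ [tp k]))"
  unfolding edge_curve_def curve_def es_Min_Max p_tv[OF assms] p_rv[OF assms] polyline_swap_ends by simp_all

text \<open>All other tips are avoided, including those of later edges, because every vertex is
  present from the start.\<close>

definition spike_ok :: "nat \<Rightarrow> complex list \<Rightarrow> bool" where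
  "spike_ok k bs \<longleftrightarrow> arc (polyline (rp k # bs @ [tp k])) \<and> pimg (rp k # bs @ [tp k]) \<inter> W \<subseteq> {rp k} \<and>
     (\<forall>j<m. j \<noteq> k \<longrightarrow> tp j \<notin> pimg (rp k # bs @ [tp k]))"

definition drawing_ok :: "nat set \<Rightarrow> (nat set \<Rightarrow> complex list) \<Rightarrow> bool" where
  "drawing_ok I bd \<longleftrightarrow> (\<forall>k\<in>I. spike_ok k (rev (bd (es k)))) \<and> (\<forall>j\<in>I. \<forall>k\<in>I. j \<noteq> k \<longrightarrow> curve bd j \<inter> curve bd k = {})"

text \<open>Without its root the arc is still connected and misses the walls, which contain the
  frontier of the box. One of its points, the tip, lies in the box, so all of it does.\<close>

lemma spike_subset_\<Omega>:
  assumes "k < m" "spike_ok k bs"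
  shows "pimg (rp k # bs @ [tp k]) - {rp k} \<subseteq> \<Omega>"
proof -
  let ?S = "pimg (rp k # bs @ [tp k]) - {rp k}"
  have "connected ?S" using connected_arc_minus_start[of "polyline (rp k # bs @ [tp k])"] assms
    by (simp add: spike_ok_def del: pimg_Cons)
  moreover have "tp k \<in> ?S \<inter> box"
    using tp_in_\<Omega>[OF assms(1)] by (auto simp: \<Omega>_def rp_def tp_def simp del: pimg_Cons)
  moreover have "?S \<inter> W = {}" using assms by (auto simp: spike_ok_def simp del: pimg_Cons)
  ultimately have "?S \<subseteq> box" using connected_Int_frontier[of ?S box] frontier_box_subset by blast
  then show ?thesis using \<open>?S \<inter> W = {}\<close> by (auto simp: \<Omega>_def)
qed

lemma inj_on_tp: "inj_on tp N"
  by (auto simp: inj_on_def tp_def)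

lemma planar_of_drawing_ok:
  assumes "I \<subseteq> {..<m}" "E' \<subseteq> EW" "\<And>e. e \<in> E' \<Longrightarrow> bd e = []" "drawing_ok I bd"
  shows "planar_drawing {..<n} (E' \<union> es ` I) p bd"
proof -
  have kI: "k < m" if "k \<in> I" for k using that assms by blast
  show ?thesis
  proof (rule planar_drawingI[where q = tp])
    show "arc (edge_curve p bd (es k))" if "k \<in> I" for k
      using assms(4) that edge_curve_es[OF kI[OF that]] by (auto simp: drawing_ok_def spike_ok_def)
    show "path_image (edge_curve p bd (es k)) \<subseteq> insert (rp k) \<Omega>" if "k \<in> I" for k
      using spike_subset_\<Omega>[OF kI[OF that]] assms(4) that unfolding edge_curve_es[OF kI[OF that]] curve_def
      by (auto simp: drawing_ok_def simp del: pimg_Cons)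
    show "tp j \<notin> path_image (edge_curve p bd (es k))" if "j < m" "k \<in> I" "j \<noteq> k" for j k
      using assms(4) that unfolding edge_curve_es[OF kI[OF that(2)]] curve_def
      by (auto simp: drawing_ok_def spike_ok_def simp del: pimg_Cons)
    show "path_image (edge_curve p bd (es j)) \<inter> path_image (edge_curve p bd (es k)) = {}" if "j \<in> I" "k \<in> I" "j \<noteq> k" for j k
      using assms(4) that edge_curve_es kI by (simp add: drawing_ok_def)
  qed (use assms p_tv tp_in_\<Omega> inj_on_tp in auto)
qed

lemma drawing_ok_of_planar:
  assumes I: "I \<subseteq> {..<m}" and bd: "\<And>e. e \<in> EW \<Longrightarrow> bd e = []" and pl: "planar_drawing {..<n} (EW \<union> es ` I) p bd"
  shows "drawing_ok I bd"
proof -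
  have kI: "k < m" if "k \<in> I" for k using that I by blast
  have 1: "arc (edge_curve p bd e) \<and> path_image (edge_curve p bd e) \<inter> p ` {..<n} = p ` e" if "e \<in> EW \<union> es ` I" for e
    using pl[unfolded planar_drawing_def, THEN conjunct2, THEN conjunct1] that by blast
  have 2: "path_image (edge_curve p bd e) \<inter> path_image (edge_curve p bd e') = p ` (e \<inter> e')" if "e \<in> EW \<union> es ` I" "e' \<in> EW \<union> es ` I" "e \<noteq> e'" for e e'
    using pl[unfolded planar_drawing_def, THEN conjunct2, THEN conjunct2, rule_format, OF that] .
  have wall_image: "path_image (edge_curve p bd e) = useg e" if e: "e \<in> EW" for e
  proof -
    have "Min e \<in> e" "Max e \<in> e" using e by (cases rule: EW_cases; auto)+
    then show ?thesis using used_mem[OF e] bd[OF e] by (auto simp: edge_curve_def useg_def p_used)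
  qed
  have pes: "p ` es k = {tp k, rp k}" if "k < m" for k using that by (simp add: es_def p_tv p_rv)
  have "spike_ok k (rev (bd (es k)))" if k: "k \<in> I" for k
  proof -
    note km = kI[OF k]
    have "curve bd k \<inter> W \<subseteq> {rp k}"
    proof
      fix z assume z: "z \<in> curve bd k \<inter> W"
      then obtain e where e: "e \<in> EW" "z \<in> useg e" unfolding W_eq by blast
      have "e \<noteq> es k" using es_notin_EW[OF km] e by blast
      then have "z \<in> p ` (e \<inter> es k)" using 2[of e "es k"] e k z wall_image edge_curve_es(1)[OF km] by blast
      then show "z \<in> {rp k}" using tv_notin_EW[OF km e(1)] p_rv[OF km] by (auto simp: es_def)
    qed
    moreover have "tp j \<notin> curve bd k" if "j < m" "j \<noteq> k" for j
    proof
      assume "tp j \<in> curve bd k"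
      moreover have "tp j \<in> p ` {..<n}" using p_tv[OF that(1)] tv_lt[OF that(1)] by (metis imageI lessThan_iff)
      moreover have "curve bd k \<inter> p ` {..<n} = p ` es k" using 1[of "es k"] k edge_curve_es(1)[OF km] by auto
      ultimately have "tp j \<in> p ` es k" by blast
      then show False using pes[OF km] that by (auto simp: tp_def rp_def)
    qed
    moreover have "arc (polyline (rp k # rev (bd (es k)) @ [tp k]))" using 1[of "es k"] k edge_curve_es(2)[OF km] by blast
    ultimately show ?thesis unfolding spike_ok_def curve_def by blast
  qed
  moreover have "curve bd j \<inter> curve bd k = {}" if "j \<in> I" "k \<in> I" "j \<noteq> k" for j k
  proof -
    have "es j \<inter> es k = {}" using that es_disjoint by blast
    then show ?thesis using 2[of "es j" "es k"] that edge_curve_es(1) kI by simp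
  qed
  ultimately show ?thesis unfolding drawing_ok_def by blast
qed

lemma strip_subset_\<Omega>:
  assumes "k < m"
  shows "{z. \<bar>Re z - Re (rp k)\<bar> < 1 \<and> 0 < Im z \<and> Im z < 1} \<subseteq> \<Omega>"
proof
  fix z assume z: "z \<in> {z. \<bar>Re z - Re (rp k)\<bar> < 1 \<and> 0 < Im z \<and> Im z < 1}"
  have "real k + 1 \<le> real m" using assms by linarith
  then have "z \<in> box" using z by (auto simp: box_def rp_def X_def)
  moreover have "z \<notin> W" using strip_free[OF assms] z by (auto simp: rp_def)
  ultimately show "z \<in> \<Omega>" by (simp add: \<Omega>_def)
qed

lemma tp_rp_sep: "\<bar>Re (tp j) - Re (rp k)\<bar> \<ge> 1"
proof -
  consider "j \<le> k" | "j = k + 1" | "k + 2 \<le> j" by linarith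
  then have "real j \<le> real k \<or> real j = real k + 1 \<or> real j \<ge> real k + 2" by cases auto
  then show ?thesis by (auto simp: tp_def rp_def)
qed

lemma rp_sep: "j \<noteq> k \<Longrightarrow> \<bar>Re (rp j) - Re (rp k)\<bar> \<ge> 2"
proof -
  assume "j \<noteq> k"
  then have "real j + 1 \<le> real k \<or> real j \<ge> real k + 1" by linarith
  then show ?thesis by (auto simp: rp_def)
qed

text \<open>The straightening map is supported in \<open>\<Omega>\<close> and so fixes the walls and
  the parked vertices; its inverse carries the reference drawing to the given one. After this the
  embedding imposes no condition on competing drawings beyond planarity.\<close>

lemma respects_of_drawing_ok:
  assumes I: "I \<subseteq> {..<m}" and E': "E' \<subseteq> EW" "\<And>e. e \<in> E' \<Longrightarrow> bd e = []" and ok: "drawing_ok I bd"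
  shows "respects_embedding {..<n} p0 (\<lambda>_. []) (E' \<union> es ` I) p bd"
proof -
  have kI: "k < m" if "k \<in> I" for k using that I by blast
  have "\<exists>f. supp_homeo \<Omega> f \<and>
    (\<forall>k\<in>I. f ` pimg (rp k # rev (bd (es k)) @ [tp k]) = closed_segment (rp k) (rp k + (1/2) *\<^sub>R \<i>)) \<and>
    (\<forall>k\<in>{..<m}. f (tp k) = rp k + (1/2) *\<^sub>R \<i>)"
  proof (rule homeo_to_vertical_spikes)
    show "\<And>z. z \<in> \<Omega> \<Longrightarrow> 0 < Im z" by (auto simp: \<Omega>_def box_def)
    show "{z. \<bar>Re z - Re (rp k)\<bar> < 1 \<and> 0 < Im z \<and> Im z < 1} \<subseteq> \<Omega>" if "k \<in> {..<m}" for k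
      using strip_subset_\<Omega> that by simp
    show "arc (polyline (rp k # rev (bd (es k)) @ [tp k]))" if "k \<in> I" for k
      using ok that by (auto simp: drawing_ok_def spike_ok_def)
    show "pimg (rp k # rev (bd (es k)) @ [tp k]) - {rp k} \<subseteq> \<Omega>" if "k \<in> I" for k
      using spike_subset_\<Omega>[OF kI[OF that]] ok that unfolding drawing_ok_def by blast
    show "pimg (rp j # rev (bd (es j)) @ [tp j]) \<inter> pimg (rp k # rev (bd (es k)) @ [tp k]) = {}"
      if "j \<in> I" "k \<in> I" "j \<noteq> k" for j k
      using ok that unfolding drawing_ok_def curve_def by blast
    show "tp j \<notin> pimg (rp k # rev (bd (es k)) @ [tp k])" if "j \<in> {..<m}" "k \<in> I" "j \<noteq> k" for j k
      using ok that unfolding drawing_ok_def spike_ok_def by blast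
  qed (use I open_\<Omega> tp_in_\<Omega> inj_on_tp tp_rp_sep rp_sep connected_\<Omega>_minus_spikes[OF I] in \<open>auto simp: rp_def\<close>)
  then obtain f where f: "supp_homeo \<Omega> f" "\<And>k. k \<in> I \<Longrightarrow> f ` curve bd k = closed_segment (rp k) (rp k + (1/2) *\<^sub>R \<i>)"
    "\<And>k. k < m \<Longrightarrow> f (tp k) = rp k + (1/2) *\<^sub>R \<i>" unfolding curve_def by auto
  obtain h where h: "supp_homeo \<Omega> h" "\<And>x. h (f x) = x" "\<And>x. f (h x) = x"
    by (rule supp_homeo_inverse[OF f(1)]) (rule that)
  have hfix: "h z = z" if "z \<notin> \<Omega>" for z using supp_homeo_fix[OF h(1) that] .
  show ?thesis unfolding respects_embedding_def
  proof (intro exI[of _ h] conjI ballI)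
    show "orient_pres_homeo h" by (rule supp_homeo_imp_orient_pres[OF h(1) bounded_\<Omega>])
    fix v
    show "h (p0 v) = p v"
    proof (cases "\<exists>k<m. v = tv k")
      case True
      then obtain k where k: "k < m" "v = tv k" by blast
      then show ?thesis using h(2)[of "tp k"] f(3)[OF k(1)] p0_tv[OF k(1)] p_tv[OF k(1)] by simp
    next
      case False
      then show ?thesis using p0_other[of v] p_notin_\<Omega>[of v] hfix by metis
    qed
  next
    fix e assume "e \<in> E' \<union> es ` I"
    then show "h ` path_image (edge_curve p0 (\<lambda>_. []) e) = path_image (edge_curve p bd e)"
    proof
      assume e: "e \<in> E'"
      then have eE: "e \<in> EW" using E' by blast
      have mm: "Min e \<in> e" "Max e \<in> e" using eE by (cases rule: EW_cases; auto)+
      have "p0 w = p w" if "w \<in> e" for w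
        by (rule p0_other) (use tv_notin_EW[OF _ eE] that in metis)
      then have "path_image (edge_curve p0 (\<lambda>_. []) e) = useg e" "path_image (edge_curve p bd e) = useg e"
        using mm used_mem[OF eE] E'(2)[OF e] by (auto simp: edge_curve_def useg_def p_used)
      moreover have "h ` useg e = useg e"
        by (rule supp_homeo_fix_image[OF h(1)]) (use useg_subset_W[OF eE] \<Omega>_W in blast)
      ultimately show ?thesis by simp
    next
      assume "e \<in> es ` I"
      then obtain k where k: "k \<in> I" "e = es k" by blast
      have "p0 (rv k) = rp k" using p0_other[of "rv k"] p_rv[OF kI[OF k(1)]] tv_ne_rv by metis
      then have "path_image (edge_curve p0 (\<lambda>_. []) e) = closed_segment (rp k) (rp k + (1/2) *\<^sub>R \<i>)"
        using p0_tv[OF kI[OF k(1)]] k by (auto simp: edge_curve_def closed_segment_commute)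
      then have "h ` path_image (edge_curve p0 (\<lambda>_. []) e) = h ` f ` curve bd k" using f(2)[OF k(1)] by simp
      also have "\<dots> = curve bd k" using h(2) by (simp add: image_image)
      finally show ?thesis using k edge_curve_es(1)[OF kI[OF k(1)]] by simp
    qed
  qed
qed

lemma reference_planar: "planar_drawing {..<n} (EW \<union> es ` {..<m}) p0 (\<lambda>_. [])"
proof (rule planar_drawingI[where q = "\<lambda>k. rp k + (1/2) *\<^sub>R \<i>"])
  have c: "path_image (edge_curve p0 (\<lambda>_. []) (es k)) = {z. Re z = 12 * real k + 16 \<and> 0 \<le> Im z \<and> Im z \<le> 1/2}" if "k < m" for k
  proof -
    have "p0 (rv k) = rp k" using p0_other[of "rv k"] p_rv[OF that] tv_ne_rv by metis
    moreover have "rp k = Complex (12 * real k + 16) 0" "rp k + (1/2) *\<^sub>R \<i> = Complex (12 * real k + 16) (1/2)"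
      by (auto simp: rp_def complex_eq_iff)
    ultimately show ?thesis using p0_tv[OF that] mem_vertical_segment[of 0 "1/2" _ "12 * real k + 16"]
      by (auto simp: edge_curve_def closed_segment_commute)
  qed
  show "arc (edge_curve p0 (\<lambda>_. []) (es k))" if "k \<in> {..<m}" for k
  proof -
    have "p0 (rv k) = rp k" using p0_other[of "rv k"] p_rv[of k] tv_ne_rv that by (metis lessThan_iff)
    then show ?thesis using p0_tv[of k] that by (simp add: edge_curve_def)
  qed
  show "path_image (edge_curve p0 (\<lambda>_. []) (es k)) \<subseteq> insert (rp k) \<Omega>" if "k \<in> {..<m}" for k
  proof
    fix z assume "z \<in> path_image (edge_curve p0 (\<lambda>_. []) (es k))"
    then have z: "Re z = 12 * real k + 16" "0 \<le> Im z" "Im z \<le> 1/2" using c that by auto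
    show "z \<in> insert (rp k) \<Omega>"
    proof (cases "Im z = 0")
      case True
      then show ?thesis using z by (simp add: rp_def complex_eq_iff)
    next
      case False
      then have "\<bar>Re z - Re (rp k)\<bar> < 1 \<and> 0 < Im z \<and> Im z < 1" using z by (simp add: rp_def)
      then show ?thesis using strip_subset_\<Omega>[of k] that by blast
    qed
  qed
  show "rp j + (1/2) *\<^sub>R \<i> \<notin> path_image (edge_curve p0 (\<lambda>_. []) (es k))" if "j < m" "k \<in> {..<m}" "j \<noteq> k" for j k
    using c[of k] that by (auto simp: rp_def)
  show "path_image (edge_curve p0 (\<lambda>_. []) (es j)) \<inter> path_image (edge_curve p0 (\<lambda>_. []) (es k)) = {}"
    if "j \<in> {..<m}" "k \<in> {..<m}" "j \<noteq> k" for j k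
    using c[of k] c[of j] that by auto
  show "rp k + (1/2) *\<^sub>R \<i> \<in> \<Omega>" if "k < m" for k
    using strip_subset_\<Omega>[OF that] by (auto simp: rp_def)
  show "inj_on (\<lambda>k. rp k + (1/2) *\<^sub>R \<i>) {..<m}" by (auto simp: inj_on_def rp_def)
qed (use p0_tv p0_other in auto)

section \<open>The drawing order and the use of minimality\<close>

definition wl :: "nat set list" where "wl = (SOME l. set l = EW \<and> distinct l)"

lemma wl: "set wl = EW" "distinct wl"
  using someI_ex[OF finite_distinct_list[OF finite_EW]] unfolding wl_def by auto

definition \<sigma> :: "nat set list" where "\<sigma> = wl @ map es [0..<m]"

lemma set_\<sigma>: "set \<sigma> = EW \<union> es ` {..<m}"
  by (auto simp: \<sigma>_def wl)

lemma distinct_\<sigma>: "distinct \<sigma>"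
  unfolding \<sigma>_def using wl es_notin_EW by (auto simp: distinct_map inj_on_def)

definition greedy :: "(nat set \<Rightarrow> complex list) \<Rightarrow> bool" where
  "greedy bd \<longleftrightarrow> greedily_extends {..<n} (EW \<union> es ` {..<m}) p0 (\<lambda>_. []) {} p \<sigma> bd"

lemma greedy_step:
  assumes "greedy bd" "i < length \<sigma>"
  shows "admissible {..<n} p0 (\<lambda>_. []) (set (take (Suc i) \<sigma>)) p bd"
    and "admissible {..<n} p0 (\<lambda>_. []) (set (take (Suc i) \<sigma>)) p (bd(\<sigma> ! i := b)) \<Longrightarrow> length (bd (\<sigma> ! i)) \<le> length b"
  using assms unfolding greedy_def greedily_extends_def by auto

lemma admissibleI:
  assumes "I \<subseteq> {..<m}" "E' \<subseteq> EW" "\<And>e. e \<in> E' \<Longrightarrow> bd e = []" "drawing_ok I bd"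
  shows "admissible {..<n} p0 (\<lambda>_. []) (E' \<union> es ` I) p bd"
  unfolding admissible_def using planar_of_drawing_ok[OF assms] respects_of_drawing_ok[OF assms] by blast

text \<open>Once the earlier walls are straight, drawing the next one straight is admissible as
  well, so minimality leaves it no bend.\<close>

lemma greedy_walls:
  assumes g: "greedy bd" and e: "e \<in> EW"
  shows "bd e = []"
proof -
  have "bd (wl ! i) = []" if "i < length wl" for i
    using that
  proof (induction i rule: less_induct)
    case (less i)
    let ?E = "set (take (Suc i) wl)"
    have si: "\<sigma> ! i = wl ! i" "i < length \<sigma>" "set (take (Suc i) \<sigma>) = ?E"
      using less.prems by (auto simp: \<sigma>_def nth_append)
    have "(bd(wl ! i := [])) e = []" if e: "e \<in> ?E" for e
    proof -
      obtain j where "j < Suc i" "j < length wl" "e = wl ! j" using e by (auto simp: in_set_conv_nth)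
      then show ?thesis using less.IH[of j] by (cases "j = i") auto
    qed
    then have "admissible {..<n} p0 (\<lambda>_. []) (?E \<union> es ` {}) p (bd(wl ! i := []))"
      using wl(1) set_take_subset[of "Suc i" wl] by (intro admissibleI) (auto simp: drawing_ok_def)
    then show ?case using greedy_step(2)[OF g si(2), of "[]"] si by simp
  qed
  then show ?thesis using e wl(1) by (metis in_set_conv_nth)
qed

lemma take_\<sigma>: "k < m \<Longrightarrow> set (take (Suc (length wl + k)) \<sigma>) = EW \<union> es ` {..k}"
proof -
  assume "k < m"
  then have "take (Suc k) [0..<m] = [0..<Suc k]" by (subst take_upt) auto
  then have "set (take (Suc (length wl + k)) \<sigma>) = EW \<union> es ` set [0..<Suc k]"
    by (simp add: \<sigma>_def wl take_map del: upt_Suc)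
  then show ?thesis by (simp only: set_upt atLeast0LessThan lessThan_Suc_atMost)
qed

lemma greedy_drawing_ok:
  assumes "greedy bd" "k < m"
  shows "drawing_ok {..k} bd"
proof -
  have "length wl + k < length \<sigma>" using assms by (simp add: \<sigma>_def)
  then have "planar_drawing {..<n} (EW \<union> es ` {..k}) p bd"
    using greedy_step(1)[OF assms(1)] take_\<sigma>[OF assms(2)] unfolding admissible_def by metis
  then show ?thesis using assms greedy_walls by (intro drawing_ok_of_planar) auto
qed

text \<open>Minimality freed of homeomorphisms: a competitor only has to be a spike disjoint from
  the earlier curves.\<close>

lemma greedy_minimal:
  assumes g: "greedy bd" and k: "k < m" and bs: "spike_ok k bs"
    and disj: "\<And>j. j < k \<Longrightarrow> pimg (rp k # bs @ [tp k]) \<inter> curve bd j = {}"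
  shows "length (bd (es k)) \<le> length bs"
proof -
  let ?bd = "bd(es k := rev bs)"
  have i: "length wl + k < length \<sigma>" "\<sigma> ! (length wl + k) = es k" using k by (auto simp: \<sigma>_def nth_append)
  have ck: "curve ?bd k = pimg (rp k # bs @ [tp k])" by (simp add: curve_def)
  have cj: "curve ?bd j = curve bd j" if "j \<noteq> k" for j using that by (simp add: curve_def)
  have ok: "drawing_ok {..k} bd" by (rule greedy_drawing_ok[OF g k])
  have "drawing_ok {..k} ?bd"
    unfolding drawing_ok_def
  proof (intro conjI ballI impI)
    fix j assume "j \<in> {..k}"
    then show "spike_ok j (rev (?bd (es j)))" using ok bs by (cases "j = k") (auto simp: drawing_ok_def)
  next
    fix i j assume ij: "i \<in> {..k}" "j \<in> {..k}" "i \<noteq> j"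
    consider "i = k" "j < k" | "j = k" "i < k" | "i < k" "j < k" using ij by force
    then show "curve ?bd i \<inter> curve ?bd j = {}"
    proof cases
      case 1 then show ?thesis using ck cj[of j] disj[of j] by simp
    next
      case 2 then show ?thesis using ck cj[of i] disj[of i] by (simp add: Int_commute)
    next
      case 3 then show ?thesis using ok ij cj[of i] cj[of j] by (auto simp: drawing_ok_def)
    qed
  qed
  then have "admissible {..<n} p0 (\<lambda>_. []) (EW \<union> es ` {..k}) p ?bd"
    using k es_notin_EW[OF k] greedy_walls[OF g] by (intro admissibleI) auto
  then have "length (bd (es k)) \<le> length (rev bs)"
    using greedy_step(2)[OF g i(1), of "rev bs"] take_\<sigma>[OF k] i(2) by simp
  then show ?thesis by simp
qed

subsection \<open>Greedy drawings\<close>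

definition strip :: "nat \<Rightarrow> complex set" where
  "strip k = {z. \<bar>Re z - (12 * real k + 16)\<bar> < 1 \<and> 0 < Im z \<and> Im z < 1}"

definition tipseg :: "nat \<Rightarrow> complex set" where
  "tipseg k = closed_segment (Complex (12 * real k + 2) 0) (tp k)"

text \<open>The gate of the nook of tip \<open>k + 1\<close>: it runs from the root straight up to
  the lower end of the wall with residue 4.\<close>

definition KR :: "nat \<Rightarrow> complex set" where
  "KR k = closed_segment (rp k) (Complex (12 * real k + 16) 1)"

text \<open>The gate of the trunk to the right of the root, ending at the foot of its first baffle
  in column \<open>12 * (k + 1) + 5\<close>. It is slanted so that it also starts at the root, and a
  curve can leave the root along it.\<close>

definition KL :: "nat \<Rightarrow> complex set" where
  "KL k = closed_segment (rp k) (Complex (12 * real k + 17) 1)"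

lemma mem_tipseg: "z \<in> tipseg k \<longleftrightarrow> Re z = 12 * real k + 2 \<and> 0 \<le> Im z \<and> Im z \<le> 1"
  unfolding tipseg_def tp_def by (rule mem_vertical_segment) simp

lemma mem_KR: "z \<in> KR k \<longleftrightarrow> Re z = 12 * real k + 16 \<and> 0 \<le> Im z \<and> Im z \<le> 1"
  unfolding KR_def rp_def by (rule mem_vertical_segment) simp

lemma mem_KL: "z \<in> KL k \<longleftrightarrow> Re z = 12 * real k + 16 + Im z \<and> 0 \<le> Im z \<and> Im z \<le> 1"
proof
  assume "z \<in> KL k"
  then show "Re z = 12 * real k + 16 + Im z \<and> 0 \<le> Im z \<and> Im z \<le> 1"
  proof -
    obtain u where u: "0 \<le> u" "u \<le> 1" "z = (1 - u) *\<^sub>R rp k + u *\<^sub>R Complex (12 * real k + 17) 1"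
      using \<open>z \<in> KL k\<close> unfolding KL_def closed_segment_def by blast
    have "Re z = 12 * real k + 16 + u" "Im z = u" unfolding u(3) rp_def by (auto simp: algebra_simps)
    then show ?thesis using u(1,2) by simp
  qed
next
  assume "Re z = 12 * real k + 16 + Im z \<and> 0 \<le> Im z \<and> Im z \<le> 1"
  then show "z \<in> KL k"
    unfolding KL_def rp_def by (intro in_closed_segmentI[of _ "Im z"]) (auto simp: complex_eq_iff algebra_simps)
qed

lemma strip_\<Omega>: "k < m \<Longrightarrow> strip k \<subseteq> \<Omega>"
  using strip_subset_\<Omega>[of k] by (simp add: strip_def rp_def)

lemma \<Omega>_bounds: "z \<in> \<Omega> \<Longrightarrow> 0 < Re z \<and> Re z < real X \<and> 0 < Im z \<and> Im z < 5"
  by (simp add: \<Omega>_def box_def)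

lemma KR_\<Omega>: "k < m \<Longrightarrow> z \<in> KR k \<Longrightarrow> z \<in> \<Omega> \<Longrightarrow> z \<in> strip k"
proof -
  assume k: "k < m" and z: "z \<in> KR k" "z \<in> \<Omega>"
  have "Im z \<noteq> 1"
  proof
    assume "Im z = 1"
    then have "z \<in> W" using z(1) mem_KR[of z k] k lo_hi_offset[of 4 "k + 1"]
      by (intro W_vertical[of "k + 1" 4]) auto
    then show False using z(2) \<Omega>_W by blast
  qed
  then show ?thesis using z mem_KR[of z k] \<Omega>_bounds[of z] by (auto simp: strip_def)
qed

lemma KL_\<Omega>: "k < m \<Longrightarrow> z \<in> KL k \<Longrightarrow> z \<in> \<Omega> \<Longrightarrow> z \<in> strip k"
proof -
  assume k: "k < m" and z: "z \<in> KL k" "z \<in> \<Omega>"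
  have "Im z \<noteq> 1"
  proof
    assume "Im z = 1"
    then have "z \<in> W" using z(1) mem_KL[of z k] k lo_hi_offset[of 5 "k + 1"]
      by (intro W_vertical[of "k + 1" 5]) auto
    then show False using z(2) \<Omega>_W by blast
  qed
  then show ?thesis using z mem_KL[of z k] \<Omega>_bounds[of z] by (auto simp: strip_def)
qed

text \<open>The root is the middle of the lower side of a convex box. These segments are the initial
  pieces of all modified drawings of e_k.\<close>

lemma strip_segment: "q \<in> strip k \<Longrightarrow> closed_segment (rp k) q \<subseteq> insert (rp k) (strip k)"
proof
  fix z assume q: "q \<in> strip k" and "z \<in> closed_segment (rp k) q"
  then obtain t where t: "0 \<le> t" "t \<le> 1" "z = (1 - t) *\<^sub>R rp k + t *\<^sub>R q" unfolding closed_segment_def by blast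
  show "z \<in> insert (rp k) (strip k)"
  proof (cases "t = 0")
    case False
    have R: "Re z - (12 * real k + 16) = t * (Re q - (12 * real k + 16))" and I: "Im z = t * Im q"
      unfolding t(3) rp_def by (auto simp: algebra_simps)
    have "\<bar>t * (Re q - (12 * real k + 16))\<bar> \<le> 1 * \<bar>Re q - (12 * real k + 16)\<bar>"
      unfolding abs_mult using t by (intro mult_right_mono) auto
    moreover have "t * Im q \<le> 1 * Im q" using t q by (intro mult_right_mono) (auto simp: strip_def)
    moreover have "t * Im q > 0" using t False q by (auto simp: strip_def)
    ultimately show ?thesis using q unfolding strip_def R[symmetric] I[symmetric] by auto
  qed (use t in simp)
qed

text \<open>At the hanging baffles \<open>c\<close> and \<open>c + 2\<close> the line would be lower
  than 1, at the standing baffle between them higher than 3; but its height there is the mean of the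
  two outer heights.\<close>

lemma trunk_block:
  assumes j: "j \<le> m" and c: "c \<in> {5, 7, 9}"
    and u: "Re w \<le> 12 * real j + real c" "12 * real j + real c + 2 \<le> Re u"
    and sub: "\<And>z. z \<in> closed_segment w u \<Longrightarrow> 12 * real j + real c \<le> Re z \<Longrightarrow> Re z \<le> 12 * real j + real c + 2 \<Longrightarrow> z \<in> \<Omega>"
  shows False
proof -
  define x where "x = 12 * real j + real c"
  define q where "q = (Im u - Im w) / (Re u - Re w)"
  define y where "y = (\<lambda>s. Im w + (s - Re w) * q)"
  have in\<Omega>: "Complex s (y s) \<in> \<Omega>" if "x \<le> s" "s \<le> x + 2" for s
    using segment_point_at_Re[of w s u] sub[of "Complex s (y s)"] that u by (auto simp: y_def q_def x_def)
  have W: "Complex (12 * real j + real d) (y (12 * real j + real d)) \<notin> W \<and> 0 < y (12 * real j + real d) \<and> y (12 * real j + real d) < 5"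
    if "c \<le> d" "d \<le> c + 2" for d
  proof -
    have "real c \<le> real d" "real d \<le> real c + 2" using that by auto
    then show ?thesis using in\<Omega>[of "12 * real j + real d"] \<Omega>_W \<Omega>_bounds by (fastforce simp: x_def)
  qed
  have lip: "y (12 * real j + real d) < 1" if "c \<le> d" "d \<le> c + 2" "d \<in> {5, 7, 9, 11}" for d
    using W[OF that(1,2)] W_vertical[of j d "Complex (12 * real j + real d) (y (12 * real j + real d))"] j that lo_hi_offset[of d j] by force
  have baf: "y (12 * real j + real d) > 3" if "c \<le> d" "d \<le> c + 2" "d \<in> {6, 8, 10}" for d
    using W[OF that(1,2)] W_vertical[of j d "Complex (12 * real j + real d) (y (12 * real j + real d))"] j that lo_hi_offset[of d j] by force
  have "y x < 1" "y (x + 2) < 1" using lip[of c] lip[of "c + 2"] c by (auto simp: x_def algebra_simps)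
  moreover have "y (x + 1) > 3" using baf[of "c + 1"] c by (auto simp: x_def algebra_simps)
  moreover have "2 * y (x + 1) = y x + y (x + 2)" by (simp add: y_def algebra_simps)
  ultimately show False by linarith
qed

text \<open>Coming from the right, the triple 9-10-11 keeps the first bend to the right of column 9,
  the triple 7-8-9 keeps the second to the right of column 7, and the triple 5-6-7 prevents the next
  segment from reaching column 5.\<close>

lemma trunk_bends:
  assumes j: "j \<le> m" and ab: "12 * real j + 11 \<le> Re a" "Re b \<le> 12 * real j + 5"
    and sub: "\<And>z. z \<in> pimg (a # bs @ [b]) \<Longrightarrow> 12 * real j + 5 \<le> Re z \<Longrightarrow> Re z \<le> 12 * real j + 11 \<Longrightarrow> z \<in> \<Omega>"
  shows "3 \<le> length bs"
proof (rule ccontr)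
  assume "\<not> 3 \<le> length bs"
  then consider "bs = []" | b1 where "bs = [b1]" | b1 b2 where "bs = [b1, b2]"
    by (cases bs; cases "tl bs"; cases "tl (tl bs)") auto
  moreover have blk: "Re u < 12 * real j + real c + 2 \<or> 12 * real j + real c < Re w"
    if "c \<in> {5, 7, 9}" "closed_segment w u \<subseteq> pimg (a # bs @ [b])" for w u c
  proof (rule ccontr)
    assume "\<not> (Re u < 12 * real j + real c + 2 \<or> 12 * real j + real c < Re w)"
    then show False using trunk_block[OF j that(1), of w u] sub that by (force simp del: pimg_Cons)
  qed
  ultimately show False
  proof cases
    case 1
    then show False using blk[of 5 b a] ab by (auto simp: closed_segment_commute)
  next
    case 2
    then have "closed_segment b1 a \<subseteq> pimg (a # bs @ [b])" "closed_segment b b1 \<subseteq> pimg (a # bs @ [b])"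
      by (auto simp: closed_segment_commute)
    then show False using blk[of 9 b1 a] blk[of 5 b b1] ab by auto
  next
    case 3
    then have "closed_segment b1 a \<subseteq> pimg (a # bs @ [b])" "closed_segment b2 b1 \<subseteq> pimg (a # bs @ [b])" "closed_segment b b2 \<subseteq> pimg (a # bs @ [b])"
      by (auto simp: closed_segment_commute)
    then show False using blk[of 9 b1 a] blk[of 7 b2 b1] blk[of 5 b b2] ab by auto
  qed
qed

section \<open>Regions behind the gates and excursions into them\<close>

definition Areg :: "nat \<Rightarrow> complex set" where
  "Areg k = {z. Re z > 12 * real k + 17 \<or> (Re z > 12 * real k + 16 \<and> Im z < Re z - (12 * real k + 16))}"

definition Nreg :: "nat \<Rightarrow> complex set" where
  "Nreg k = {z. 12 * real k + 13 < Re z \<and> Re z < 12 * real k + 16 \<and> 0 < Im z \<and> Im z < 4}"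

text \<open>The first baffle fills the vertical part of the frontier from height 1 up to the
  ceiling, so that within \<open>\<Omega>\<close> the gate is the only passage.\<close>

lemma frontier_Areg: "k < m \<Longrightarrow> frontier (Areg k) \<inter> \<Omega> \<subseteq> KL k"
proof
  fix z assume k: "k < m" and z: "z \<in> frontier (Areg k) \<inter> \<Omega>"
  have "open (Areg k)" unfolding Areg_def
    by (intro open_Collect_disj open_Collect_conj open_Collect_less continuous_intros)
  then have "z \<notin> Areg k" using z by (simp add: frontier_def interior_open)
  moreover have "closure (Areg k) \<subseteq> {z. Re z \<ge> 12 * real k + 17 \<or> (Re z \<ge> 12 * real k + 16 \<and> Im z \<le> Re z - (12 * real k + 16))}"
    by (rule closure_minimal) (auto simp: Areg_def intro!: closed_Collect_disj closed_Collect_conj closed_Collect_le continuous_intros)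
  ultimately have c: "Re z \<ge> 12 * real k + 17 \<or> (Re z \<ge> 12 * real k + 16 \<and> Im z \<le> Re z - (12 * real k + 16))" "Re z \<le> 12 * real k + 17"
    "Re z > 12 * real k + 16 \<longrightarrow> Im z \<ge> Re z - (12 * real k + 16)" using z by (auto simp: Areg_def frontier_def)
  have b: "0 < Im z" "Im z < 5" "z \<notin> W" using z \<Omega>_bounds \<Omega>_W by auto
  have "Im z \<le> 1" if "Re z = 12 * real k + 17"
  proof (rule ccontr)
    assume "\<not> Im z \<le> 1"
    then have "z \<in> W" using b that k lo_hi_offset[of 5 "k + 1"] by (intro W_vertical[of "k + 1" 5]) auto
    then show False using b by blast
  qed
  then show "z \<in> KL k" unfolding mem_KL using c b by (cases "Re z = 12 * real k + 17") auto
qed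

text \<open>The nook is bounded by the walls with residues 1 and 4, the roof and the floor; only the
  mouth below the wall with residue 4 is open.\<close>

lemma frontier_Nreg: "k < m \<Longrightarrow> frontier (Nreg k) \<inter> \<Omega> \<subseteq> KR k"
proof
  fix z assume k: "k < m" and z: "z \<in> frontier (Nreg k) \<inter> \<Omega>"
  have "open (Nreg k)" unfolding Nreg_def
    by (intro open_Collect_conj open_Collect_less continuous_intros)
  then have nz: "z \<notin> Nreg k" using z by (simp add: frontier_def interior_open)
  moreover have "closure (Nreg k) \<subseteq> {z. 12 * real k + 13 \<le> Re z \<and> Re z \<le> 12 * real k + 16 \<and> 0 \<le> Im z \<and> Im z \<le> 4}"
    by (rule closure_minimal) (auto simp: Nreg_def intro!: closed_Collect_conj closed_Collect_le continuous_intros)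
  ultimately have c: "12 * real k + 13 \<le> Re z" "Re z \<le> 12 * real k + 16" "0 \<le> Im z" "Im z \<le> 4"
    using z by (auto simp: frontier_def)
  have b: "0 < Im z" "Im z < 5" "z \<notin> W" using z \<Omega>_bounds \<Omega>_W by auto
  have "Im z \<noteq> 4"
  proof
    assume "Im z = 4"
    then have "z \<in> W" using c k unfolding W_def by (intro UnI2 CollectI exI[of _ "k + 1"]) auto
    then show False using b by blast
  qed
  moreover have "Re z \<noteq> 12 * real k + 13"
  proof
    assume "Re z = 12 * real k + 13"
    then have "z \<in> W" using b c k lo_hi_offset[of 1 "k + 1"] by (intro W_vertical[of "k + 1" 1]) auto
    then show False using b by blast
  qed
  ultimately have "Re z = 12 * real k + 16" using nz c b by (auto simp: Nreg_def)
  moreover have "Im z \<le> 1"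
  proof (rule ccontr)
    assume "\<not> Im z \<le> 1"
    then have "z \<in> W" using b c \<open>Re z = _\<close> k lo_hi_offset[of 4 "k + 1"] by (intro W_vertical[of "k + 1" 4]) auto
    then show False using b by blast
  qed
  ultimately show "z \<in> KR k" using mem_KR b by auto
qed

lemma tp_notin_strip: "tp j \<notin> strip k"
  using tp_rp_sep[of j k] by (auto simp: strip_def rp_def)

lemma greedy_spike_ok: "greedy bd \<Longrightarrow> k < m \<Longrightarrow> spike_ok k (rev (bd (es k)))"
  using greedy_drawing_ok[of bd k] by (auto simp: drawing_ok_def)

lemma greedy_disjoint: "greedy bd \<Longrightarrow> j < k \<Longrightarrow> k < m \<Longrightarrow> curve bd j \<inter> curve bd k = {}"
  using greedy_drawing_ok[of bd k] by (auto simp: drawing_ok_def)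

lemma curve_\<Omega>: "greedy bd \<Longrightarrow> k < m \<Longrightarrow> curve bd k - {rp k} \<subseteq> \<Omega>"
  unfolding curve_def by (rule spike_subset_\<Omega>[OF _ greedy_spike_ok])

text \<open>\<open>K\<close> is the gate of the region \<open>A\<close>. The way from the root to
  \<open>z\<close> has a bend, and so has the way from \<open>z\<close> to the last passage
  \<open>q\<close> of the gate, because neither can be straight. Joining the root to
  \<open>q\<close> along the gate replaces both by the single bend \<open>q\<close>. The hypothesis
  \<open>old\<close> keeps this new piece away from earlier curves.\<close>

lemma shortcut:
  assumes g: "greedy bd" and k: "k < m" and z: "z \<in> curve bd k" "z \<in> A" "z \<notin> K"
    and tA: "tp k \<notin> A" and fr: "frontier A \<inter> \<Omega> \<subseteq> K" and K: "closed K" "convex K" "rp k \<in> K" "tp k \<notin> K" "K \<inter> \<Omega> \<subseteq> strip k"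
    and old: "\<And>j w. j < k \<Longrightarrow> w \<in> curve bd j \<Longrightarrow> Re w < 12 * real k + 15"
    and blk: "\<not> closed_segment (rp k) z \<subseteq> insert (rp k) \<Omega>" "\<And>q. q \<in> K \<Longrightarrow> \<not> closed_segment z q \<subseteq> \<Omega>"
  shows False
proof -
  define bs where "bs = rev (bd (es k))"
  have ok: "spike_ok k bs" using greedy_spike_ok[OF g k] by (simp add: bs_def)
  have C: "curve bd k = pimg (rp k # bs @ [tp k])" by (simp add: curve_def bs_def)
  have C\<Omega>: "curve bd k - {rp k} \<subseteq> \<Omega>" by (rule curve_\<Omega>[OF g k])
  have arc: "arc (polyline (rp k # bs @ [tp k]))" using ok by (simp add: spike_ok_def)
  have zr: "z \<noteq> rp k" "z \<noteq> tp k" using z K tA by auto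
  obtain bs1 bs2 where cut: "length bs1 + length bs2 \<le> length bs"
     "arc (polyline (rp k # bs1 @ [z]))" "arc (polyline (z # bs2 @ [tp k]))"
     "pimg (rp k # bs1 @ [z]) \<union> pimg (z # bs2 @ [tp k]) = curve bd k"
     "pimg (rp k # bs1 @ [z]) \<inter> pimg (z # bs2 @ [tp k]) = {z}"
    using polyline_cut[OF arc _ zr] z(1) unfolding C by blast
  define Q where "Q = pimg (z # bs2 @ [tp k])"
  have QC: "Q \<subseteq> curve bd k" using cut(4) Q_def by blast
  have rQ: "rp k \<notin> Q" using cut(5) zr pimg_endpoints(1)[of "rp k" "bs1 @ [z]"] unfolding Q_def by (metis IntI singletonD)
  have Q\<Omega>: "Q \<subseteq> \<Omega>" using QC rQ C\<Omega> by blast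
  have "Q \<inter> frontier A \<noteq> {}"
    by (rule connected_Int_frontier) (use z(2) tA pimg_endpoints(1)[of z] pimg_endpoints(3)[of "tp k" z bs2] in \<open>auto simp: Q_def simp del: pimg_Cons\<close>)
  then have QK: "Q \<inter> K \<noteq> {}" using fr Q\<Omega> by blast
  obtain q c1 c2 where q: "q \<in> K" "length c1 + length c2 \<le> length bs2"
     "arc (polyline (z # c1 @ [q]))" "arc (polyline (q # c2 @ [tp k]))"
     "pimg (z # c1 @ [q]) \<union> pimg (q # c2 @ [tp k]) = Q"
     "pimg (q # c2 @ [tp k]) \<inter> K = {q}"
    using polyline_last_hit[OF cut(3) K(1) z(3) K(4)] QK unfolding Q_def by metis
  have qQ: "q \<in> Q" using q(5) pimg_endpoints(1)[of q] by blast
  have qs: "q \<in> strip k" using K(5) q(1) qQ Q\<Omega> by blast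
  have "bs1 \<noteq> []"
  proof
    assume "bs1 = []"
    then have "closed_segment (rp k) z \<subseteq> curve bd k" using cut(4) by auto
    then show False using blk(1) C\<Omega> by blast
  qed
  moreover have "c1 \<noteq> []"
  proof
    assume "c1 = []"
    then have "closed_segment z q \<subseteq> Q" using q(5) by auto
    then show False using blk(2)[OF q(1)] Q\<Omega> by blast
  qed
  ultimately have len: "length bs1 \<ge> 1" "length c1 \<ge> 1" by (auto simp: Suc_le_eq)
  define T where "T = pimg (q # c2 @ [tp k])"
  have TQ: "T \<subseteq> Q" using q(5) T_def by blast
  have seg: "closed_segment (rp k) q \<subseteq> K" using K q(1) by (simp add: closed_segment_subset)
  have img: "pimg (rp k # (q # c2) @ [tp k]) = closed_segment (rp k) q \<union> T" by (simp add: T_def)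
  have segs: "closed_segment (rp k) q \<subseteq> insert (rp k) (strip k)" by (rule strip_segment[OF qs])
  have "spike_ok k (q # c2)"
    unfolding spike_ok_def img
  proof (intro conjI allI impI)
    obtain d ds where d: "c2 @ [tp k] = d # ds" by (cases c2) auto
    have "rp k \<noteq> q" using rQ qQ by blast
    then have "arc (polyline (rp k # q # d # ds))"
      using q(4,6) seg unfolding arc_polyline_Cons d by blast
    then show "arc (polyline (rp k # (q # c2) @ [tp k]))" using d by simp
    show "(closed_segment (rp k) q \<union> T) \<inter> W \<subseteq> {rp k}"
      using segs strip_\<Omega>[OF k] TQ Q\<Omega> \<Omega>_W by blast
    fix j assume j: "j < m" "j \<noteq> k"
    have "tp j \<notin> T" using TQ QC ok j unfolding C spike_ok_def by blast
    moreover have "tp j \<noteq> rp k" by (simp add: tp_def rp_def)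
    ultimately show "tp j \<notin> closed_segment (rp k) q \<union> T" using segs tp_notin_strip by blast
  qed
  moreover have "pimg (rp k # (q # c2) @ [tp k]) \<inter> curve bd j = {}" if j: "j < k" for j
  proof -
    have "T \<inter> curve bd j = {}" using TQ QC greedy_disjoint[OF g j k] by blast
    moreover have "w \<notin> curve bd j" if "w \<in> closed_segment (rp k) q" for w
    proof
      assume "w \<in> curve bd j"
      then have "Re w < 12 * real k + 15" using old[OF j] by blast
      moreover have "w \<in> insert (rp k) (strip k)" using segs that by blast
      ultimately show False by (auto simp: strip_def rp_def)
    qed
    ultimately show ?thesis unfolding img by blast
  qed
  \<comment> \<open>The new curve has \<open>1 + length c2\<close> bends, whereas the old one has at
    least \<open>length bs1 + length c1 + length c2\<close>, hence at least
    \<open>2 + length c2\<close>.\<close>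
  ultimately have "length (bd (es k)) \<le> length (q # c2)" by (rule greedy_minimal[OF g k])
  moreover have "length (bd (es k)) = length bs" by (simp add: bs_def)
  ultimately show False using cut(1) q(2) len by simp
qed

text \<open>Column \<open>12 * k + 19\<close> is the third of the first triple beyond the root, so
  neither the way there nor the way back to the gate can be straight, and \<open>shortcut\<close>
  applies. The induction clears the gate: for \<open>j < k\<close> earlier curves stay left of
  \<open>12 * j + 19\<close>, which is at most \<open>12 * k + 7\<close>.\<close>

lemma guard_trunk:
  assumes g: "greedy bd"
  shows "k < m \<Longrightarrow> w \<in> curve bd k \<Longrightarrow> Re w < 12 * real k + 19"
proof (induction k arbitrary: w rule: less_induct)
  case (less k)
  show ?case
  proof (rule ccontr)
    assume "\<not> Re w < 12 * real k + 19"
    then have w: "Re w \<ge> 12 * real k + 19" by simp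
    have old: "Re u < 12 * real k + 15" if "j < k" "u \<in> curve bd j" for j u
    proof -
      have "Re u < 12 * real j + 19" using less.IH[OF that(1) _ that(2)] that less.prems by simp
      moreover have "real j + 1 \<le> real k" using that(1) by linarith
      ultimately show ?thesis by simp
    qed
    have k1: "k + 1 \<le> m" using less.prems by simp
    show False
    proof (rule shortcut[OF g less.prems(1) less.prems(2), where A = "Areg k" and K = "KL k"])
      show "w \<in> Areg k" using w by (simp add: Areg_def)
      show "w \<notin> KL k" using w by (simp add: mem_KL)
      show "tp k \<notin> Areg k" "tp k \<notin> KL k" by (auto simp: Areg_def tp_def mem_KL)
      show "frontier (Areg k) \<inter> \<Omega> \<subseteq> KL k" by (rule frontier_Areg[OF less.prems(1)])
      show "closed (KL k)" "convex (KL k)" "rp k \<in> KL k" by (auto simp: KL_def)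
      show "KL k \<inter> \<Omega> \<subseteq> strip k" using KL_\<Omega>[OF less.prems(1)] by blast
      show "\<And>j w. j < k \<Longrightarrow> w \<in> curve bd j \<Longrightarrow> Re w < 12 * real k + 15" by (rule old)
      show "\<not> closed_segment (rp k) w \<subseteq> insert (rp k) \<Omega>"
      proof
        assume s: "closed_segment (rp k) w \<subseteq> insert (rp k) \<Omega>"
        show False
        proof (rule trunk_block[OF k1, of 5 "rp k" w])
          fix z assume "z \<in> closed_segment (rp k) w" "12 * real (k + 1) + real 5 \<le> Re z"
          then show "z \<in> \<Omega>" using s by (auto simp: rp_def)
        qed (use w in \<open>auto simp: rp_def\<close>)
      qed
      show "\<not> closed_segment w q \<subseteq> \<Omega>" if "q \<in> KL k" for q
      proof
        assume s: "closed_segment w q \<subseteq> \<Omega>"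
        show False
          by (rule trunk_block[OF k1, of 5 q w]) (use s w that in \<open>auto simp: mem_KL closed_segment_commute\<close>)
      qed
    qed
  qed
qed

lemma old_curves:
  assumes "greedy bd" "j < k" "k < m" "w \<in> curve bd j"
  shows "Re w < 12 * real k + 15"
proof -
  have "Re w < 12 * real j + 19" using guard_trunk assms by simp
  moreover have "real j + 1 \<le> real k" using assms(2) by linarith
  ultimately show ?thesis by simp
qed

text \<open>By \<open>guard_trunk\<close> only the edge with \<open>j + 1 = k\<close>, whose root
  lies in the mouth of this nook, comes far enough to the right. The baffle in column 3 stands
  exactly half way between the gate and \<open>tipseg k\<close>, so a segment joining them has its
  midpoint, of height at most 1, on the baffle.\<close>

lemma guard_nook:
  assumes g: "greedy bd" and j: "j < k" and k: "k < m"
  shows "curve bd j \<inter> tipseg k = {}"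
proof (rule ccontr)
  assume "curve bd j \<inter> tipseg k \<noteq> {}"
  then obtain z where z: "z \<in> curve bd j" "z \<in> tipseg k" by blast
  have jm: "j < m" using j k by simp
  have zb: "Re z = 12 * real k + 2" "0 \<le> Im z" "Im z \<le> 1" using z(2) mem_tipseg by auto
  have "Re z < 12 * real j + 19" by (rule guard_trunk[OF g jm z(1)])
  then have "real k < real j + 2" using zb by simp
  then have kj: "k = j + 1" using j by linarith
  have zR: "Re z = 12 * real j + 14" using zb kj by simp
  have "z \<noteq> rp j" using zR by (auto simp: rp_def)
  then have z\<Omega>: "z \<in> \<Omega>" using curve_\<Omega>[OF g jm] z(1) by blast
  have baf: "Complex (12 * real j + 15) y \<in> W" if "0 \<le> y" "y \<le> 3" for y
    using that k kj lo_hi_offset[of 3 "j + 1"] by (intro W_vertical[of "j + 1" 3]) auto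
  show False
  proof (rule shortcut[OF g jm z(1), where A = "Nreg j" and K = "KR j"])
    show "z \<in> Nreg j" using zb zR \<Omega>_bounds[OF z\<Omega>] by (simp add: Nreg_def)
    show "z \<notin> KR j" using zR by (simp add: mem_KR)
    show "tp j \<notin> Nreg j" "tp j \<notin> KR j" by (auto simp: Nreg_def tp_def mem_KR)
    show "frontier (Nreg j) \<inter> \<Omega> \<subseteq> KR j" by (rule frontier_Nreg[OF jm])
    show "closed (KR j)" "convex (KR j)" "rp j \<in> KR j" by (auto simp: KR_def)
    show "KR j \<inter> \<Omega> \<subseteq> strip j" using KR_\<Omega>[OF jm] by blast
    show "\<And>i w. i < j \<Longrightarrow> w \<in> curve bd i \<Longrightarrow> Re w < 12 * real j + 15" using old_curves[OF g _ jm] by blast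
    show "\<not> closed_segment (rp j) z \<subseteq> insert (rp j) \<Omega>"
    proof -
      let ?m = "Complex ((Re (rp j) + Re z) / 2) ((Im (rp j) + Im z) / 2)"
      have eq: "?m = Complex (12 * real j + 15) (Im z / 2)" using zR by (simp add: rp_def)
      have "Complex (12 * real j + 15) (Im z / 2) \<in> W" by (rule baf) (use zb in auto)
      then have "?m \<in> W" unfolding eq .
      moreover have "?m \<noteq> rp j" unfolding eq by (simp add: rp_def)
      ultimately show ?thesis using midpoint_in_closed_segment[of "rp j" z] \<Omega>_W by blast
    qed
    show "\<not> closed_segment z q \<subseteq> \<Omega>" if q: "q \<in> KR j" for q
    proof -
      let ?m = "Complex ((Re z + Re q) / 2) ((Im z + Im q) / 2)"
      have eq: "?m = Complex (12 * real j + 15) ((Im z + Im q) / 2)" using zR q mem_KR by simp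
      have "Complex (12 * real j + 15) ((Im z + Im q) / 2) \<in> W" by (rule baf) (use zb q mem_KR in auto)
      then have "?m \<in> W" unfolding eq .
      then show ?thesis using midpoint_in_closed_segment[of z q] \<Omega>_W by blast
    qed
  qed
qed

text \<open>The arc from \<open>x\<close> to \<open>q\<close> will be a piece of e_(k+1). With a
  segment from the root to \<open>x\<close> and another from \<open>q\<close> up to the tip it
  competes with e_k, and \<open>x\<close> and \<open>q\<close> are the two extra bends. The piece
  below the tip is free of earlier curves by \<open>guard_nook\<close>, the piece at the root by
  \<open>old_curves\<close>.\<close>

lemma detour:
  assumes g: "greedy bd" and k: "k < m" and arc: "arc (polyline (x # l @ [q]))"
    and M: "pimg (x # l @ [q]) \<subseteq> \<Omega>" and x: "x \<in> strip k" and q: "q \<in> tipseg k"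
    and Mx: "pimg (x # l @ [q]) \<inter> closed_segment (rp k) x \<subseteq> {x}" and Mq: "pimg (x # l @ [q]) \<inter> tipseg k \<subseteq> {q}"
    and tips: "\<And>j. j < m \<Longrightarrow> tp j \<notin> pimg (x # l @ [q])"
    and old: "\<And>j. j < k \<Longrightarrow> pimg (x # l @ [q]) \<inter> curve bd j = {}"
  shows "length (bd (es k)) \<le> length l + 2"
proof -
  define M where "M = pimg (x # l @ [q])"
  have ends: "x \<in> M" "q \<in> M" by (auto simp: M_def simp del: pimg_Cons)
  have q\<Omega>: "q \<in> \<Omega>" using ends assms(4) by (auto simp: M_def simp del: pimg_Cons)
  have qt: "q \<noteq> tp k" using tips[OF k] ends(2) by (auto simp: M_def simp del: pimg_Cons)
  have r\<Omega>: "rp k \<notin> \<Omega>" using rp_in_W[OF k] \<Omega>_W by blast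
  have xr: "rp k \<noteq> x" using r\<Omega> ends assms(4) by (auto simp: M_def simp del: pimg_Cons)
  have seg1: "closed_segment (rp k) x \<subseteq> insert (rp k) (strip k)" by (rule strip_segment[OF x])
  have tt: "tp k \<in> tipseg k" by (simp add: tipseg_def)
  have seg2t: "closed_segment q (tp k) \<subseteq> tipseg k"
    using q tt by (simp add: tipseg_def subset_closed_segment)
  have seg2: "z \<in> \<Omega> \<and> Re z = 12 * real k + 2" if z: "z \<in> closed_segment q (tp k)" for z
  proof -
    have z1: "Re z = 12 * real k + 2" "Im z \<le> 1" using z seg2t mem_tipseg by auto
    have "q = Complex (12 * real k + 2) (Im q)" using q mem_tipseg by (simp add: complex_eq_iff)
    then have "Im z \<ge> Im q" using z mem_vertical_segment[of "Im q" 1 z "12 * real k + 2"] q mem_tipseg by (simp add: tp_def)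
    then have z2: "Im z > 0" using \<Omega>_bounds[OF q\<Omega>] by simp
    have "real k + 1 \<le> real m" using k by linarith
    then have "z \<in> box" using z1 z2 by (auto simp: box_def X_def)
    then show ?thesis using tip_free[of z k] z1 z2 by (auto simp: \<Omega>_def)
  qed
  have disj: "closed_segment (rp k) x \<inter> closed_segment q (tp k) = {}"
  proof -
    have "z \<notin> closed_segment (rp k) x" if "Re z = 12 * real k + 2" for z
      using seg1 that by (auto simp: strip_def rp_def)
    then show ?thesis using seg2 by blast
  qed
  have P1: "pimg (rp k # x # l @ [q]) = closed_segment (rp k) x \<union> M" by (simp add: M_def)
  have P2: "pimg [q, tp k] = closed_segment q (tp k)" by auto
  have img: "pimg (rp k # (x # l @ [q]) @ [tp k]) = closed_segment (rp k) x \<union> M \<union> closed_segment q (tp k)"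
    using pimg_append[of "rp k # x # l" q "[tp k]"] P1 P2 by (simp del: pimg_Cons)
  have arc1: "arc (polyline ((rp k # x # l) @ [q]))"
  proof -
    obtain d ds where d: "l @ [q] = d # ds" by (cases l) auto
    show ?thesis using arc xr Mx by (simp add: d arc_polyline_Cons Int_commute del: pimg_Cons)
  qed
  have "spike_ok k (x # l @ [q])"
    unfolding spike_ok_def img
  proof (intro conjI allI impI)
    have "arc (polyline ((rp k # x # l) @ q # [tp k]))"
      using arc1 qt disj Mq seg2t unfolding P1 M_def[symmetric]
      by (subst arc_polyline_append) (auto simp: P1 P2 M_def[symmetric] simp del: pimg_Cons)
    then show "arc (polyline (rp k # (x # l @ [q]) @ [tp k]))" by simp
    show "(closed_segment (rp k) x \<union> M \<union> closed_segment q (tp k)) \<inter> W \<subseteq> {rp k}"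
      using seg1 strip_\<Omega>[OF k] assms(4) seg2 \<Omega>_W unfolding M_def by blast
    fix j assume j: "j < m" "j \<noteq> k"
    have "tp j \<noteq> rp k" by (simp add: tp_def rp_def)
    moreover have "tp j \<notin> closed_segment q (tp k)" using seg2[of "tp j"] j by (auto simp: tp_def)
    ultimately show "tp j \<notin> closed_segment (rp k) x \<union> M \<union> closed_segment q (tp k)"
      using tips[OF j(1)] seg1 tp_notin_strip unfolding M_def by blast
  qed
  moreover have "pimg (rp k # (x # l @ [q]) @ [tp k]) \<inter> curve bd j = {}" if j: "j < k" for j
  proof -
    have "w \<notin> curve bd j" if "w \<in> closed_segment (rp k) x" for w
    proof
      assume "w \<in> curve bd j"
      then have "Re w < 12 * real k + 15" using old_curves[OF g j k] by blast
      moreover have "w \<in> insert (rp k) (strip k)" using seg1 that by blast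
      ultimately show False by (auto simp: strip_def rp_def)
    qed
    moreover have "closed_segment q (tp k) \<inter> curve bd j = {}" using guard_nook[OF g j k] seg2t by blast
    ultimately show ?thesis using old[OF j] unfolding img M_def by blast
  qed
  ultimately have "length (bd (es k)) \<le> length (x # l @ [q])" by (rule greedy_minimal[OF g k])
  then show ?thesis by simp
qed

text \<open>Prolonged by the drops from their tips to the floor, e_k and e_(k+1) have end points
  that alternate along the floor, so the prolonged curves cross. The two drops are disjoint, the two
  edges are disjoint, and \<open>guard_nook\<close> keeps e_k off the drop of e_(k+1); one
  possibility remains.\<close>

lemma curve_hits_tipseg:
  assumes g: "greedy bd" and k: "k + 1 < m"
  shows "curve bd (k + 1) \<inter> tipseg k \<noteq> {}"
proof -
  define f where "f = (\<lambda>k. polyline (Complex (12 * real k + 2) 0 # tp k # bd (es k) @ [rp k]))"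
  have img: "path_image (f k) = tipseg k \<union> curve bd k" for k
    unfolding f_def curve_def polyline_swap_ends by (simp add: tipseg_def)
  have bnd: "0 \<le> Re z \<and> Re z \<le> real X \<and> 0 \<le> Im z \<and> Im z \<le> 5" if jz: "j < m" "z \<in> path_image (f j)" for z j
  proof -
    have jm: "real j + 1 \<le> real m" using jz by linarith
    consider "z \<in> tipseg j" | "z = rp j" | "z \<in> \<Omega>" using jz(2) curve_\<Omega>[OF g jz(1)] unfolding img by blast
    then show ?thesis
    proof cases
      case 1 then show ?thesis using jm by (auto simp: mem_tipseg X_def)
    next
      case 2 then show ?thesis using jm by (auto simp: rp_def X_def)
    next
      case 3 then show ?thesis using \<Omega>_bounds[of z] by auto
    qed
  qed
  have fin: "pathstart (f j) = Complex (12 * real j + 2) 0" "pathfinish (f j) = rp j" "path (f j)" for j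
    by (auto simp: f_def)
  have "path_image (f k) \<inter> path_image (f (k + 1)) \<noteq> {}"
  proof (rule fashoda_interlace_complex[where ?x0.0 = 0 and ?x1.0 = "real X" and ?y1.0 = 5])
    show "0 \<le> Re z \<and> Re z \<le> real X \<and> 0 \<le> Im z \<and> Im z \<le> 5" if "z \<in> path_image (f k)" for z
      using bnd[of k z] that k by simp
    show "0 \<le> Re z \<and> Re z \<le> real X \<and> 0 \<le> Im z \<and> Im z \<le> 5" if "z \<in> path_image (f (k + 1))" for z
      using bnd[OF k that] .
  qed (auto simp: fin rp_def)
  then have "(tipseg k \<union> curve bd k) \<inter> (tipseg (k + 1) \<union> curve bd (k + 1)) \<noteq> {}" unfolding img .
  moreover have "tipseg k \<inter> tipseg (k + 1) = {}" by (auto simp: mem_tipseg)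
  moreover have "curve bd k \<inter> tipseg (k + 1) = {}" using guard_nook[OF g, of k "k + 1"] k by simp
  moreover have "curve bd k \<inter> curve bd (k + 1) = {}" using greedy_disjoint[OF g, of k "k + 1"] k by simp
  ultimately show ?thesis by blast
qed

text \<open>From its root on, e_(k+1) is cut at \<open>KL k\<close>, at its first and last contacts
  with \<open>tipseg k\<close>, and at \<open>KR k\<close>. The stretch before \<open>KL k\<close>
  has at least three bends, and with \<open>b\<close> for the number of bends of e_k the stretches
  between gate and \<open>tipseg k\<close> have at least \<open>b - 2\<close> each;
  \<open>3 + 2 * (b - 2) = 2 * b - 1\<close>.\<close>

lemma doubling:
  assumes g: "greedy bd" and k: "k + 1 < m"
  shows "2 * length (bd (es k)) \<le> length (bd (es (k + 1))) + 1"
proof -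
  let ?K = "k + 1"
  have km: "k < m" using k by simp
  define bs where "bs = rev (bd (es ?K))"
  have ok: "spike_ok ?K bs" using greedy_spike_ok[OF g k] by (simp add: bs_def)
  have C: "curve bd ?K = pimg (rp ?K # bs @ [tp ?K])" by (simp add: curve_def bs_def)
  have C\<Omega>: "curve bd ?K - {rp ?K} \<subseteq> \<Omega>" by (rule curve_\<Omega>[OF g k])
  have arc: "arc (polyline (rp ?K # bs @ [tp ?K]))" using ok by (simp add: spike_ok_def)
  have tipC: "tp j \<notin> curve bd ?K" if "j < m" "j \<noteq> ?K" for j using ok that unfolding C spike_ok_def by blast
  have dis: "curve bd ?K \<inter> curve bd j = {}" if "j < k" for j using greedy_disjoint[OF g, of j ?K] that k by auto
  have out: "rp ?K \<notin> tipseg k" "tp ?K \<notin> tipseg k" by (auto simp: mem_tipseg rp_def tp_def)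
  have clt: "closed (tipseg k)" by (simp add: tipseg_def)
  obtain q l1 l2 where q: "q \<in> tipseg k" "length l1 + length l2 \<le> length bs"
     "arc (polyline (rp ?K # l1 @ [q]))" "arc (polyline (q # l2 @ [tp ?K]))"
     "pimg (rp ?K # l1 @ [q]) \<union> pimg (q # l2 @ [tp ?K]) = curve bd ?K"
     "pimg (rp ?K # l1 @ [q]) \<inter> pimg (q # l2 @ [tp ?K]) = {q}" "pimg (rp ?K # l1 @ [q]) \<inter> tipseg k = {q}"
    using polyline_first_hit[OF arc clt out] curve_hits_tipseg[OF g k] unfolding C by metis
  define L where "L = pimg (rp ?K # l1 @ [q])"
  define R where "R = pimg (q # l2 @ [tp ?K])"
  have qne: "q \<noteq> rp ?K" "q \<noteq> tp ?K" using q(1) out by auto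
  have LC: "L \<subseteq> curve bd ?K" "R \<subseteq> curve bd ?K" using q(5) by (auto simp: L_def R_def simp del: pimg_Cons)
  have tL: "tp ?K \<notin> L" using q(6) qne pimg_endpoints(3)[of "tp ?K" q l2] unfolding L_def by (metis IntI singletonD)
  have rR: "rp ?K \<notin> R" using q(6) qne pimg_endpoints(1)[of "rp ?K" "l1 @ [q]"] unfolding R_def by (metis IntI singletonD)
  have R\<Omega>: "R \<subseteq> \<Omega>" using LC rR C\<Omega> by blast
  have qR: "Re q = 12 * real k + 2" using q(1) mem_tipseg by blast
  have rK: "Re (rp ?K) = 12 * real k + 28" by (simp add: rp_def)

  \<comment> \<open>The part up to \<open>tipseg k\<close> starts on the right of the trunk gate and
    ends on its left.\<close>
  have "L \<inter> frontier (Areg k) \<noteq> {}"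
  proof (rule connected_Int_frontier)
    show "L \<inter> Areg k \<noteq> {}" using pimg_endpoints(1)[of "rp ?K" "l1 @ [q]"] rK unfolding L_def Areg_def by force
    show "L - Areg k \<noteq> {}" using pimg_endpoints(3)[of q "rp ?K" l1] qR unfolding L_def Areg_def by force
  qed (simp add: L_def del: pimg_Cons)
  then obtain u where u: "u \<in> L" "u \<in> frontier (Areg k)" by blast
  have "u \<noteq> rp ?K"
  proof
    assume "u = rp ?K"
    moreover have "open (Areg k)" unfolding Areg_def
      by (intro open_Collect_disj open_Collect_conj open_Collect_less continuous_intros)
    moreover have "rp ?K \<in> Areg k" using rK by (simp add: Areg_def)
    ultimately show False using u(2) by (simp add: frontier_def interior_open)
  qed
  then have "u \<in> KL k" using u LC C\<Omega> frontier_Areg[OF km] by blast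
  then have LK: "L \<inter> KL k \<noteq> {}" using u by blast
  have KLne: "rp ?K \<notin> KL k" "q \<notin> KL k" using rK qR by (auto simp: mem_KL)
  \<comment> \<open>The last contact with the gate is taken so that the remaining stretch meets the
    segment from the root to \<open>x\<close>, which lies in the gate, only in
    \<open>x\<close>.\<close>
  obtain x a1 a2 where x: "x \<in> KL k" "length a1 + length a2 \<le> length l1"
     "arc (polyline (rp ?K # a1 @ [x]))" "arc (polyline (x # a2 @ [q]))"
     "pimg (rp ?K # a1 @ [x]) \<union> pimg (x # a2 @ [q]) = L"
     "pimg (rp ?K # a1 @ [x]) \<inter> pimg (x # a2 @ [q]) = {x}" "pimg (x # a2 @ [q]) \<inter> KL k = {x}"
    using polyline_last_hit[OF q(3) _ KLne] LK unfolding L_def KL_def by (metis closed_segment)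
  have a1: "3 \<le> length a1"
  proof (rule trunk_bends[of ?K "rp ?K" x])
    fix z assume z: "z \<in> pimg (rp ?K # a1 @ [x])" "Re z \<le> 12 * real ?K + 11"
    then have "z \<noteq> rp ?K" using rK by auto
    then show "z \<in> \<Omega>" using z x(5) LC C\<Omega> by blast
  qed (use k x(1) in \<open>auto simp: rp_def mem_KL\<close>)
  define M where "M = pimg (x # a2 @ [q])"
  have M_sub: "M \<subseteq> L" using x(5) M_def by blast
  have xr: "x \<noteq> rp ?K" using x(1) KLne by blast
  have rM: "rp ?K \<notin> M" using x(6) xr pimg_endpoints(1)[of "rp ?K" "a1 @ [x]"] unfolding M_def by (metis IntI singletonD)
  have M\<Omega>: "M \<subseteq> \<Omega>" using M_sub LC rM C\<Omega> by blast
  have xM: "x \<in> M" "q \<in> M" by (auto simp: M_def simp del: pimg_Cons)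
  have d1: "length (bd (es k)) \<le> length a2 + 2"
  proof (rule detour[OF g km x(4)])
    show "pimg (x # a2 @ [q]) \<subseteq> \<Omega>" using M\<Omega> by (simp add: M_def)
    show "x \<in> strip k" using KL_\<Omega>[OF km x(1)] xM M\<Omega> by blast
    show "q \<in> tipseg k" by (rule q(1))
    have "closed_segment (rp k) x \<subseteq> KL k" using x(1) by (simp add: KL_def subset_closed_segment)
    then show "pimg (x # a2 @ [q]) \<inter> closed_segment (rp k) x \<subseteq> {x}" using x(7) by blast
    show "pimg (x # a2 @ [q]) \<inter> tipseg k \<subseteq> {q}" using q(7) M_sub unfolding M_def L_def by blast
    show "tp j \<notin> pimg (x # a2 @ [q])" if "j < m" for j
      using tipC[OF that] tL M_sub LC unfolding M_def by blast
    show "pimg (x # a2 @ [q]) \<inter> curve bd j = {}" if "j < k" for j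
      using dis[OF that] M_sub LC unfolding M_def by blast
  qed

  \<comment> \<open>The rest of the edge starts on \<open>tipseg k\<close> and may come back to it.
    The stretch wanted runs from the last such contact to the first contact with the mouth of the
    nook; as it leads towards the root, it is reversed before \<open>detour\<close> is
    applied.\<close>
  have "R \<inter> tipseg k \<noteq> {}" using q(1) pimg_endpoints(1)[of q "l2 @ [tp ?K]"] unfolding R_def by blast
  then obtain q' r where q': "q' \<in> tipseg k" "length r \<le> length l2" "arc (polyline (q' # r @ [tp ?K]))"
     "pimg (q' # r @ [tp ?K]) \<subseteq> R" "pimg (q' # r @ [tp ?K]) \<inter> tipseg k = {q'}"
    using polyline_last_hit_suffix[OF q(4) clt out(2)] unfolding R_def by metis
  define R' where "R' = pimg (q' # r @ [tp ?K])"
  have q'R: "Re q' = 12 * real k + 2" using q'(1) mem_tipseg by blast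
  have "R' \<inter> frontier (Nreg k) \<noteq> {}"
  proof (rule connected_Int_frontier)
    have "tp ?K \<in> Nreg k" by (simp add: Nreg_def tp_def)
    then show "R' \<inter> Nreg k \<noteq> {}" using pimg_endpoints(3)[of "tp ?K" q' r] unfolding R'_def by blast
    have "q' \<notin> Nreg k" using q'R by (simp add: Nreg_def)
    then show "R' - Nreg k \<noteq> {}" using pimg_endpoints(1)[of q' "r @ [tp ?K]"] unfolding R'_def by blast
  qed (simp add: R'_def del: pimg_Cons)
  then have RK: "R' \<inter> KR k \<noteq> {}" using frontier_Nreg[OF km] q'(4) R\<Omega> unfolding R'_def by blast
  have KRne: "q' \<notin> KR k" "tp ?K \<notin> KR k" using q'R by (auto simp: mem_KR tp_def)
  obtain y b1 b2 where y: "y \<in> KR k" "length b1 + length b2 \<le> length r"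
     "arc (polyline (q' # b1 @ [y]))"
     "pimg (q' # b1 @ [y]) \<union> pimg (y # b2 @ [tp ?K]) = R'"
     "pimg (q' # b1 @ [y]) \<inter> pimg (y # b2 @ [tp ?K]) = {y}" "pimg (q' # b1 @ [y]) \<inter> KR k = {y}"
    using polyline_first_hit[OF q'(3) _ KRne] RK unfolding R'_def KR_def by (metis closed_segment)
  define M' where "M' = pimg (y # rev b1 @ [q'])"
  have M'_eq: "M' = pimg (q' # b1 @ [y])" unfolding M'_def polyline_swap_ends ..
  have M_sub': "M' \<subseteq> R'" using y(4) M'_eq by blast
  have RR: "R' \<subseteq> R" using q'(4) R'_def by simp
  have M'\<Omega>: "M' \<subseteq> \<Omega>" using M_sub' RR R\<Omega> by blast
  have "tp ?K \<noteq> y" using y(1) KRne by blast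
  then have tM: "tp ?K \<notin> M'" using y(5) pimg_endpoints(3)[of "tp ?K" y b2] unfolding M'_eq by (metis IntI singletonD)
  have yM: "y \<in> M'" by (simp add: M'_def del: pimg_Cons)
  have d2: "length (bd (es k)) \<le> length (rev b1) + 2"
  proof (rule detour[OF g km, of y "rev b1" q'])
    show "arc (polyline (y # rev b1 @ [q']))" using y(3) by (simp add: polyline_swap_ends)
    show "pimg (y # rev b1 @ [q']) \<subseteq> \<Omega>" using M'\<Omega> by (simp add: M'_def)
    show "y \<in> strip k" using KR_\<Omega>[OF km y(1)] yM M'\<Omega> by blast
    show "q' \<in> tipseg k" by (rule q'(1))
    have "closed_segment (rp k) y \<subseteq> KR k" using y(1) by (simp add: KR_def subset_closed_segment)
    then show "pimg (y # rev b1 @ [q']) \<inter> closed_segment (rp k) y \<subseteq> {y}" using y(6) M'_eq unfolding M'_def by blast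
    show "pimg (y # rev b1 @ [q']) \<inter> tipseg k \<subseteq> {q'}" using q'(5) M_sub' unfolding M'_def R'_def by blast
    show "tp j \<notin> pimg (y # rev b1 @ [q'])" if "j < m" for j
      using tipC[OF that] tM M_sub' RR LC unfolding M'_def by blast
    show "pimg (y # rev b1 @ [q']) \<inter> curve bd j = {}" if "j < k" for j
      using dis[OF that] M_sub' RR LC unfolding M'_def by blast
  qed
  have "length bs = length (bd (es ?K))" by (simp add: bs_def)
  then show ?thesis using d1 d2 a1 q(2) x(2) q'(2) y(2) by simp
qed

text \<open>The root and the tip of the first edge lie on opposite sides of the baffles in columns 5
  to 11.\<close>

lemma first_spike_bends:
  assumes g: "greedy bd" and m: "0 < m"
  shows "3 \<le> length (bd (es 0))"
proof -
  have "3 \<le> length (rev (bd (es 0)))"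
  proof (rule trunk_bends[of 0 "rp 0" "tp 0"])
    fix z assume z: "z \<in> pimg (rp 0 # rev (bd (es 0)) @ [tp 0])" "Re z \<le> 12 * real 0 + 11"
    then have "z \<noteq> rp 0" by (auto simp: rp_def)
    then show "z \<in> \<Omega>" using z(1) curve_\<Omega>[OF g m] unfolding curve_def by blast
  qed (auto simp: rp_def tp_def)
  then show ?thesis by simp
qed

text \<open>The number of bends minus 1 is at least 2 at the start and at least doubles in every
  step.\<close>

lemma exponential_bends:
  assumes g: "greedy bd"
  shows "k < m \<Longrightarrow> 2 ^ (k + 1) + 1 \<le> length (bd (es k))"
proof (induction k)
  case 0
  then show ?case using first_spike_bends[OF g] by simp
next
  case (Suc k)
  then show ?case using doubling[OF g, of k] by simp
qed

end

theorem theorem3: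
  shows "\<exists>c::real. c > 0 \<and> (\<exists>n0::nat. \<forall>n \<ge> n0.
     \<exists>E p0 bd0 p \<sigma>.
       simple_graph {..<n} E \<and> planar_drawing {..<n} E p0 bd0 \<and>
       inj_on p {..<n} \<and>
       distinct \<sigma> \<and> set \<sigma> = E \<and>
       (\<forall>bd. greedily_extends {..<n} E p0 bd0 {} p \<sigma> bd \<longrightarrow>
          (\<exists>e\<in>E. real (length (bd e)) \<ge> 2 powr (c * real n))))"
proof (rule exI[of _ "1 / 288"], rule conjI, simp, rule exI[of _ 288], intro allI impI)
  fix n :: nat assume n: "288 \<le> n"
  \<comment> \<open>For \<open>n \<ge> 288\<close> this gives \<open>m \<ge> 2\<close>, so
    \<open>72 * m + 78 \<le> 144 * m \<le> n\<close> as the maze demands. Conversely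
    \<open>n < 144 * (m + 1) \<le> 288 * m\<close>, whence the constant 1/288.\<close>
  define m where "m = n div 144"
  interpret maze m n by unfold_locales (use n in \<open>simp add: m_def\<close>)
  let ?E = "EW \<union> es ` {..<m}"
  have m1: "1 \<le> m" using n by (simp add: m_def)
  have "n < 144 * (m + 1)" unfolding m_def by simp
  then have "real n < real (144 * (m + 1))" by (simp only: of_nat_less_iff)
  then have "real n < 144 * real m + 144" by simp
  then have mn: "1 / 288 * real n \<le> real m" using m1 by simp
  have sg: "simple_graph {..<n} ?E"
    unfolding simple_graph_def using EW_subset EW_card es_subset es_card by auto
  have ip: "inj_on p {..<n}" using inj_p by (rule inj_on_subset) simp
  have many: "\<exists>e\<in>?E. real (length (bd e)) \<ge> 2 powr (1 / 288 * real n)"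
    if "greedily_extends {..<n} ?E p0 (\<lambda>_. []) {} p \<sigma> bd" for bd
  proof
    have "greedy bd" using that by (simp add: greedy_def)
    moreover have mm: "m - 1 < m" "m - 1 + 1 = m" using m1 by auto
    ultimately have "2 ^ m + 1 \<le> length (bd (es (m - 1)))"
      using exponential_bends[of bd "m - 1"] unfolding mm(2) by blast
    then have "(2::nat) ^ m \<le> length (bd (es (m - 1)))" by simp
    then have "real (2 ^ m) \<le> real (length (bd (es (m - 1))))" by (simp only: of_nat_le_iff)
    then have "(2::real) ^ m \<le> real (length (bd (es (m - 1))))" by simp
    moreover have "2 powr (1 / 288 * real n) \<le> 2 powr real m" using mn by (intro powr_mono) auto
    moreover have "(2::real) powr real m = 2 ^ m" by (simp add: powr_realpow)
    ultimately show "real (length (bd (es (m - 1)))) \<ge> 2 powr (1 / 288 * real n)" by linarith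
    show "es (m - 1) \<in> ?E" using m1 by auto
  qed
  show "\<exists>E p0 bd0 p \<sigma>.
     simple_graph {..<n} E \<and> planar_drawing {..<n} E p0 bd0 \<and>
     inj_on p {..<n} \<and>
     distinct \<sigma> \<and> set \<sigma> = E \<and>
     (\<forall>bd. greedily_extends {..<n} E p0 bd0 {} p \<sigma> bd \<longrightarrow>
        (\<exists>e\<in>E. real (length (bd e)) \<ge> 2 powr (1 / 288 * real n)))"
    by (rule exI[of _ ?E], rule exI[of _ p0], rule exI[of _ "\<lambda>_. []"], rule exI[of _ p], rule exI[of _ \<sigma>])
      (intro conjI allI impI sg reference_planar ip distinct_\<sigma> set_\<sigma> many)
qed

end
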